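(* Let $\theta=(\{\theta_s\}_{s\in S},\{X_s\}_{s\in S})$ be a topologically free action of an inverse semigroup $S$ on a locally compact, Hausdorff, zero-dimensional space $X$, and let $\mathcal O$ be an $S\ltimes X$-sheaf of fields. If $S\ltimes X$ is Hausdorff, then $\theta$ has a dense orbit if, and only if, $\Gamma_c(S\ltimes X,\mathcal O)$ is left primitive.
   Context: "Compact" includes Hausdorff. Zero-dimensional: having a basis of compact open sets. An action $\theta$ of an inverse semigroup $S$ on $X$ is a semigroup homomorphism $s\mapsto\theta_s$ to the inverse semigroup of homeomorphisms between open subsets of $X$, where $\theta_s:X_{s^*}\to X_s$, and such that $\bigcup_{s\in S}X_s=X$. The orbit of $x$ is $\{\theta_s(x): s\in S,\ x\in X_{s^*}\}$. $\theta$ is topologically free if for every $s\in S$ the interior of $\{x\in X_{s^*}\mid\theta_s(x)=x\}$ equals $\{x\in X_{s^*}\mid \text{there is an idempotent } e\in E(S) \text{ with } e\le s \text{ and } x\in X_e\}$. Groupoid of germs $S\ltimes X$: unit space $X$; arrows are classes $[s,x]$ of pairs $(s,x)\in S\times X$ with $x\in X_{s^*}$, where $(s,x)\sim(t,y)$ iff $x=y$ and there is $u\le s,t$ with $x\in X_{u^*}$; $\boldsymbol d([s,x])=x$, $\boldsymbol r([s,x])=\theta_s(x)$, $[s,\theta_t(x)][t,x]=[st,x]$, $[s,x]^{-1}=[s^*,\theta_s(x)]$; basic open sets $(s,U)=\{[s,x]:x\in U\}$ for $U\subseteq X_{s^*}$ open. It is an ample groupoid: a topological groupoid with locally compact Hausdorff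 unit space having a basis of compact open sets and with $\boldsymbol r$ a local homeomorphism. For an ample groupoid $\mathscr G$: a bisection is a subset on which $\boldsymbol d$ and $\boldsymbol r$ are injective. A $\mathscr G$-sheaf $(E,p,\alpha)$ is a space $E$, a local homeomorphism $p:E\to\mathscr G^{(0)}$ and a continuous map $\alpha:\mathscr G\times_{\boldsymbol d,p}E\to E$, $(\gamma,e)\mapsto\alpha_\gamma(e)$, with $\alpha_{p(e)}(e)=e$, $p(\alpha_\gamma(e))=\boldsymbol r(\gamma)$, and $\alpha_\beta(\alpha_\gamma(e))=\alpha_{\beta\gamma}(e)$ whenever defined. A $\mathscr G$-sheaf of rings $\mathcal O=(E,p,\alpha)$ is a $\mathscr G$-sheaf with a unital ring structure on each stalk $\mathcal O_x=p^{-1}(x)$ such that fiberwise addition and multiplication $E\times_{p,p}E\to E$ and the unit section $x\mapsto1_x$ are continuous, and each $\alpha_\gamma:\mathcal O_{\boldsymbol d(\gamma)}\to\mathcal O_{\boldsymbol r(\gamma)}$ is a (unital) ring homomorphism; it is a sheaf of fields if all stalks are fields. $\Gamma_c(\mathscr G,\mathcal O)$ is the additive group generated by all maps $f:\mathscr G\to E$ with $p\circ f=\boldsymbol r$ for which there is a compact open bisection $U$ with $f|_U$ continuous and $f=0$ off $U$; it is a ring under pointwise addition and convolution $(f*g)(\gamma)=\sum_{\beta\rho=\gamma}f(\beta)\alpha_\beta(g(\rho))$. A ring $R$ is left primitive if it has a faithful simple left module; a simple left $R$-module is a module $N$ with $RN\neq 0$ whose only submodules are $0$ and $N$. *)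

theory Defs
  imports "HOL-Analysis.Analysis" "HOL-Algebra.Module" "HOL-Algebra.Generated_Groups"
begin

section \<open>Inverse semigroups\<close>

class inverse_semigroup = semigroup_mult +
  assumes ex1_inverse: "\<exists>!t. s * t * s = s \<and> t * s * t = t"

definition star :: "'s::inverse_semigroup \<Rightarrow> 's" where
  "star s = (THE t. s * t * s = s \<and> t * s * t = t)"

definition idem :: "'s::inverse_semigroup \<Rightarrow> bool" where
  "idem e \<longleftrightarrow> e * e = e"

definition natural_le :: "'s::inverse_semigroup \<Rightarrow> 's \<Rightarrow> bool" (infix \<open>\<preceq>\<close> 50) where
  "s \<preceq> t \<longleftrightarrow> (\<exists>e. idem e \<and> s = t * e)"

lemma star_inverse:
  fixes s :: "'s::inverse_semigroup"
  shows "s * star s * s = s" "star s * s * star s = star s"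
  using theI'[OF ex1_inverse[of s]] unfolding star_def by auto

lemma star_unique:
  fixes s :: "'s::inverse_semigroup"
  assumes "s * t * s = s" "t * s * t = t"
  shows "star s = t"
  using ex1_inverse[of s] star_inverse[of s] assms by blast

lemma star_star [simp]: "star (star s) = (s::'s::inverse_semigroup)"
  by (rule star_unique) (simp_all add: star_inverse)

lemma star_idem: "idem e \<Longrightarrow> star e = e"
  by (rule star_unique) (simp_all add: idem_def)

lemma idem_star_mult: "idem (star s * s)" and idem_mult_star: "idem (s * star s)"
  by (simp_all add: idem_def mult.assoc[symmetric] star_inverse)

lemma idem_mult:
  fixes e f :: "'s::inverse_semigroup"
  assumes "idem e" "idem f"
  shows "idem (e * f)"
proof -
  define a where "a = star (e * f)"
  have ee: "e * e = e" "\<And>x. e * (e * x) = e * x" and ff: "f * f = f" "\<And>x. f * (f * x) = f * x"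
    using assms by (auto simp: idem_def mult.assoc[symmetric])
  have a: "e * f * a * (e * f) = e * f" "a * (e * f) * a = a"
    unfolding a_def by (rule star_inverse)+
  have "star (e * f) = f * a * e"
  proof (rule star_unique)
    show "e * f * (f * a * e) * (e * f) = e * f"
      using a(1) by (simp add: mult.assoc ee ff)
    have "f * a * e * (e * f) * (f * a * e) = f * (a * (e * f) * a) * e"
      by (simp add: mult.assoc ee ff)
    then show "f * a * e * (e * f) * (f * a * e) = f * a * e"
      using a(2) by simp
  qed
  then have afae: "a = f * a * e" by (simp add: a_def)
  have "a * a = f * a * e * (f * a * e)" using afae by simp
  also have "\<dots> = f * (a * (e * f) * a) * e" by (simp add: mult.assoc)
  finally have "idem a" using a(2) afae by (simp add: idem_def)
  then have "star a = a" by (rule star_idem)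
  then have "e * f = a" unfolding a_def by simp
  with \<open>idem a\<close> show ?thesis by simp
qed

lemma idem_commute:
  fixes e f :: "'s::inverse_semigroup"
  assumes "idem e" "idem f"
  shows "e * f = f * e"
proof -
  have ee: "e * e = e" "\<And>x. e * (e * x) = e * x" and ff: "f * f = f" "\<And>x. f * (f * x) = f * x"
    using assms by (auto simp: idem_def mult.assoc[symmetric])
  have 1: "e * (f * (e * f)) = e * f" and 2: "f * (e * (f * e)) = f * e"
    using idem_mult[OF assms] idem_mult[OF assms(2,1)] by (simp_all add: idem_def mult.assoc)
  have "star (e * f) = f * e"
    by (rule star_unique) (simp_all add: mult.assoc ee ff 1 2)
  with star_idem[OF idem_mult[OF assms]] show ?thesis by simp
qed

lemma idem_conj:
  fixes e t :: "'s::inverse_semigroup"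
  assumes "idem e"
  shows "idem (star t * e * t)" "t * (star t * e * t) = e * t"
proof -
  have c: "t * star t * e = e * (t * star t)"
    using idem_commute[OF idem_mult_star assms] by simp
  have "t * (star t * e * t) = t * star t * e * t" by (simp add: mult.assoc)
  also have "\<dots> = e * (t * star t * t)" unfolding c by (simp add: mult.assoc)
  finally show *: "t * (star t * e * t) = e * t" by (simp add: star_inverse)
  have "star t * e * t * (star t * e * t) = star t * e * (t * (star t * e * t))"
    by (simp add: mult.assoc)
  also have "\<dots> = star t * (e * e) * t" unfolding * by (simp add: mult.assoc)
  finally show "idem (star t * e * t)" using assms by (simp add: idem_def)
qed

lemma star_mult:
  fixes s t :: "'s::inverse_semigroup"
  shows "star (s * t) = star t * star s"
proof (rule star_unique)
  have c: "t * star t * (star s * s) = star s * s * (t * star t)"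
    by (rule idem_commute[OF idem_mult_star idem_star_mult])
  have "s * t * (star t * star s) * (s * t) = s * (t * star t * (star s * s)) * t"
    by (simp add: mult.assoc)
  also have "\<dots> = (s * star s * s) * (t * star t * t)" unfolding c by (simp add: mult.assoc)
  finally show "s * t * (star t * star s) * (s * t) = s * t" by (simp add: star_inverse)
  have "star t * star s * (s * t) * (star t * star s)
      = star t * (star s * s * (t * star t)) * star s"
    by (simp add: mult.assoc)
  also have "\<dots> = (star t * t * star t) * (star s * s * star s)"
    unfolding c[symmetric] by (simp add: mult.assoc)
  finally show "star t * star s * (s * t) * (star t * star s) = star t * star s"
    by (simp add: star_inverse)
qed

lemma natural_le_mult:
  assumes "u \<preceq> s" "v \<preceq> t"
  shows "u * v \<preceq> s * t"
proof -
  obtain e f where e: "idem e" "u = s * e" and f: "idem f" "v = t * f"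
    using assms by (auto simp: natural_le_def)
  have "u * v = s * (e * t) * f" by (simp add: e f mult.assoc)
  also have "\<dots> = s * t * (star t * e * t * f)"
    unfolding idem_conj(2)[OF e(1), of t, symmetric] by (simp add: mult.assoc)
  finally show ?thesis
    using idem_mult[OF idem_conj(1)[OF e(1)] f(1)] by (auto simp: natural_le_def)
qed

lemma natural_le_star:
  assumes "u \<preceq> s"
  shows "star u \<preceq> star s"
proof -
  obtain e where e: "idem e" "u = s * e"
    using assms by (auto simp: natural_le_def)
  have "star u = e * star s" by (simp add: e star_mult star_idem)
  then show ?thesis
    using idem_conj[OF e(1), of "star s"] by (auto simp: natural_le_def)
qed

lemma natural_le_refl: "s \<preceq> s"
  using idem_star_mult[of s] star_inverse(1)[of s]
  by (auto simp: natural_le_def mult.assoc intro!: exI[of _ "star s * s"])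

lemma natural_le_trans: "u \<preceq> s \<Longrightarrow> s \<preceq> t \<Longrightarrow> u \<preceq> t"
  unfolding natural_le_def by (metis idem_mult mult.assoc)


section \<open>Actions of inverse semigroups\<close>

text \<open>In what follows, \<open>D s\<close> is the open set $X_s$ and \<open>\<theta> s\<close> represents the partial homeomorphism
  $\theta_s : X_{s^*} \to X_s$; the values of \<open>\<theta> s\<close> outside \<open>D (star s)\<close> are irrelevant.
  The conditions on \<open>s * t\<close> say that $\theta_{st}$ is the composite of the partial maps
  $\theta_s$ and $\theta_t$, on its largest domain of definition.\<close>

definition inverse_semigroup_action ::
  "'x topology \<Rightarrow> ('s::inverse_semigroup \<Rightarrow> 'x set) \<Rightarrow> ('s \<Rightarrow> 'x \<Rightarrow> 'x) \<Rightarrow> bool" where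
  "inverse_semigroup_action X D \<theta> \<longleftrightarrow>
     (\<forall>s. openin X (D s)) \<and>
     (\<forall>s. homeomorphic_map (subtopology X (D (star s))) (subtopology X (D s)) (\<theta> s)) \<and>
     (\<forall>s t. D (star (s * t)) = {x \<in> D (star t). \<theta> t x \<in> D (star s)}) \<and>
     (\<forall>s t. \<forall>x \<in> D (star (s * t)). \<theta> (s * t) x = \<theta> s (\<theta> t x)) \<and>
     (\<Union>s. D s) = topspace X"

definition act_orbit :: "('s::inverse_semigroup \<Rightarrow> 'x set) \<Rightarrow> ('s \<Rightarrow> 'x \<Rightarrow> 'x) \<Rightarrow> 'x \<Rightarrow> 'x set" where
  "act_orbit D \<theta> x = {\<theta> s x |s. x \<in> D (star s)}"

definition topologically_free ::
  "'x topology \<Rightarrow> ('s::inverse_semigroup \<Rightarrow> 'x set) \<Rightarrow> ('s \<Rightarrow> 'x \<Rightarrow> 'x) \<Rightarrow> bool" where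
  "topologically_free X D \<theta> \<longleftrightarrow>
     (\<forall>s. X interior_of {x \<in> D (star s). \<theta> s x = x} =
          {x \<in> D (star s). \<exists>e. idem e \<and> e \<preceq> s \<and> x \<in> D e})"


section \<open>Topological notions\<close>

text \<open>Compact sets are Hausdorff by convention, which matters in non-Hausdorff groupoids.\<close>

definition compact_Hausdorffin :: "'a topology \<Rightarrow> 'a set \<Rightarrow> bool" where
  "compact_Hausdorffin T K \<longleftrightarrow> compactin T K \<and> Hausdorff_space (subtopology T K)"

definition zero_dimensional :: "'a topology \<Rightarrow> bool" where
  "zero_dimensional T \<longleftrightarrow>
     openin T = arbitrary union_of (\<lambda>K. openin T K \<and> compact_Hausdorffin T K)"

definition local_homeomorphism :: "'a topology \<Rightarrow> 'b topology \<Rightarrow> ('a \<Rightarrow> 'b) \<Rightarrow> bool" where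
  "local_homeomorphism T T' p \<longleftrightarrow>
     (\<forall>a \<in> topspace T. \<exists>U. openin T U \<and> a \<in> U \<and> openin T' (p ` U) \<and>
        homeomorphic_map (subtopology T U) (subtopology T' (p ` U)) p)"


section \<open>Topological groupoids and groupoids of germs\<close>

text \<open>The unit space is kept as a space of its own, embedded in the space of arrows by
  \<open>gunit\<close>. The product \<open>gcomp G \<beta> \<gamma>\<close> is meaningful when \<open>gdom G \<beta> = grng G \<gamma>\<close>.\<close>

record ('g, 'x) top_groupoid =
  arrow_topology :: "'g topology"
  unit_topology :: "'x topology"
  gunit :: "'x \<Rightarrow> 'g"
  gdom :: "'g \<Rightarrow> 'x"
  grng :: "'g \<Rightarrow> 'x"
  gcomp :: "'g \<Rightarrow> 'g \<Rightarrow> 'g"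
  ginv :: "'g \<Rightarrow> 'g"

abbreviation arrows :: "('g, 'x) top_groupoid \<Rightarrow> 'g set" where
  "arrows G \<equiv> topspace (arrow_topology G)"

definition germ_rel :: "('s::inverse_semigroup \<Rightarrow> 'x set) \<Rightarrow> (('s \<times> 'x) \<times> ('s \<times> 'x)) set" where
  "germ_rel D = {((s, x), (t, y)). x \<in> D (star s) \<and> y \<in> D (star t) \<and>
     x = y \<and> (\<exists>u. u \<preceq> s \<and> u \<preceq> t \<and> x \<in> D (star u))}"

definition germ :: "('s::inverse_semigroup \<Rightarrow> 'x set) \<Rightarrow> 's \<Rightarrow> 'x \<Rightarrow> ('s \<times> 'x) set" where
  "germ D s x = germ_rel D `` {(s, x)}"

definition slice :: "('s::inverse_semigroup \<Rightarrow> 'x set) \<Rightarrow> 's \<Rightarrow> 'x set \<Rightarrow> ('s \<times> 'x) set set" where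
  "slice D s U = germ D s ` U"

text \<open>The structure maps are defined by all representatives at once; each set to which
  \<open>the_elem\<close> is applied is a singleton (see the lemmas \<open>gdom_germ\<close> to \<open>gunit_germ\<close> below).\<close>

definition germ_groupoid ::
  "'x topology \<Rightarrow> ('s::inverse_semigroup \<Rightarrow> 'x set) \<Rightarrow> ('s \<Rightarrow> 'x \<Rightarrow> 'x)
    \<Rightarrow> (('s \<times> 'x) set, 'x) top_groupoid" where
  "germ_groupoid X D \<theta> = \<lparr>
     arrow_topology = topology_generated_by {slice D s U |s U. openin X U \<and> U \<subseteq> D (star s)},
     unit_topology = X,
     gunit = (\<lambda>x. the_elem {germ D e x |e. idem e \<and> x \<in> D e}),
     gdom = (\<lambda>\<gamma>. the_elem {x. \<exists>s. (s, x) \<in> \<gamma>}),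
     grng = (\<lambda>\<gamma>. the_elem {\<theta> s x |s x. (s, x) \<in> \<gamma>}),
     gcomp = (\<lambda>\<beta> \<gamma>. the_elem {germ D (s * t) x |s t x. (s, \<theta> t x) \<in> \<beta> \<and> (t, x) \<in> \<gamma>}),
     ginv = (\<lambda>\<gamma>. the_elem {germ D (star s) (\<theta> s x) |s x. (s, x) \<in> \<gamma>}) \<rparr>"

context
  fixes X :: "'x topology" and D :: "'s::inverse_semigroup \<Rightarrow> 'x set" and \<theta> :: "'s \<Rightarrow> 'x \<Rightarrow> 'x"
  assumes act: "inverse_semigroup_action X D \<theta>"
begin

lemma act_open: "openin X (D s)"
  and act_homeo: "homeomorphic_map (subtopology X (D (star s))) (subtopology X (D s)) (\<theta> s)"
  and act_dom: "D (star (s * t)) = {x \<in> D (star t). \<theta> t x \<in> D (star s)}"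
  and act_mult: "x \<in> D (star (s * t)) \<Longrightarrow> \<theta> (s * t) x = \<theta> s (\<theta> t x)"
  and act_cover: "(\<Union>s. D s) = topspace X"
  using act by (auto simp: inverse_semigroup_action_def)

lemma act_subset: "D s \<subseteq> topspace X"
  using act_open openin_subset by blast

lemma act_image: "\<theta> s ` D (star s) = D s"
  using homeomorphic_imp_surjective_map[OF act_homeo[of s]] act_subset
  by (simp add: Int_absorb1)

lemma act_inj: "inj_on (\<theta> s) (D (star s))"
  using homeomorphic_imp_injective_map[OF act_homeo[of s]] act_subset
  by (simp add: Int_absorb1)

lemma act_idem:
  assumes "idem e" "x \<in> D e"
  shows "\<theta> e x = x"
proof -
  have x: "x \<in> D (star e)" "x \<in> D (star (e * e))"
    using assms by (simp_all add: star_idem idem_def)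
  then have "\<theta> e (\<theta> e x) = \<theta> e x" "\<theta> e x \<in> D (star e)"
    using act_mult[of x e e] act_dom[of e e] assms(1) by (auto simp: idem_def)
  with x(1) show ?thesis using act_inj[of e] by (auto dest: inj_onD)
qed

lemma act_mult_idem:
  assumes "idem e"
  shows "x \<in> D (star (s * e)) \<longleftrightarrow> x \<in> D (star s) \<and> x \<in> D e"
    and "x \<in> D (star (s * e)) \<Longrightarrow> \<theta> (s * e) x = \<theta> s x"
proof -
  have *: "x \<in> D (star (s * e)) \<longleftrightarrow> x \<in> D e \<and> \<theta> e x \<in> D (star s)"
    unfolding act_dom star_idem[OF assms] by blast
  show **: "x \<in> D (star (s * e)) \<longleftrightarrow> x \<in> D (star s) \<and> x \<in> D e"
    unfolding * by (metis act_idem[OF assms])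
  show "\<theta> (s * e) x = \<theta> s x" if "x \<in> D (star (s * e))"
    using act_mult[OF that] act_idem[OF assms, of x] that ** by simp
qed

lemma act_le:
  assumes "u \<preceq> s" "x \<in> D (star u)"
  shows "x \<in> D (star s)" "\<theta> u x = \<theta> s x"
  using assms act_mult_idem by (auto simp: natural_le_def)

lemma act_star:
  assumes "x \<in> D (star s)"
  shows "\<theta> s x \<in> D s" "\<theta> (star s) (\<theta> s x) = x"
proof -
  show 1: "\<theta> s x \<in> D s" using act_image assms by blast
  have "x \<in> D (star (star s * s))" using act_dom[of "star s" s] assms 1 by simp
  then show "\<theta> (star s) (\<theta> s x) = x"
    using act_mult[of x "star s" s] act_idem[OF idem_star_mult, of x s]
      star_idem[OF idem_star_mult, of s] by simp
qed

lemma equiv_germ_rel: "equiv {(s, x). x \<in> D (star s)} (germ_rel D)"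
proof (rule equivI)
  show "germ_rel D \<subseteq> {(s, x). x \<in> D (star s)} \<times> {(s, x). x \<in> D (star s)}"
    by (auto simp: germ_rel_def)
  show "refl_on {(s, x). x \<in> D (star s)} (germ_rel D)"
    by (auto simp: refl_on_def germ_rel_def intro: natural_le_refl)
  show "sym (germ_rel D)"
    by (auto simp: sym_def germ_rel_def)
  show "trans (germ_rel D)"
  proof (rule transI, clarsimp simp: germ_rel_def)
    fix s t w u v x
    assume u: "u \<preceq> s" "u \<preceq> t" "x \<in> D (star u)" and v: "v \<preceq> t" "v \<preceq> w" "x \<in> D (star v)"
    obtain e f where e: "idem e" "u = t * e" and f: "idem f" "v = t * f"
      using u v by (auto simp: natural_le_def)
    have "u * f = v * e" using idem_commute[OF e(1) f(1)] by (simp add: e f mult.assoc)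
    then have "u * f \<preceq> s" "u * f \<preceq> w"
      using u v e f by (metis natural_le_def natural_le_trans)+
    moreover have "x \<in> D (star (u * f))"
      using u v e f act_mult_idem by auto
    ultimately show "\<exists>u. u \<preceq> s \<and> u \<preceq> w \<and> x \<in> D (star u)" by blast
  qed
qed

lemma germ_eq_iff:
  assumes "x \<in> D (star s)" "y \<in> D (star t)"
  shows "germ D s x = germ D t y \<longleftrightarrow> x = y \<and> (\<exists>u. u \<preceq> s \<and> u \<preceq> t \<and> x \<in> D (star u))"
  unfolding germ_def
  by (subst eq_equiv_class_iff[OF equiv_germ_rel]) (use assms in \<open>auto simp: germ_rel_def\<close>)

lemma mem_germ_iff:
  assumes "x \<in> D (star s)"
  shows "(t, y) \<in> germ D s x \<longleftrightarrow> y \<in> D (star t) \<and> germ D t y = germ D s x"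
proof -
  have "(t, y) \<in> germ D s x \<longleftrightarrow> y \<in> D (star t) \<and> x = y \<and> (\<exists>u. u \<preceq> s \<and> u \<preceq> t \<and> x \<in> D (star u))"
    using assms by (auto simp: germ_def germ_rel_def)
  then show ?thesis using germ_eq_iff[OF assms, of y t] by metis
qed

lemma mem_germD:
  assumes "x \<in> D (star s)" "(t, y) \<in> germ D s x"
  shows "y = x" "x \<in> D (star t)" "\<theta> t x = \<theta> s x"
    and "\<exists>u. u \<preceq> s \<and> u \<preceq> t \<and> x \<in> D (star u)"
proof -
  have "x = y \<and> x \<in> D (star t) \<and> (\<exists>u. u \<preceq> s \<and> u \<preceq> t \<and> x \<in> D (star u))"
    using assms by (auto simp: germ_def germ_rel_def)
  then show "y = x" "x \<in> D (star t)" "\<exists>u. u \<preceq> s \<and> u \<preceq> t \<and> x \<in> D (star u)" by auto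
  then show "\<theta> t x = \<theta> s x" using act_le by metis
qed

lemma germ_self: "x \<in> D (star s) \<Longrightarrow> (s, x) \<in> germ D s x"
  by (simp add: mem_germ_iff)

lemma gdom_germ:
  assumes "x \<in> D (star s)"
  shows "gdom (germ_groupoid X D \<theta>) (germ D s x) = x"
proof -
  have "{y. \<exists>t. (t, y) \<in> germ D s x} = {x}"
    by (auto dest: mem_germD(1)[OF assms] intro: germ_self[OF assms])
  then show ?thesis by (simp add: germ_groupoid_def)
qed

lemma grng_germ:
  assumes "x \<in> D (star s)"
  shows "grng (germ_groupoid X D \<theta>) (germ D s x) = \<theta> s x"
proof -
  have "{\<theta> t y |t y. (t, y) \<in> germ D s x} = {\<theta> s x}"
    by (auto dest: mem_germD(1,3)[OF assms] intro!: exI germ_self[OF assms])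
  then show ?thesis by (simp add: germ_groupoid_def)
qed

lemma gcomp_germ:
  assumes "x \<in> D (star t)" "\<theta> t x \<in> D (star s)"
  shows "gcomp (germ_groupoid X D \<theta>) (germ D s (\<theta> t x)) (germ D t x) = germ D (s * t) x"
proof -
  have "germ D (s' * t') x' = germ D (s * t) x"
    if "(s', \<theta> t' x') \<in> germ D s (\<theta> t x)" "(t', x') \<in> germ D t x" for s' t' x'
  proof -
    note t' = mem_germD[OF assms(1) that(2)] and s' = mem_germD[OF assms(2) that(1)]
    obtain u v where u: "u \<preceq> s" "u \<preceq> s'" "\<theta> t x \<in> D (star u)"
      and v: "v \<preceq> t" "v \<preceq> t'" "x \<in> D (star v)"
      using t' s' by blast
    have "x \<in> D (star (u * v))" using u v act_le[OF v(1,3)] by (simp add: act_dom)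
    moreover have "u * v \<preceq> s * t" "u * v \<preceq> s' * t'" using u v natural_le_mult by blast+
    moreover note act_le(1)[OF calculation(2,1)] act_le(1)[OF calculation(3,1)]
    ultimately show ?thesis unfolding t'(1) by (subst germ_eq_iff) auto
  qed
  then have "{germ D (s' * t') x' |s' t' x'. (s', \<theta> t' x') \<in> germ D s (\<theta> t x) \<and> (t', x') \<in> germ D t x}
      = {germ D (s * t) x}" (is "?A = _")
  proof (intro equalityI subsetI)
    fix \<gamma> assume "\<gamma> \<in> {germ D (s * t) x}"
    then have "\<gamma> = germ D (s * t) x" by simp
    then show "\<gamma> \<in> ?A"
      using germ_self[OF assms(1)] germ_self[OF assms(2)] by (intro CollectI exI conjI)
  qed auto
  then show ?thesis unfolding germ_groupoid_def top_groupoid.simps by simp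
qed

lemma ginv_germ:
  assumes "x \<in> D (star s)"
  shows "ginv (germ_groupoid X D \<theta>) (germ D s x) = germ D (star s) (\<theta> s x)"
proof -
  have "germ D (star t) (\<theta> t y) = germ D (star s) (\<theta> s x)" if "(t, y) \<in> germ D s x" for t y
  proof -
    note t = mem_germD[OF assms that]
    obtain u where u: "u \<preceq> s" "u \<preceq> t" "x \<in> D (star u)" using t by blast
    have "\<theta> s x \<in> D (star (star u))" using act_le[OF u(1,3)] act_star[OF u(3)] by simp
    moreover have "star u \<preceq> star s" "star u \<preceq> star t" using u natural_le_star by blast+
    moreover note act_le(1)[OF calculation(2,1)] act_le(1)[OF calculation(3,1)]
    ultimately show ?thesis unfolding t(1) t(3) by (subst germ_eq_iff) auto
  qed
  then have "{germ D (star t) (\<theta> t y) |t y. (t, y) \<in> germ D s x} = {germ D (star s) (\<theta> s x)}"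
    using germ_self[OF assms] by blast
  then show ?thesis by (simp add: germ_groupoid_def)
qed

lemma gunit_germ:
  assumes "idem e" "x \<in> D e"
  shows "gunit (germ_groupoid X D \<theta>) x = germ D e x"
proof -
  have "germ D f x = germ D e x" if f: "idem f" "x \<in> D f" for f
  proof -
    have "f * e \<preceq> f" "f * e \<preceq> e"
      using assms(1) f(1) idem_commute by (auto simp: natural_le_def)
    moreover have "x \<in> D (star (f * e))" "x \<in> D (star e)" "x \<in> D (star f)"
      using assms f act_mult_idem[of e x f] by (simp_all add: star_idem)
    ultimately show ?thesis using germ_eq_iff by blast
  qed
  then have "{germ D f x |f. idem f \<and> x \<in> D f} = {germ D e x}"
    using assms by blast
  then show ?thesis by (simp add: germ_groupoid_def)
qed

lemma arrows_germ_groupoid: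
  "arrows (germ_groupoid X D \<theta>) = {germ D s x |s x. x \<in> D (star s)}"
proof -
  have "arrows (germ_groupoid X D \<theta>) = \<Union> {slice D s U |s U. openin X U \<and> U \<subseteq> D (star s)}"
    by (simp add: germ_groupoid_def)
  also have "\<dots> = (\<Union>s. slice D s (D (star s)))"
  proof (intro equalityI Union_least)
    fix W assume "W \<in> {slice D s U |s U. openin X U \<and> U \<subseteq> D (star s)}"
    then obtain s U where "W = slice D s U" "U \<subseteq> D (star s)" by auto
    then have "W \<subseteq> slice D s (D (star s))" by (simp add: slice_def image_mono)
    then show "W \<subseteq> (\<Union>s. slice D s (D (star s)))" by (rule order.trans) (rule UN_upper, simp)
  next
    fix W assume "W \<in> range (\<lambda>s. slice D s (D (star s)))"
    then show "W \<subseteq> \<Union> {slice D s U |s U. openin X U \<and> U \<subseteq> D (star s)}"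
      by (intro Union_upper) (use act_open in auto)
  qed
  also have "\<dots> = {germ D s x |s x. x \<in> D (star s)}"
    by (auto simp: slice_def)
  finally show ?thesis .
qed

lemma slices_basis:
  "openin (arrow_topology (germ_groupoid X D \<theta>)) =
     arbitrary union_of (\<lambda>W. \<exists>s U. W = slice D s U \<and> openin X U \<and> U \<subseteq> D (star s))"
proof -
  define B where "B = {slice D s U |s U. openin X U \<and> U \<subseteq> D (star s)}"
  have T: "openin (arrow_topology (germ_groupoid X D \<theta>)) W \<longleftrightarrow> generate_topology_on B W" for W
    by (simp add: germ_groupoid_def B_def openin_topology_generated_by_iff)
  have basis_Int: "\<exists>V \<in> B. \<gamma> \<in> V \<and> V \<subseteq> b1 \<inter> b2"
    if b: "b1 \<in> B" "b2 \<in> B" "\<gamma> \<in> b1" "\<gamma> \<in> b2" for b1 b2 \<gamma>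
  proof -
    obtain s U where U: "openin X U" "U \<subseteq> D (star s)" "b1 = slice D s U"
      using b(1) by (auto simp: B_def)
    obtain t V where V: "openin X V" "V \<subseteq> D (star t)" "b2 = slice D t V"
      using b(2) by (auto simp: B_def)
    obtain x where x: "\<gamma> = germ D s x" "x \<in> U" using b(3) U(3) by (auto simp: slice_def)
    obtain y where y: "\<gamma> = germ D t y" "y \<in> V" using b(4) V(3) by (auto simp: slice_def)
    have xs: "x \<in> D (star s)" and yt: "y \<in> D (star t)" using x y U V by auto
    have "x = y \<and> (\<exists>u. u \<preceq> s \<and> u \<preceq> t \<and> x \<in> D (star u))"
      unfolding germ_eq_iff[OF xs yt, symmetric] using x y by simp
    then obtain u where u: "u \<preceq> s" "u \<preceq> t" "x \<in> D (star u)" "x \<in> V" using y by auto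
    let ?W = "U \<inter> V \<inter> D (star u)"
    have *: "germ D u z = germ D r z" if "z \<in> D (star u)" "u \<preceq> r" for z r
      using that act_le(1)[OF that(2,1)] natural_le_refl[of u] by (subst germ_eq_iff) auto
    have "slice D u ?W \<subseteq> b1 \<inter> b2"
      using *[OF _ u(1)] *[OF _ u(2)] U(3) V(3) by (auto simp: slice_def)
    moreover have "\<gamma> \<in> slice D u ?W"
      using *[OF u(3,1)] x u by (auto simp: slice_def)
    moreover have "slice D u ?W \<in> B"
      unfolding B_def using openin_Int[OF openin_Int[OF U(1) V(1)] act_open] by blast
    ultimately show ?thesis by auto
  qed
  have "\<exists>V \<in> B. \<gamma> \<in> V \<and> V \<subseteq> W" if "generate_topology_on B W" "\<gamma> \<in> W" for W \<gamma>
    using that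
  proof (induction arbitrary: \<gamma> rule: generate_topology_on.induct)
    case (Int a b)
    obtain b1 b2 where "b1 \<in> B" "\<gamma> \<in> b1" "b1 \<subseteq> a" "b2 \<in> B" "\<gamma> \<in> b2" "b2 \<subseteq> b"
      using Int.IH[of \<gamma>] Int.prems by auto
    then show ?case using basis_Int[of b1 b2 \<gamma>] by blast
  next
    case (UN K)
    then obtain k where k: "k \<in> K" "\<gamma> \<in> k" by auto
    then show ?case using UN.IH[OF k] by blast
  qed auto
  moreover have "(\<exists>s U. W = slice D s U \<and> openin X U \<and> U \<subseteq> D (star s)) \<longleftrightarrow> W \<in> B" for W
    by (simp add: B_def)
  ultimately show ?thesis
    unfolding openin_topology_base_unique T
    by (metis generate_topology_on.Basis)
qed

end


section \<open>Sheaves on groupoids\<close>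

record ('g, 'x, 'e) gsheaf =
  total :: "'e topology"
  proj :: "'e \<Rightarrow> 'x"
  transport :: "'g \<Rightarrow> 'e \<Rightarrow> 'e"

record ('g, 'x, 'e) gsheaf_of_rings = "('g, 'x, 'e) gsheaf" +
  stalk :: "'x \<Rightarrow> 'e ring"

definition is_gsheaf :: "('g, 'x) top_groupoid \<Rightarrow> ('g, 'x, 'e, 'm) gsheaf_scheme \<Rightarrow> bool" where
  "is_gsheaf G E \<longleftrightarrow>
     proj E \<in> topspace (total E) \<rightarrow> topspace (unit_topology G) \<and>
     local_homeomorphism (total E) (unit_topology G) (proj E) \<and>
     continuous_map
       (subtopology (prod_topology (arrow_topology G) (total E)) {(\<gamma>, e). gdom G \<gamma> = proj E e})
       (total E) (\<lambda>(\<gamma>, e). transport E \<gamma> e) \<and>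
     (\<forall>e \<in> topspace (total E). transport E (gunit G (proj E e)) e = e) \<and>
     (\<forall>\<gamma> \<in> arrows G. \<forall>e \<in> topspace (total E). gdom G \<gamma> = proj E e \<longrightarrow>
        proj E (transport E \<gamma> e) = grng G \<gamma>) \<and>
     (\<forall>\<beta> \<in> arrows G. \<forall>\<gamma> \<in> arrows G. \<forall>e \<in> topspace (total E).
        gdom G \<beta> = grng G \<gamma> \<and> gdom G \<gamma> = proj E e \<longrightarrow>
        transport E \<beta> (transport E \<gamma> e) = transport E (gcomp G \<beta> \<gamma>) e)"

definition is_gsheaf_of_rings ::
  "('g, 'x) top_groupoid \<Rightarrow> ('g, 'x, 'e) gsheaf_of_rings \<Rightarrow> bool" where
  "is_gsheaf_of_rings G \<O> \<longleftrightarrow>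
     is_gsheaf G \<O> \<and>
     (\<forall>x \<in> topspace (unit_topology G).
        ring (stalk \<O> x) \<and> carrier (stalk \<O> x) = {e \<in> topspace (total \<O>). proj \<O> e = x}) \<and>
     continuous_map
       (subtopology (prod_topology (total \<O>) (total \<O>)) {(a, b). proj \<O> a = proj \<O> b})
       (total \<O>) (\<lambda>(a, b). a \<oplus>\<^bsub>stalk \<O> (proj \<O> a)\<^esub> b) \<and>
     continuous_map
       (subtopology (prod_topology (total \<O>) (total \<O>)) {(a, b). proj \<O> a = proj \<O> b})
       (total \<O>) (\<lambda>(a, b). a \<otimes>\<^bsub>stalk \<O> (proj \<O> a)\<^esub> b) \<and>
     continuous_map (unit_topology G) (total \<O>) (\<lambda>x. \<one>\<^bsub>stalk \<O> x\<^esub>) \<and>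
     (\<forall>\<gamma> \<in> arrows G.
        transport \<O> \<gamma> \<in> ring_hom (stalk \<O> (gdom G \<gamma>)) (stalk \<O> (grng G \<gamma>)))"

definition is_gsheaf_of_fields ::
  "('g, 'x) top_groupoid \<Rightarrow> ('g, 'x, 'e) gsheaf_of_rings \<Rightarrow> bool" where
  "is_gsheaf_of_fields G \<O> \<longleftrightarrow>
     is_gsheaf_of_rings G \<O> \<and> (\<forall>x \<in> topspace (unit_topology G). field (stalk \<O> x))"


section \<open>The convolution ring\<close>

definition compact_open_bisection :: "('g, 'x) top_groupoid \<Rightarrow> 'g set \<Rightarrow> bool" where
  "compact_open_bisection G U \<longleftrightarrow>
     openin (arrow_topology G) U \<and> compact_Hausdorffin (arrow_topology G) U \<and>
     inj_on (gdom G) U \<and> inj_on (grng G) U"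

text \<open>The defining sum of the convolution is taken over its nonzero terms, which are finite in
  number for \<open>f\<close> and \<open>g\<close> in \<open>\<Gamma>\<^sub>c\<close>, because \<open>finsum\<close> is only meaningful on
  finite index sets.\<close>

definition convolution ::
  "('g, 'x) top_groupoid \<Rightarrow> ('g, 'x, 'e) gsheaf_of_rings \<Rightarrow> ('g \<Rightarrow> 'e) \<Rightarrow> ('g \<Rightarrow> 'e) \<Rightarrow> 'g \<Rightarrow> 'e" where
  "convolution G \<O> f g = (\<lambda>\<gamma> \<in> arrows G.
     finsum (stalk \<O> (grng G \<gamma>))
       (\<lambda>(\<beta>, \<rho>). f \<beta> \<otimes>\<^bsub>stalk \<O> (grng G \<gamma>)\<^esub> transport \<O> \<beta> (g \<rho>))
       {(\<beta>, \<rho>). \<beta> \<in> arrows G \<and> \<rho> \<in> arrows G \<and> gdom G \<beta> = grng G \<rho> \<and> gcomp G \<beta> \<rho> = \<gamma> \<and>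
          f \<beta> \<otimes>\<^bsub>stalk \<O> (grng G \<gamma>)\<^esub> transport \<O> \<beta> (g \<rho>) \<noteq> \<zero>\<^bsub>stalk \<O> (grng G \<gamma>)\<^esub>})"

text \<open>Rings without unit are represented by the library's ring records, whose \<open>one\<close> field is
  then left unspecified and never used. All sections \<open>G \<rightarrow> E\<close>, continuous or not, form the
  ambient additive group.\<close>

definition all_sections ::
  "('g, 'x) top_groupoid \<Rightarrow> ('g, 'x, 'e) gsheaf_of_rings \<Rightarrow> ('g \<Rightarrow> 'e) ring" where
  "all_sections G \<O> = \<lparr>
     carrier = {f \<in> extensional (arrows G).
       \<forall>\<gamma> \<in> arrows G. f \<gamma> \<in> topspace (total \<O>) \<and> proj \<O> (f \<gamma>) = grng G \<gamma>},
     mult = convolution G \<O>,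
     one = undefined,
     zero = (\<lambda>\<gamma> \<in> arrows G. \<zero>\<^bsub>stalk \<O> (grng G \<gamma>)\<^esub>),
     add = (\<lambda>f g. \<lambda>\<gamma> \<in> arrows G. f \<gamma> \<oplus>\<^bsub>stalk \<O> (grng G \<gamma>)\<^esub> g \<gamma>) \<rparr>"

definition bisection_sections ::
  "('g, 'x) top_groupoid \<Rightarrow> ('g, 'x, 'e) gsheaf_of_rings \<Rightarrow> ('g \<Rightarrow> 'e) set" where
  "bisection_sections G \<O> = {f \<in> carrier (all_sections G \<O>).
     \<exists>U. compact_open_bisection G U \<and>
       continuous_map (subtopology (arrow_topology G) U) (total \<O>) f \<and>
       (\<forall>\<gamma> \<in> arrows G - U. f \<gamma> = \<zero>\<^bsub>stalk \<O> (grng G \<gamma>)\<^esub>)}"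

definition Gamma_c ::
  "('g, 'x) top_groupoid \<Rightarrow> ('g, 'x, 'e) gsheaf_of_rings \<Rightarrow> ('g \<Rightarrow> 'e) ring" where
  "Gamma_c G \<O> = (all_sections G \<O>)
     \<lparr>carrier := generate (add_monoid (all_sections G \<O>)) (bisection_sections G \<O>)\<rparr>"


section \<open>Left primitive rings\<close>

text \<open>The library's \<^locale>\<open>module\<close> requires a commutative unital ring of scalars;
  here the scalars need neither commute nor have a unit.\<close>

definition left_module :: "'r ring \<Rightarrow> ('r, 'n) module \<Rightarrow> bool" where
  "left_module R N \<longleftrightarrow>
     abelian_group N \<and>
     (\<forall>a \<in> carrier R. \<forall>n \<in> carrier N. a \<odot>\<^bsub>N\<^esub> n \<in> carrier N) \<and>
     (\<forall>a \<in> carrier R. \<forall>b \<in> carrier R. \<forall>n \<in> carrier N.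
        (a \<oplus>\<^bsub>R\<^esub> b) \<odot>\<^bsub>N\<^esub> n = a \<odot>\<^bsub>N\<^esub> n \<oplus>\<^bsub>N\<^esub> b \<odot>\<^bsub>N\<^esub> n) \<and>
     (\<forall>a \<in> carrier R. \<forall>m \<in> carrier N. \<forall>n \<in> carrier N.
        a \<odot>\<^bsub>N\<^esub> (m \<oplus>\<^bsub>N\<^esub> n) = a \<odot>\<^bsub>N\<^esub> m \<oplus>\<^bsub>N\<^esub> a \<odot>\<^bsub>N\<^esub> n) \<and>
     (\<forall>a \<in> carrier R. \<forall>b \<in> carrier R. \<forall>n \<in> carrier N.
        (a \<otimes>\<^bsub>R\<^esub> b) \<odot>\<^bsub>N\<^esub> n = a \<odot>\<^bsub>N\<^esub> (b \<odot>\<^bsub>N\<^esub> n))"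

definition simple_left_module :: "'r ring \<Rightarrow> ('r, 'n) module \<Rightarrow> bool" where
  "simple_left_module R N \<longleftrightarrow>
     left_module R N \<and>
     (\<exists>a \<in> carrier R. \<exists>n \<in> carrier N. a \<odot>\<^bsub>N\<^esub> n \<noteq> \<zero>\<^bsub>N\<^esub>) \<and>
     (\<forall>H. submodule H R N \<longrightarrow> H = {\<zero>\<^bsub>N\<^esub>} \<or> H = carrier N)"

definition faithful_left_module :: "'r ring \<Rightarrow> ('r, 'n) module \<Rightarrow> bool" where
  "faithful_left_module R N \<longleftrightarrow>
     left_module R N \<and>
     (\<forall>a \<in> carrier R. (\<forall>n \<in> carrier N. a \<odot>\<^bsub>N\<^esub> n = \<zero>\<^bsub>N\<^esub>) \<longrightarrow> a = \<zero>\<^bsub>R\<^esub>)"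

text \<open>HOL cannot quantify over the type of module elements. The type \<open>'r set\<close>, which
  accommodates the quotients of \<open>R\<close> by left ideals, is large enough: if some type
  carries a faithful simple left \<open>R\<close>-module then so does \<open>'r set\<close>, see \<open>left_primitiveI\<close>.\<close>

definition left_primitive :: "'r ring \<Rightarrow> bool" where
  "left_primitive R \<longleftrightarrow>
     (\<exists>N :: ('r, 'r set) module. simple_left_module R N \<and> faithful_left_module R N)"

lemma transport_simple_faithful:
  fixes N :: "('r, 'n) module" and \<phi> :: "'n \<Rightarrow> 'k"
  assumes simple: "simple_left_module R N" and faithful: "faithful_left_module R N"
    and inj: "inj_on \<phi> (carrier N)"
  shows "\<exists>N' :: ('r, 'k) module. simple_left_module R N' \<and> faithful_left_module R N'"
proof -
  define \<psi> where "\<psi> = inv_into (carrier N) \<phi>"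
  have \<psi>: "\<psi> (\<phi> m) = m" if "m \<in> carrier N" for m
    using inj that by (simp add: \<psi>_def)
  define N' :: "('r, 'k) module" where "N' = \<lparr>carrier = \<phi> ` carrier N,
    mult = undefined, one = undefined, zero = \<phi> \<zero>\<^bsub>N\<^esub>,
    add = (\<lambda>x y. \<phi> (\<psi> x \<oplus>\<^bsub>N\<^esub> \<psi> y)), smult = (\<lambda>a x. \<phi> (a \<odot>\<^bsub>N\<^esub> \<psi> x))\<rparr>"
  have carr: "carrier N' = \<phi> ` carrier N" and zero: "\<zero>\<^bsub>N'\<^esub> = \<phi> \<zero>\<^bsub>N\<^esub>"
    by (simp_all add: N'_def)
  have add: "\<phi> m \<oplus>\<^bsub>N'\<^esub> \<phi> n = \<phi> (m \<oplus>\<^bsub>N\<^esub> n)" if "m \<in> carrier N" "n \<in> carrier N" for m n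
    using that by (simp add: N'_def \<psi>)
  have smult: "a \<odot>\<^bsub>N'\<^esub> \<phi> m = \<phi> (a \<odot>\<^bsub>N\<^esub> m)" if "m \<in> carrier N" for a m
    using that by (simp add: N'_def \<psi>)
  have N: "left_module R N" using simple by (simp add: simple_left_module_def)
  interpret N: abelian_group N using N by (simp add: left_module_def)
  have closed: "a \<odot>\<^bsub>N\<^esub> n \<in> carrier N" if "a \<in> carrier R" "n \<in> carrier N" for a n
    using N that by (simp add: left_module_def)
  have eq: "\<phi> m = \<phi> n \<longleftrightarrow> m = n" if "m \<in> carrier N" "n \<in> carrier N" for m n
    using inj that by (auto dest: inj_onD)
  have ag: "abelian_group N'"
  proof (rule abelian_groupI)
    fix x y z assume "x \<in> carrier N'" "y \<in> carrier N'" "z \<in> carrier N'"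
    then show "x \<oplus>\<^bsub>N'\<^esub> y \<oplus>\<^bsub>N'\<^esub> z = x \<oplus>\<^bsub>N'\<^esub> (y \<oplus>\<^bsub>N'\<^esub> z)"
      by (auto simp: carr add N.a_assoc)
  next
    fix x assume "x \<in> carrier N'"
    then obtain m where m: "x = \<phi> m" "m \<in> carrier N" by (auto simp: carr)
    show "\<exists>y \<in> carrier N'. y \<oplus>\<^bsub>N'\<^esub> x = \<zero>\<^bsub>N'\<^esub>"
      by (rule bexI[of _ "\<phi> (\<ominus>\<^bsub>N\<^esub> m)"]) (use m in \<open>simp_all add: carr add zero N.l_neg\<close>)
  qed (auto simp: carr add zero N.a_comm)
  interpret N': abelian_group N' by (rule ag)
  have lm: "left_module R N'"
    using N ag by (auto simp: left_module_def carr smult add)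
  have "H = {\<zero>\<^bsub>N'\<^esub>} \<or> H = carrier N'" if H: "submodule H R N'" for H
  proof -
    interpret H: submodule H R N' by (rule H)
    define K where "K = {m \<in> carrier N. \<phi> m \<in> H}"
    have HK: "H = \<phi> ` K" using H.subset by (auto simp: K_def carr)
    have "submodule K R N"
    proof (intro submodule.intro subgroup.intro submodule_axioms.intro)
      show "K \<subseteq> carrier (add_monoid N)" by (auto simp: K_def)
      show "\<one>\<^bsub>add_monoid N\<^esub> \<in> K" using H.one_closed by (simp add: K_def zero)
      show "m \<otimes>\<^bsub>add_monoid N\<^esub> n \<in> K" if "m \<in> K" "n \<in> K" for m n
        using that H.m_closed[of "\<phi> m" "\<phi> n"] by (simp add: K_def add)
      show "inv\<^bsub>add_monoid N\<^esub> m \<in> K" if "m \<in> K" for m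
      proof -
        have m: "m \<in> carrier N" "\<phi> m \<in> H" using that by (auto simp: K_def)
        have "\<ominus>\<^bsub>N'\<^esub> \<phi> m = \<phi> (\<ominus>\<^bsub>N\<^esub> m)"
          by (rule N'.minus_equality) (use m in \<open>simp_all add: carr add zero N.l_neg\<close>)
        then show ?thesis
          using H.m_inv_closed[OF m(2)] m(1) N.a_inv_closed[OF m(1)] by (simp add: K_def a_inv_def)
      qed
      show "a \<odot>\<^bsub>N\<^esub> m \<in> K" if "a \<in> carrier R" "m \<in> K" for a m
        using that H.smult_closed[of a "\<phi> m"] closed by (simp add: K_def smult)
    qed
    then have "K = {\<zero>\<^bsub>N\<^esub>} \<or> K = carrier N"
      using simple by (simp add: simple_left_module_def)
    then show ?thesis using HK by (auto simp: carr zero)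
  qed
  moreover obtain a n where "a \<in> carrier R" "n \<in> carrier N" "a \<odot>\<^bsub>N\<^esub> n \<noteq> \<zero>\<^bsub>N\<^esub>"
    using simple by (auto simp: simple_left_module_def)
  then have "\<exists>a \<in> carrier R. \<exists>x \<in> carrier N'. a \<odot>\<^bsub>N'\<^esub> x \<noteq> \<zero>\<^bsub>N'\<^esub>"
    by (intro bexI[of _ a] bexI[of _ "\<phi> n"]) (auto simp: carr smult zero eq closed)
  ultimately have "simple_left_module R N'"
    using lm by (simp add: simple_left_module_def)
  moreover have "faithful_left_module R N'"
    using lm faithful by (simp add: faithful_left_module_def carr smult zero eq closed)
  ultimately show ?thesis by blast
qed

lemma left_primitiveI:
  fixes N :: "('r, 'n) module"
  assumes R: "abelian_group R" "\<And>a b. a \<in> carrier R \<Longrightarrow> b \<in> carrier R \<Longrightarrow> a \<otimes>\<^bsub>R\<^esub> b \<in> carrier R"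
    and simple: "simple_left_module R N" and faithful: "faithful_left_module R N"
  shows "left_primitive R"
proof -
  have N: "left_module R N" using simple by (simp add: simple_left_module_def)
  interpret R: abelian_group R by (rule R)
  interpret N: abelian_group N using N by (simp add: left_module_def)
  have closed: "a \<odot>\<^bsub>N\<^esub> n \<in> carrier N" if "a \<in> carrier R" "n \<in> carrier N" for a n
    using N that by (simp add: left_module_def)
  have distr: "(a \<oplus>\<^bsub>R\<^esub> b) \<odot>\<^bsub>N\<^esub> n = a \<odot>\<^bsub>N\<^esub> n \<oplus>\<^bsub>N\<^esub> b \<odot>\<^bsub>N\<^esub> n"
    and assoc: "(a \<otimes>\<^bsub>R\<^esub> b) \<odot>\<^bsub>N\<^esub> n = a \<odot>\<^bsub>N\<^esub> (b \<odot>\<^bsub>N\<^esub> n)"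
    if "a \<in> carrier R" "b \<in> carrier R" "n \<in> carrier N" for a b n
    using N that by (simp_all add: left_module_def)
  obtain a0 n where n: "a0 \<in> carrier R" "n \<in> carrier N" "a0 \<odot>\<^bsub>N\<^esub> n \<noteq> \<zero>\<^bsub>N\<^esub>"
    using simple by (auto simp: simple_left_module_def)
  let ?K = "(\<lambda>a. a \<odot>\<^bsub>N\<^esub> n) ` carrier R"
  have zero: "\<zero>\<^bsub>R\<^esub> \<odot>\<^bsub>N\<^esub> n = \<zero>\<^bsub>N\<^esub>"
    using distr[of "\<zero>\<^bsub>R\<^esub>" "\<zero>\<^bsub>R\<^esub>" n] closed[of "\<zero>\<^bsub>R\<^esub>" n] n(2) by simp
  have "submodule ?K R N"
  proof (intro submodule.intro subgroup.intro submodule_axioms.intro)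
    show "?K \<subseteq> carrier (add_monoid N)" using closed n(2) by auto
    show "\<one>\<^bsub>add_monoid N\<^esub> \<in> ?K" using zero by (auto intro!: image_eqI[of _ _ "\<zero>\<^bsub>R\<^esub>"])
    show "x \<otimes>\<^bsub>add_monoid N\<^esub> y \<in> ?K" if "x \<in> ?K" "y \<in> ?K" for x y
      using that distr[OF _ _ n(2), symmetric] by auto
    show "inv\<^bsub>add_monoid N\<^esub> x \<in> ?K" if x: "x \<in> ?K" for x
    proof -
      obtain a where a: "x = a \<odot>\<^bsub>N\<^esub> n" "a \<in> carrier R" using x by auto
      have "\<ominus>\<^bsub>N\<^esub> x = (\<ominus>\<^bsub>R\<^esub> a) \<odot>\<^bsub>N\<^esub> n"
        by (rule N.minus_equality)
          (use a n(2) closed zero distr[of "\<ominus>\<^bsub>R\<^esub> a" a n] in \<open>simp_all add: R.l_neg\<close>)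
      then have "\<ominus>\<^bsub>N\<^esub> x \<in> ?K" using R.a_inv_closed[OF a(2)] by auto
      then show ?thesis by (simp only: a_inv_def)
    qed
    show "a \<odot>\<^bsub>N\<^esub> x \<in> ?K" if "a \<in> carrier R" "x \<in> ?K" for a x
      using that R(2) assoc[OF _ _ n(2), symmetric] by auto
  qed
  then have "?K = {\<zero>\<^bsub>N\<^esub>} \<or> ?K = carrier N"
    using simple by (simp add: simple_left_module_def)
  then have K: "?K = carrier N" using n by blast
  have "inj_on (\<lambda>m. {a \<in> carrier R. a \<odot>\<^bsub>N\<^esub> n = m}) (carrier N)"
  proof (rule inj_onI)
    fix m m'
    assume m: "m \<in> carrier N"
      and eq: "{a \<in> carrier R. a \<odot>\<^bsub>N\<^esub> n = m} = {a \<in> carrier R. a \<odot>\<^bsub>N\<^esub> n = m'}"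
    have "m \<in> ?K" using m unfolding K .
    then obtain a where "a \<in> carrier R" "m = a \<odot>\<^bsub>N\<^esub> n" by (rule imageE)
    then have "a \<in> {a \<in> carrier R. a \<odot>\<^bsub>N\<^esub> n = m}" by simp
    then show "m = m'" unfolding eq using \<open>m = _\<close> by simp
  qed
  then show ?thesis
    unfolding left_primitive_def by (rule transport_simple_faithful[OF simple faithful])
qed

end

theory Submission
  imports Defs
begin

text \<open>Suppose that the orbit of \<open>x\<close> is dense. The elements of \<open>\<Gamma>\<^sub>c\<close> vanishing on all arrows with
  source \<open>x\<close> form a left ideal \<open>L\<close>, for which the indicator \<open>e\<close> of any compact open set of units
  around \<open>x\<close> is a right unit modulo \<open>L\<close>. Every nonzero two-sided ideal is comaximal with \<open>L\<close>:
  given \<open>f \<noteq> 0\<close>, topological freeness yields a small open bisection \<open>A\<close> inside the support of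
  \<open>f\<close> (open, because the stalks are fields and the groupoid is Hausdorff) such that \<open>f\<close> vanishes
  on all other arrows from the source of \<open>A\<close> to its range. As the orbit of \<open>x\<close> meets the source
  of \<open>A\<close>, multiplying \<open>f\<close> on both sides by suitable bumps gives \<open>e\<close> modulo \<open>L\<close>. Hence the
  quotient by any maximal left ideal containing \<open>L\<close> is simple and faithful, and no representation
  theory of isotropy groups is needed.

  Conversely, let \<open>N\<close> be a faithful simple module and suppose that no orbit is dense. For each
  \<open>x\<close> some nonempty compact open \<open>V\<close> misses the orbit of \<open>x\<close>, and \<open>1\<^sub>V n \<noteq> 0\<close> for some \<open>n\<close>, so every
  \<open>m\<close> has the form \<open>a 1\<^sub>V n\<close>. Then \<open>1\<^sub>U a 1\<^sub>V = 0\<close>, hence \<open>1\<^sub>U m = 0\<close>, for some neighbourhood \<open>U\<close>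
  of \<open>x\<close>. By compactness \<open>1\<^sub>K m = 0\<close> for all compact open \<open>K\<close>, which forces \<open>m = 0\<close>.\<close>


section \<open>Left primitivity of rings without unit\<close>

text \<open>The ring has local units but in general no unit, so \<open>e\<close> replaces it: ideals
  are kept proper by keeping \<open>e\<close> out. An f annihilating the quotient has f b in the
  maximal ideal for every b, so a congruence of some a f b with \<open>e\<close> would force
  \<open>e\<close> into that ideal. The obstacle to such a congruence is that a value of a f b may
  collect contributions from many arrows of f. The support of f lies in finitely many bisections,
  and the open set \<open>A\<close> is shrunk once for each of them. With b concentrated on one
  arrow out of \<open>x\<close> and a confined to arrows starting in the range of the shrunken set,
  a single factorisation survives over the source \<open>x\<close>, and an inverse in the stalk
  normalises its value. Arrows with other sources need no control, because the congruence is modulo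
  \<open>L\<close>. In the converse the neighbourhood \<open>U\<close> depends on a, hence on m, so
  m is fixed before compactness is used. Taking m = a0 n0 places the targets of the support of a0 in
  one compact set; the indicator of a compact open set around it fixes m, and this is why its
  vanishing on m is a contradiction.\<close>

locale nonunital_ring = abelian_group R for R :: "'r ring" (structure) +
  assumes m_closed: "a \<in> carrier R \<Longrightarrow> b \<in> carrier R \<Longrightarrow> a \<otimes> b \<in> carrier R"
    and m_assoc: "a \<in> carrier R \<Longrightarrow> b \<in> carrier R \<Longrightarrow> c \<in> carrier R \<Longrightarrow>
      a \<otimes> b \<otimes> c = a \<otimes> (b \<otimes> c)"
    and l_distr: "a \<in> carrier R \<Longrightarrow> b \<in> carrier R \<Longrightarrow> c \<in> carrier R \<Longrightarrow>
      (a \<oplus> b) \<otimes> c = a \<otimes> c \<oplus> b \<otimes> c"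
    and r_distr: "a \<in> carrier R \<Longrightarrow> b \<in> carrier R \<Longrightarrow> c \<in> carrier R \<Longrightarrow>
      a \<otimes> (b \<oplus> c) = a \<otimes> b \<oplus> a \<otimes> c"
begin

lemma mult_zero_right: "a \<in> carrier R \<Longrightarrow> a \<otimes> \<zero> = \<zero>"
  using r_distr[of a \<zero> \<zero>] m_closed[of a \<zero>] by simp

lemma minus_zero: "\<ominus> \<zero> = \<zero>"
  by (rule minus_equality) simp_all

lemma r_minus:
  assumes "a \<in> carrier R" "b \<in> carrier R"
  shows "a \<otimes> (\<ominus> b) = \<ominus> (a \<otimes> b)"
proof -
  have "a \<otimes> (\<ominus> b) \<oplus> a \<otimes> b = \<zero>"
    using assms by (simp add: r_distr[symmetric] l_neg mult_zero_right)
  then show ?thesis using assms by (simp add: minus_equality m_closed)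
qed

definition left_ideal :: "'r set \<Rightarrow> bool" where
  "left_ideal L \<longleftrightarrow> L \<subseteq> carrier R \<and> \<zero> \<in> L \<and> (\<forall>a\<in>L. \<forall>b\<in>L. a \<ominus> b \<in> L) \<and>
     (\<forall>a\<in>carrier R. \<forall>b\<in>L. a \<otimes> b \<in> L)"

lemma left_idealD:
  assumes "left_ideal L"
  shows "a \<in> L \<Longrightarrow> a \<in> carrier R" "\<zero> \<in> L" "a \<in> L \<Longrightarrow> b \<in> L \<Longrightarrow> a \<ominus> b \<in> L"
    "a \<in> L \<Longrightarrow> \<ominus> a \<in> L" "a \<in> L \<Longrightarrow> b \<in> L \<Longrightarrow> a \<oplus> b \<in> L"
    "c \<in> carrier R \<Longrightarrow> b \<in> L \<Longrightarrow> c \<otimes> b \<in> L"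
proof -
  show 1: "a \<in> L \<Longrightarrow> a \<in> carrier R" and 0: "\<zero> \<in> L"
    and 2: "a \<in> L \<Longrightarrow> b \<in> L \<Longrightarrow> a \<ominus> b \<in> L"
    and "c \<in> carrier R \<Longrightarrow> b \<in> L \<Longrightarrow> c \<otimes> b \<in> L" for a b c
    using assms by (auto simp: left_ideal_def)
  show 3: "a \<in> L \<Longrightarrow> \<ominus> a \<in> L" for a
    using 2[OF 0, of a] 1[of a] by (simp add: minus_eq)
  show "a \<in> L \<Longrightarrow> b \<in> L \<Longrightarrow> a \<oplus> b \<in> L"
    using 2[OF _ 3, of a b] 1[of a] 1[of b] by (simp add: minus_eq)
qed

text \<open>Missing \<open>e\<close> survives unions of chains, whereas without a unit a union of
  proper left ideals can be the whole ring. Maximality is therefore taken relative to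
  \<open>e\<close>.\<close>

lemma maximal_left_ideal:
  assumes "left_ideal L0" "e \<notin> L0"
  shows "\<exists>L. left_ideal L \<and> L0 \<subseteq> L \<and> e \<notin> L \<and>
    (\<forall>K. left_ideal K \<longrightarrow> L \<subseteq> K \<longrightarrow> e \<notin> K \<longrightarrow> K = L)"
proof -
  let ?A = "{L. left_ideal L \<and> L0 \<subseteq> L \<and> e \<notin> L}"
  have "\<exists>M\<in>?A. \<forall>X\<in>?A. M \<subseteq> X \<longrightarrow> X = M"
  proof (rule subset_Zorn_nonempty)
    show "?A \<noteq> {}" using assms by auto
    fix C assume C: "C \<noteq> {}" "subset.chain ?A C"
    have dir: "\<exists>K\<in>C. a \<in> K \<and> b \<in> K" if "a \<in> \<Union>C" "b \<in> \<Union>C" for a b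
    proof -
      obtain K K' where K: "K \<in> C" "a \<in> K" "K' \<in> C" "b \<in> K'" using \<open>a \<in> \<Union>C\<close> \<open>b \<in> \<Union>C\<close> by blast
      then have "K \<subseteq> K' \<or> K' \<subseteq> K" using C(2) unfolding subset_chain_def by blast
      then show ?thesis using K by blast
    qed
    have CA: "K \<in> ?A" if "K \<in> C" for K
      using that C(2) by (auto simp: subset_chain_def)
    have "left_ideal (\<Union>C)"
      unfolding left_ideal_def
    proof (intro conjI ballI)
      show "\<Union>C \<subseteq> carrier R" using CA left_idealD(1) by blast
      show "\<zero> \<in> \<Union>C" using C(1) CA left_idealD(2) by blast
      show "a \<ominus> b \<in> \<Union>C" if "a \<in> \<Union>C" "b \<in> \<Union>C" for a b
      proof -
        obtain K where "K \<in> C" "a \<in> K" "b \<in> K"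
          using dir \<open>a \<in> \<Union>C\<close> \<open>b \<in> \<Union>C\<close> by meson
        then show ?thesis using left_idealD(3)[of K a b] CA[of K] by blast
      qed
      show "a \<otimes> b \<in> \<Union>C" if "a \<in> carrier R" "b \<in> \<Union>C" for a b
      proof -
        obtain K where "K \<in> C" "b \<in> K" using \<open>b \<in> \<Union>C\<close> by blast
        then show ?thesis using left_idealD(6)[of K a b] CA[of K] \<open>a \<in> carrier R\<close> by blast
      qed
    qed
    moreover have "e \<notin> \<Union>C" using CA by auto
    moreover obtain K where "K \<in> C" using C(1) by blast
    with CA[of K] have "L0 \<subseteq> \<Union>C" by blast
    ultimately show "\<Union>C \<in> ?A" by simp
  qed
  then obtain L where "L \<in> ?A" and max: "\<And>K. K \<in> ?A \<Longrightarrow> L \<subseteq> K \<Longrightarrow> K = L" by meson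
  then have "K = L" if "left_ideal K" "L \<subseteq> K" "e \<notin> K" for K
    using that max[of K] by auto
  with \<open>L \<in> ?A\<close> show ?thesis by auto
qed

text \<open>The hypothesis on \<open>L0\<close> makes \<open>e\<close> a right unit modulo every left ideal above \<open>L0\<close>, and
  the last one makes \<open>L0\<close> comaximal with every nonzero two-sided ideal. So the annihilator of
  the simple quotient by a maximal left ideal containing \<open>L0\<close> must vanish.\<close>

theorem left_primitive_modular:
  assumes L0: "left_ideal L0" and e: "e \<in> carrier R" "e \<notin> L0"
    and unit: "\<And>a. a \<in> carrier R \<Longrightarrow> a \<ominus> a \<otimes> e \<in> L0"
    and comax: "\<And>f. f \<in> carrier R \<Longrightarrow> f \<noteq> \<zero> \<Longrightarrow>
      \<exists>a\<in>carrier R. \<exists>b\<in>carrier R. a \<otimes> (f \<otimes> b) \<ominus> e \<in> L0"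
  shows "left_primitive R"
proof -
  obtain L where L: "left_ideal L" "L0 \<subseteq> L" "e \<notin> L"
    and max: "\<And>K. left_ideal K \<Longrightarrow> L \<subseteq> K \<Longrightarrow> e \<notin> K \<Longrightarrow> K = L"
    using maximal_left_ideal[OF L0 e(2)] by blast
  note LD = left_idealD[OF L(1)]
  \<comment> \<open>\<open>\<pi>\<close> selects a representative of the coset of \<open>a\<close>
    modulo \<open>L\<close>. Congruent elements have the same candidates, hence the same
    representative (\<open>\<pi>_eqI\<close>), so the quotient is modelled on the image of
    \<open>\<pi>\<close> and each operation is followed by \<open>\<pi>\<close>.\<close>
  define \<pi> where "\<pi> a = (SOME b. b \<in> carrier R \<and> b \<ominus> a \<in> L)" for a
  have \<pi>: "\<pi> a \<in> carrier R" "\<pi> a \<ominus> a \<in> L" if "a \<in> carrier R" for a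
    using someI[of "\<lambda>b. b \<in> carrier R \<and> b \<ominus> a \<in> L" a] that LD(2)
    by (auto simp: \<pi>_def minus_eq r_neg)
  have shift: "a \<ominus> c \<in> L" if "a \<ominus> b \<in> L" "b \<ominus> c \<in> L"
    "a \<in> carrier R" "b \<in> carrier R" "c \<in> carrier R" for a b c
  proof -
    have "a \<ominus> c = (a \<ominus> b) \<oplus> (b \<ominus> c)"
      using that(3-) by (simp add: minus_eq a_ac r_neg2)
    then show ?thesis using LD(5)[OF that(1,2)] by simp
  qed
  have sym: "b \<ominus> a \<in> L" if "a \<ominus> b \<in> L" "a \<in> carrier R" "b \<in> carrier R" for a b
  proof -
    have "b \<ominus> a = \<ominus> (a \<ominus> b)"
      using that(2-) by (simp add: minus_eq minus_add a_comm)
    then show ?thesis using LD(4)[OF that(1)] by simp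
  qed
  have \<pi>_eqI: "\<pi> a = \<pi> b" if "a \<ominus> b \<in> L" "a \<in> carrier R" "b \<in> carrier R" for a b
  proof -
    have "c \<ominus> a \<in> L \<longleftrightarrow> c \<ominus> b \<in> L" if "c \<in> carrier R" for c
      using shift sym that \<open>a \<ominus> b \<in> L\<close> \<open>a \<in> carrier R\<close> \<open>b \<in> carrier R\<close> by meson
    then show ?thesis unfolding \<pi>_def by metis
  qed
  have \<pi>_eq: "\<pi> a = \<pi> b \<longleftrightarrow> a \<ominus> b \<in> L" if "a \<in> carrier R" "b \<in> carrier R" for a b
    using \<pi>_eqI \<pi> shift sym that by metis
  have \<pi>_addl: "\<pi> (\<pi> a \<oplus> b) = \<pi> (a \<oplus> b)" if "a \<in> carrier R" "b \<in> carrier R" for a b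
  proof -
    have "\<pi> a \<oplus> b \<ominus> (a \<oplus> b) = (\<pi> a \<ominus> a) \<oplus> (b \<ominus> b)"
      using that \<pi>(1) by (simp add: minus_eq minus_add a_ac)
    then have "\<pi> a \<oplus> b \<ominus> (a \<oplus> b) = \<pi> a \<ominus> a"
      using that \<pi>(1) by (simp add: minus_eq r_neg)
    then show ?thesis using \<pi> that by (simp add: \<pi>_eq)
  qed
  have \<pi>_addr: "\<pi> (a \<oplus> \<pi> b) = \<pi> (a \<oplus> b)" if "a \<in> carrier R" "b \<in> carrier R" for a b
    using \<pi>_addl[OF that(2,1)] that \<pi>(1) by (simp add: a_comm)
  have \<pi>_mult: "\<pi> (c \<otimes> \<pi> a) = \<pi> (c \<otimes> a)" if "a \<in> carrier R" "c \<in> carrier R" for a c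
  proof -
    have "c \<otimes> \<pi> a \<ominus> c \<otimes> a = c \<otimes> (\<pi> a \<ominus> a)"
      using that \<pi>(1) by (simp add: minus_eq r_distr r_minus)
    then show ?thesis using \<pi> that LD(6) by (simp add: \<pi>_eq m_closed)
  qed
  have \<pi>_zero: "\<pi> a = \<pi> \<zero> \<longleftrightarrow> a \<in> L" if "a \<in> carrier R" for a
    using that by (simp add: \<pi>_eq minus_eq minus_zero)
  define N :: "('r, 'r) module" where "N = \<lparr>carrier = \<pi> ` carrier R,
    mult = undefined, one = undefined, zero = \<pi> \<zero>,
    add = (\<lambda>x y. \<pi> (x \<oplus> y)), smult = (\<lambda>a x. \<pi> (a \<otimes> x))\<rparr>"
  have carr: "carrier N = \<pi> ` carrier R" and zero: "\<zero>\<^bsub>N\<^esub> = \<pi> \<zero>"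
    by (simp_all add: N_def)
  have add: "\<pi> a \<oplus>\<^bsub>N\<^esub> \<pi> b = \<pi> (a \<oplus> b)" if "a \<in> carrier R" "b \<in> carrier R" for a b
    using that \<pi>(1) by (simp add: N_def \<pi>_addl \<pi>_addr)
  have smult: "c \<odot>\<^bsub>N\<^esub> \<pi> a = \<pi> (c \<otimes> a)" if "a \<in> carrier R" "c \<in> carrier R" for a c
    using that by (simp add: N_def \<pi>_mult)
  have ag: "abelian_group N"
  proof (rule abelian_groupI)
    fix x assume "x \<in> carrier N"
    then obtain a where a: "x = \<pi> a" "a \<in> carrier R" by (auto simp: carr)
    show "\<exists>y \<in> carrier N. y \<oplus>\<^bsub>N\<^esub> x = \<zero>\<^bsub>N\<^esub>"
      by (rule bexI[of _ "\<pi> (\<ominus> a)"]) (use a in \<open>simp_all add: carr add zero l_neg\<close>)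
  qed (auto simp: carr add zero a_ac)
  interpret N: abelian_group N by (rule ag)
  have lm: "left_module R N"
    using ag by (auto simp: left_module_def carr smult add m_closed m_assoc l_distr r_distr)
  \<comment> \<open>By \<open>unit\<close>, a - a e lies in every left ideal above \<open>L\<close>,
    so such an ideal is everything once it contains \<open>e\<close>. Maximality among left ideals
    missing \<open>e\<close> thus becomes maximality among all proper ones.\<close>
  have eL: "K = carrier R" if K: "left_ideal K" "L \<subseteq> K" "e \<in> K" for K
  proof
    show "K \<subseteq> carrier R" using K by (auto simp: left_ideal_def)
    show "carrier R \<subseteq> K"
    proof
      fix a assume a: "a \<in> carrier R"
      have "a = (a \<ominus> a \<otimes> e) \<oplus> a \<otimes> e"
        using a e(1) by (simp add: minus_eq m_closed a_ac r_neg)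
      moreover have "a \<ominus> a \<otimes> e \<in> K" using unit[OF a] L(2) K(2) by blast
      then have "(a \<ominus> a \<otimes> e) \<oplus> a \<otimes> e \<in> K"
        using left_idealD(5)[OF K(1)] left_idealD(6)[OF K(1) a K(3)] by blast
      ultimately show "a \<in> K" by simp
    qed
  qed
  have simple: "H = {\<zero>\<^bsub>N\<^esub>} \<or> H = carrier N" if H: "submodule H R N" for H
  proof -
    interpret H: submodule H R N by (rule H)
    define K where "K = {a \<in> carrier R. \<pi> a \<in> H}"
    have HK: "H = \<pi> ` K" using H.subset by (auto simp: K_def carr)
    have "left_ideal K"
      unfolding left_ideal_def
    proof (intro conjI ballI)
      show "K \<subseteq> carrier R" by (auto simp: K_def)
      show "\<zero> \<in> K" using H.one_closed by (simp add: K_def zero)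
      show "c \<otimes> a \<in> K" if "c \<in> carrier R" "a \<in> K" for c a
        using that H.smult_closed[of c "\<pi> a"] by (simp add: K_def smult m_closed)
      show "a \<ominus> b \<in> K" if "a \<in> K" "b \<in> K" for a b
      proof -
        have ab: "a \<in> carrier R" "\<pi> a \<in> H" "b \<in> carrier R" "\<pi> b \<in> H"
          using that by (auto simp: K_def)
        have "\<ominus>\<^bsub>N\<^esub> \<pi> b = \<pi> (\<ominus> b)"
          by (rule N.minus_equality) (use ab in \<open>simp_all add: carr add zero l_neg\<close>)
        then have "\<pi> (\<ominus> b) \<in> H" using H.m_inv_closed[OF ab(4)] by (simp add: a_inv_def)
        then show ?thesis
          using H.m_closed[OF ab(2), of "\<pi> (\<ominus> b)"] ab by (simp add: K_def add minus_eq)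
      qed
    qed
    moreover have "L \<subseteq> K"
    proof
      fix a assume "a \<in> L"
      then have "a \<in> carrier R" "\<pi> a = \<zero>\<^bsub>N\<^esub>" using LD(1) \<pi>_zero zero by metis+
      then show "a \<in> K" using H.one_closed by (simp add: K_def)
    qed
    ultimately have "K = L \<or> K = carrier R" using max eL by blast
    moreover have "\<pi> ` L = {\<zero>\<^bsub>N\<^esub>}"
    proof -
      have "\<pi> a = \<zero>\<^bsub>N\<^esub>" if "a \<in> L" for a using that LD(1) \<pi>_zero zero by metis
      moreover have "\<zero>\<^bsub>N\<^esub> \<in> \<pi> ` L" using LD(2) zero by blast
      ultimately show ?thesis by blast
    qed
    ultimately show ?thesis using HK carr by blast
  qed
  \<comment> \<open>The action on the quotient is nontrivial: \<open>e\<close> sends its own class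
    to that of e e, which is congruent to \<open>e\<close>.\<close>
  have ee: "e \<otimes> e \<notin> L"
  proof
    assume *: "e \<otimes> e \<in> L"
    have "e = (e \<ominus> e \<otimes> e) \<oplus> e \<otimes> e"
      using e(1) by (simp add: minus_eq m_closed a_ac r_neg)
    moreover have "e \<ominus> e \<otimes> e \<in> L" using unit[OF e(1)] L(2) by blast
    ultimately show False using LD(5)[OF _ *, of "e \<ominus> e \<otimes> e"] L(3) by simp
  qed
  have "simple_left_module R N"
    unfolding simple_left_module_def
    using lm simple ee e(1) by (auto simp: carr zero smult \<pi>_zero m_closed)
  moreover have "faithful_left_module R N"
    unfolding faithful_left_module_def
  proof (intro conjI ballI impI lm)
    fix f assume f: "f \<in> carrier R" "\<forall>n\<in>carrier N. f \<odot>\<^bsub>N\<^esub> n = \<zero>\<^bsub>N\<^esub>"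
    have fL: "f \<otimes> b \<in> L" if "b \<in> carrier R" for b
      using f that by (simp add: carr zero smult \<pi>_zero m_closed)
    show "f = \<zero>"
    proof (rule ccontr)
      assume "f \<noteq> \<zero>"
      then obtain a b where ab: "a \<in> carrier R" "b \<in> carrier R" "a \<otimes> (f \<otimes> b) \<ominus> e \<in> L0"
        using comax[OF f(1)] by blast
      have *: "a \<otimes> (f \<otimes> b) \<in> L" using fL[OF ab(2)] ab(1) LD(6) by blast
      have "e = a \<otimes> (f \<otimes> b) \<ominus> (a \<otimes> (f \<otimes> b) \<ominus> e)"
        using ab f e(1) by (simp add: minus_eq minus_add m_closed a_ac r_neg1 r_neg2 r_neg)
      then show False using LD(3)[OF *, of "a \<otimes> (f \<otimes> b) \<ominus> e"] ab(3) L(2,3) by auto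
    qed
  qed
  ultimately show ?thesis
    using left_primitiveI abelian_group_axioms m_closed by blast
qed

end


section \<open>The convolution product\<close>

locale algebraic_groupoid =
  fixes G :: "('g, 'x) top_groupoid"
  assumes dom_closed: "\<gamma> \<in> arrows G \<Longrightarrow> gdom G \<gamma> \<in> topspace (unit_topology G)"
    and rng_closed: "\<gamma> \<in> arrows G \<Longrightarrow> grng G \<gamma> \<in> topspace (unit_topology G)"
    and comp_closed: "\<lbrakk>\<beta> \<in> arrows G; \<gamma> \<in> arrows G; gdom G \<beta> = grng G \<gamma>\<rbrakk> \<Longrightarrow> gcomp G \<beta> \<gamma> \<in> arrows G"
    and dom_comp: "\<lbrakk>\<beta> \<in> arrows G; \<gamma> \<in> arrows G; gdom G \<beta> = grng G \<gamma>\<rbrakk> \<Longrightarrow>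
      gdom G (gcomp G \<beta> \<gamma>) = gdom G \<gamma>"
    and rng_comp: "\<lbrakk>\<beta> \<in> arrows G; \<gamma> \<in> arrows G; gdom G \<beta> = grng G \<gamma>\<rbrakk> \<Longrightarrow>
      grng G (gcomp G \<beta> \<gamma>) = grng G \<beta>"
    and comp_assoc: "\<lbrakk>\<alpha> \<in> arrows G; \<beta> \<in> arrows G; \<gamma> \<in> arrows G; gdom G \<alpha> = grng G \<beta>;
      gdom G \<beta> = grng G \<gamma>\<rbrakk> \<Longrightarrow> gcomp G (gcomp G \<alpha> \<beta>) \<gamma> = gcomp G \<alpha> (gcomp G \<beta> \<gamma>)"
    and unit_closed: "x \<in> topspace (unit_topology G) \<Longrightarrow> gunit G x \<in> arrows G"
    and dom_unit: "x \<in> topspace (unit_topology G) \<Longrightarrow> gdom G (gunit G x) = x"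
    and rng_unit: "x \<in> topspace (unit_topology G) \<Longrightarrow> grng G (gunit G x) = x"
    and comp_unit_left: "\<gamma> \<in> arrows G \<Longrightarrow> gcomp G (gunit G (grng G \<gamma>)) \<gamma> = \<gamma>"
    and comp_unit_right: "\<gamma> \<in> arrows G \<Longrightarrow> gcomp G \<gamma> (gunit G (gdom G \<gamma>)) = \<gamma>"
    and inv_closed: "\<gamma> \<in> arrows G \<Longrightarrow> ginv G \<gamma> \<in> arrows G"
    and dom_inv: "\<gamma> \<in> arrows G \<Longrightarrow> gdom G (ginv G \<gamma>) = grng G \<gamma>"
    and rng_inv: "\<gamma> \<in> arrows G \<Longrightarrow> grng G (ginv G \<gamma>) = gdom G \<gamma>"
    and comp_inv_left: "\<gamma> \<in> arrows G \<Longrightarrow> gcomp G (ginv G \<gamma>) \<gamma> = gunit G (gdom G \<gamma>)"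
    and comp_inv_right: "\<gamma> \<in> arrows G \<Longrightarrow> gcomp G \<gamma> (ginv G \<gamma>) = gunit G (grng G \<gamma>)"
begin

abbreviation "units \<equiv> topspace (unit_topology G)"
abbreviation "src \<equiv> gdom G"
abbreviation "tgt \<equiv> grng G"
abbreviation gmult (infixr \<open>\<cdot>\<close> 70) where "\<beta> \<cdot> \<gamma> \<equiv> gcomp G \<beta> \<gamma>"

lemmas groupoid_simps = dom_closed rng_closed comp_closed dom_comp rng_comp unit_closed
  dom_unit rng_unit comp_unit_left comp_unit_right inv_closed dom_inv rng_inv

lemma cancel_right:
  assumes "\<beta> \<in> arrows G" "\<beta>' \<in> arrows G" "\<rho> \<in> arrows G" "src \<beta> = tgt \<rho>" "src \<beta>' = tgt \<rho>"
    and "\<beta> \<cdot> \<rho> = \<beta>' \<cdot> \<rho>"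
  shows "\<beta> = \<beta>'"
proof -
  have "(\<beta> \<cdot> \<rho>) \<cdot> ginv G \<rho> = (\<beta>' \<cdot> \<rho>) \<cdot> ginv G \<rho>" using assms(6) by simp
  then show ?thesis
    using assms(1-5) comp_unit_right[of \<beta>] comp_unit_right[of \<beta>']
    by (simp add: comp_assoc groupoid_simps comp_inv_right)
qed

lemma cancel_left:
  assumes "\<rho> \<in> arrows G" "\<rho>' \<in> arrows G" "\<beta> \<in> arrows G" "src \<beta> = tgt \<rho>" "src \<beta> = tgt \<rho>'"
    and "\<beta> \<cdot> \<rho> = \<beta> \<cdot> \<rho>'"
  shows "\<rho> = \<rho>'"
proof -
  have "ginv G \<beta> \<cdot> (\<beta> \<cdot> \<sigma>) = \<sigma>" if "\<sigma> \<in> arrows G" "src \<beta> = tgt \<sigma>" for \<sigma>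
    using that assms(3) comp_assoc[of "ginv G \<beta>" \<beta> \<sigma>] comp_unit_left[of \<sigma>]
    by (simp add: inv_closed dom_inv comp_inv_left)
  then show ?thesis using assms by metis
qed

text \<open>Once the right factor \<open>\<rho>\<close> is fixed, the left factor of
  \<open>\<gamma>\<close> is forced. Factorisations of \<open>\<gamma>\<close> are thus indexed by
  the arrows with the same source, which turns a convolution into a sum over one variable.\<close>

lemma divide_right:
  assumes "\<gamma> \<in> arrows G" "\<rho> \<in> arrows G" "src \<gamma> = src \<rho>"
  shows "\<gamma> \<cdot> ginv G \<rho> \<in> arrows G" "src (\<gamma> \<cdot> ginv G \<rho>) = tgt \<rho>"
    "tgt (\<gamma> \<cdot> ginv G \<rho>) = tgt \<gamma>" "(\<gamma> \<cdot> ginv G \<rho>) \<cdot> \<rho> = \<gamma>"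
  using assms comp_unit_right[of \<gamma>]
  by (simp_all add: groupoid_simps comp_assoc comp_inv_left)

end


section \<open>Stalks, transport and the additive group of all sections\<close>

locale sheaf_groupoid = algebraic_groupoid G
  for G :: "('g, 'x) top_groupoid" +
  fixes \<O> :: "('g, 'x, 'e) gsheaf_of_rings"
  assumes sheaf: "is_gsheaf_of_rings G \<O>"
begin

abbreviation "tr \<equiv> transport \<O>"
abbreviation "Sec \<equiv> all_sections G \<O>"
abbreviation "sections \<equiv> carrier Sec"
abbreviation "conv \<equiv> convolution G \<O>"
abbreviation "val_zero \<gamma> \<equiv> \<zero>\<^bsub>stalk \<O> (grng G \<gamma>)\<^esub>"

lemma stalk_is_ring: "x \<in> units \<Longrightarrow> ring (stalk \<O> x)"
  and stalk_carrier: "x \<in> units \<Longrightarrow>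
    carrier (stalk \<O> x) = {e \<in> topspace (total \<O>). proj \<O> e = x}"
  and tr_hom: "\<gamma> \<in> arrows G \<Longrightarrow> tr \<gamma> \<in> ring_hom (stalk \<O> (src \<gamma>)) (stalk \<O> (tgt \<gamma>))"
  and gsheaf: "is_gsheaf G \<O>"
  using sheaf by (auto simp: is_gsheaf_of_rings_def)

lemma proj_closed: "e \<in> topspace (total \<O>) \<Longrightarrow> proj \<O> e \<in> units"
  using gsheaf by (auto simp: is_gsheaf_def)

lemma tr_unit: "x \<in> units \<Longrightarrow> e \<in> carrier (stalk \<O> x) \<Longrightarrow> tr (gunit G x) e = e"
  using gsheaf by (auto simp: is_gsheaf_def stalk_carrier)

lemma tr_comp: "\<lbrakk>\<beta> \<in> arrows G; \<gamma> \<in> arrows G; src \<beta> = tgt \<gamma>; e \<in> carrier (stalk \<O> (src \<gamma>))\<rbrakk>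
    \<Longrightarrow> tr \<beta> (tr \<gamma> e) = tr (\<beta> \<cdot> \<gamma>) e"
  using gsheaf by (simp add: is_gsheaf_def stalk_carrier dom_closed)

lemma tr_closed: "\<gamma> \<in> arrows G \<Longrightarrow> e \<in> carrier (stalk \<O> (src \<gamma>)) \<Longrightarrow>
    tr \<gamma> e \<in> carrier (stalk \<O> (tgt \<gamma>))"
  using tr_hom by (rule ring_hom_closed)

lemma tr_zero: "\<gamma> \<in> arrows G \<Longrightarrow> tr \<gamma> \<zero>\<^bsub>stalk \<O> (src \<gamma>)\<^esub> = val_zero \<gamma>"
  by (intro ring_hom_zero[OF tr_hom] stalk_is_ring dom_closed rng_closed)

lemma sections_value:
  "f \<in> sections \<Longrightarrow> \<gamma> \<in> arrows G \<Longrightarrow> f \<gamma> \<in> carrier (stalk \<O> (tgt \<gamma>))"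
  by (simp add: all_sections_def stalk_carrier rng_closed)

lemma sectionsI:
  "f \<in> extensional (arrows G) \<Longrightarrow> (\<And>\<gamma>. \<gamma> \<in> arrows G \<Longrightarrow> f \<gamma> \<in> carrier (stalk \<O> (tgt \<gamma>)))
    \<Longrightarrow> f \<in> sections"
  by (auto simp: all_sections_def stalk_carrier rng_closed)

lemma sections_eqI:
  "f \<in> sections \<Longrightarrow> g \<in> sections \<Longrightarrow> (\<And>\<gamma>. \<gamma> \<in> arrows G \<Longrightarrow> f \<gamma> = g \<gamma>) \<Longrightarrow> f = g"
  by (auto simp: all_sections_def intro: extensionalityI)

lemma add_apply: "\<gamma> \<in> arrows G \<Longrightarrow> (f \<oplus>\<^bsub>Sec\<^esub> g) \<gamma> = f \<gamma> \<oplus>\<^bsub>stalk \<O> (tgt \<gamma>)\<^esub> g \<gamma>"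
  and zero_apply: "\<gamma> \<in> arrows G \<Longrightarrow> \<zero>\<^bsub>Sec\<^esub> \<gamma> = val_zero \<gamma>"
  by (simp_all add: all_sections_def)

lemma stalk_ring_rng: "\<gamma> \<in> arrows G \<Longrightarrow> ring (stalk \<O> (tgt \<gamma>))"
  by (simp add: stalk_is_ring rng_closed)

lemma abelian_group_sections: "abelian_group Sec"
proof (rule abelian_groupI)
  have add: "f \<oplus>\<^bsub>Sec\<^esub> g \<in> extensional (arrows G)" and zero: "\<zero>\<^bsub>Sec\<^esub> \<in> extensional (arrows G)" for f g
    by (simp_all add: all_sections_def)
  have carr: "x \<oplus>\<^bsub>Sec\<^esub> y \<in> sections" if "x \<in> sections" "y \<in> sections" for x y
  proof (intro sectionsI add)
    fix \<gamma> assume \<gamma>: "\<gamma> \<in> arrows G"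
    interpret ring "stalk \<O> (tgt \<gamma>)" by (rule stalk_ring_rng[OF \<gamma>])
    show "(x \<oplus>\<^bsub>Sec\<^esub> y) \<gamma> \<in> carrier (stalk \<O> (tgt \<gamma>))"
      using that \<gamma> by (simp add: add_apply sections_value)
  qed
  then show "\<And>x y. x \<in> sections \<Longrightarrow> y \<in> sections \<Longrightarrow> x \<oplus>\<^bsub>Sec\<^esub> y \<in> sections" .
  show Z: "\<zero>\<^bsub>Sec\<^esub> \<in> sections"
    by (intro sectionsI zero) (simp add: zero_apply ring.ring_simprules(2) stalk_ring_rng)
  show "x \<oplus>\<^bsub>Sec\<^esub> y \<oplus>\<^bsub>Sec\<^esub> z = x \<oplus>\<^bsub>Sec\<^esub> (y \<oplus>\<^bsub>Sec\<^esub> z)"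
    if "x \<in> sections" "y \<in> sections" "z \<in> sections" for x y z
  proof (intro sections_eqI carr that)
    fix \<gamma> assume \<gamma>: "\<gamma> \<in> arrows G"
    interpret ring "stalk \<O> (tgt \<gamma>)" by (rule stalk_ring_rng[OF \<gamma>])
    show "(x \<oplus>\<^bsub>Sec\<^esub> y \<oplus>\<^bsub>Sec\<^esub> z) \<gamma> = (x \<oplus>\<^bsub>Sec\<^esub> (y \<oplus>\<^bsub>Sec\<^esub> z)) \<gamma>"
      using that \<gamma> by (simp add: add_apply sections_value a_assoc)
  qed
  show "x \<oplus>\<^bsub>Sec\<^esub> y = y \<oplus>\<^bsub>Sec\<^esub> x" if "x \<in> sections" "y \<in> sections" for x y
  proof (intro sections_eqI carr that)
    fix \<gamma> assume \<gamma>: "\<gamma> \<in> arrows G"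
    interpret ring "stalk \<O> (tgt \<gamma>)" by (rule stalk_ring_rng[OF \<gamma>])
    show "(x \<oplus>\<^bsub>Sec\<^esub> y) \<gamma> = (y \<oplus>\<^bsub>Sec\<^esub> x) \<gamma>"
      using that \<gamma> by (simp add: add_apply sections_value a_comm)
  qed
  show "\<zero>\<^bsub>Sec\<^esub> \<oplus>\<^bsub>Sec\<^esub> x = x" if "x \<in> sections" for x
  proof (intro sections_eqI carr that Z)
    fix \<gamma> assume \<gamma>: "\<gamma> \<in> arrows G"
    interpret ring "stalk \<O> (tgt \<gamma>)" by (rule stalk_ring_rng[OF \<gamma>])
    show "(\<zero>\<^bsub>Sec\<^esub> \<oplus>\<^bsub>Sec\<^esub> x) \<gamma> = x \<gamma>"
      using that \<gamma> by (simp add: add_apply zero_apply sections_value)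
  qed
  show "\<exists>y\<in>sections. y \<oplus>\<^bsub>Sec\<^esub> x = \<zero>\<^bsub>Sec\<^esub>" if x: "x \<in> sections" for x
  proof
    let ?y = "\<lambda>\<gamma>\<in>arrows G. \<ominus>\<^bsub>stalk \<O> (tgt \<gamma>)\<^esub> x \<gamma>"
    show y: "?y \<in> sections"
      using x sections_value abelian_group.a_inv_closed[OF ring.is_abelian_group[OF stalk_ring_rng]]
      by (intro sectionsI) simp_all
    show "?y \<oplus>\<^bsub>Sec\<^esub> x = \<zero>\<^bsub>Sec\<^esub>"
    proof (intro sections_eqI carr x y Z)
      fix \<gamma> assume \<gamma>: "\<gamma> \<in> arrows G"
      interpret ring "stalk \<O> (tgt \<gamma>)" by (rule stalk_ring_rng[OF \<gamma>])
      show "(?y \<oplus>\<^bsub>Sec\<^esub> x) \<gamma> = \<zero>\<^bsub>Sec\<^esub> \<gamma>"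
        using x \<gamma> by (simp add: add_apply zero_apply sections_value l_neg)
    qed
  qed
qed

sublocale Sec: abelian_group Sec
  by (rule abelian_group_sections)

lemma minus_apply:
  assumes "f \<in> sections" "\<gamma> \<in> arrows G"
  shows "(\<ominus>\<^bsub>Sec\<^esub> f) \<gamma> = \<ominus>\<^bsub>stalk \<O> (tgt \<gamma>)\<^esub> f \<gamma>"
proof -
  interpret ring "stalk \<O> (tgt \<gamma>)" by (rule stalk_ring_rng[OF assms(2)])
  have "(\<ominus>\<^bsub>Sec\<^esub> f \<oplus>\<^bsub>Sec\<^esub> f) \<gamma> = \<zero>\<^bsub>Sec\<^esub> \<gamma>" using Sec.l_neg[OF assms(1)] by simp
  then show ?thesis
    using assms by (intro minus_equality[symmetric])
      (simp_all add: add_apply zero_apply sections_value)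
qed

section \<open>Support and single-term evaluation of convolutions\<close>

lemma conv_term_closed:
  assumes "f \<in> sections" "g \<in> sections" "\<beta> \<in> arrows G" "\<rho> \<in> arrows G" "src \<beta> = tgt \<rho>"
    and "x = tgt \<beta>"
  shows "f \<beta> \<otimes>\<^bsub>stalk \<O> x\<^esub> tr \<beta> (g \<rho>) \<in> carrier (stalk \<O> x)"
proof -
  interpret ring "stalk \<O> (tgt \<beta>)" by (rule stalk_ring_rng[OF assms(3)])
  show ?thesis using assms tr_closed[of \<beta> "g \<rho>"] by (simp add: sections_value)
qed

lemma conv_term_zero:
  assumes "f \<in> sections" "g \<in> sections" "\<beta> \<in> arrows G" "\<rho> \<in> arrows G" "src \<beta> = tgt \<rho>"
    and "x = tgt \<beta>" "f \<beta> = val_zero \<beta> \<or> g \<rho> = val_zero \<rho>"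
  shows "f \<beta> \<otimes>\<^bsub>stalk \<O> x\<^esub> tr \<beta> (g \<rho>) = \<zero>\<^bsub>stalk \<O> x\<^esub>"
proof -
  interpret ring "stalk \<O> (tgt \<beta>)" by (rule stalk_ring_rng[OF assms(3)])
  have "tr \<beta> (g \<rho>) \<in> carrier (stalk \<O> (tgt \<beta>))"
    using assms tr_closed[of \<beta> "g \<rho>"] by (simp add: sections_value)
  then show ?thesis using assms tr_zero[of \<beta>] sections_value[of f \<beta>] by auto
qed

lemma conv_closed:
  assumes "f \<in> sections" "g \<in> sections"
  shows "conv f g \<in> sections"
proof (rule sectionsI)
  show "conv f g \<in> extensional (arrows G)" by (simp add: convolution_def)
  fix \<gamma> assume \<gamma>: "\<gamma> \<in> arrows G"
  interpret ring "stalk \<O> (tgt \<gamma>)" by (rule stalk_ring_rng[OF \<gamma>])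
  show "conv f g \<gamma> \<in> carrier (stalk \<O> (tgt \<gamma>))"
    unfolding convolution_def restrict_apply'[OF \<gamma>]
    by (rule finsum_closed) (auto intro!: conv_term_closed assms simp: rng_comp)
qed

text \<open>The sum runs over nonzero terms, so under \<open>only\<close> its index set is the one
  pair or empty. In the second case the term of that pair is itself zero, and the same formula gives
  the value.\<close>

lemma conv_eq_term:
  assumes fg: "f \<in> sections" "g \<in> sections" and a: "\<beta> \<in> arrows G" "\<rho> \<in> arrows G" "src \<beta> = tgt \<rho>"
    and only: "\<And>\<beta>' \<rho>'. \<lbrakk>\<beta>' \<in> arrows G; \<rho>' \<in> arrows G; src \<beta>' = tgt \<rho>'; \<beta>' \<cdot> \<rho>' = \<beta> \<cdot> \<rho>;
      f \<beta>' \<noteq> val_zero \<beta>'; g \<rho>' \<noteq> val_zero \<rho>'\<rbrakk> \<Longrightarrow> \<beta>' = \<beta> \<and> \<rho>' = \<rho>"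
  shows "conv f g (\<beta> \<cdot> \<rho>) = f \<beta> \<otimes>\<^bsub>stalk \<O> (tgt \<beta>)\<^esub> tr \<beta> (g \<rho>)"
proof -
  interpret ring "stalk \<O> (tgt \<beta>)" by (rule stalk_ring_rng[OF a(1)])
  let ?I = "{(\<beta>', \<rho>'). \<beta>' \<in> arrows G \<and> \<rho>' \<in> arrows G \<and> src \<beta>' = tgt \<rho>' \<and> \<beta>' \<cdot> \<rho>' = \<beta> \<cdot> \<rho> \<and>
     f \<beta>' \<otimes>\<^bsub>stalk \<O> (tgt \<beta>)\<^esub> tr \<beta>' (g \<rho>') \<noteq> \<zero>\<^bsub>stalk \<O> (tgt \<beta>)\<^esub>}"
  let ?t = "f \<beta> \<otimes>\<^bsub>stalk \<O> (tgt \<beta>)\<^esub> tr \<beta> (g \<rho>)"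
  have sub: "?I \<subseteq> {(\<beta>, \<rho>)}"
  proof clarify
    fix \<beta>' \<rho>'
    assume b: "\<beta>' \<in> arrows G" "\<rho>' \<in> arrows G" "src \<beta>' = tgt \<rho>'" "\<beta>' \<cdot> \<rho>' = \<beta> \<cdot> \<rho>"
      and nz: "f \<beta>' \<otimes>\<^bsub>stalk \<O> (tgt \<beta>)\<^esub> tr \<beta>' (g \<rho>') \<noteq> \<zero>\<^bsub>stalk \<O> (tgt \<beta>)\<^esub>"
    have "tgt \<beta>' = tgt \<beta>" using b a rng_comp by metis
    then show "\<beta>' = \<beta> \<and> \<rho>' = \<rho>"
      using only[OF b] conv_term_zero[OF fg b(1-3), of "tgt \<beta>"] nz by metis
  qed
  have "conv f g (\<beta> \<cdot> \<rho>) =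
     finsum (stalk \<O> (tgt \<beta>)) (\<lambda>(\<beta>', \<rho>'). f \<beta>' \<otimes>\<^bsub>stalk \<O> (tgt \<beta>)\<^esub> tr \<beta>' (g \<rho>')) ?I"
    using a by (simp add: convolution_def comp_closed rng_comp)
  also have "\<dots> = ?t"
  proof (cases "?t = \<zero>\<^bsub>stalk \<O> (tgt \<beta>)\<^esub>")
    case True
    then have I: "?I = {}" using sub by auto
    show ?thesis unfolding I using True by simp
  next
    case False
    then have I: "?I = {(\<beta>, \<rho>)}" using sub a by auto
    show ?thesis
      unfolding I using conv_term_closed[OF fg a] by (simp add: finsum_insert)
  qed
  finally show ?thesis .
qed

text \<open>An empty index set gives zero, and a nonzero term needs both factors nonzero because
  transport preserves zero. Later bounds on supports of products come from this.\<close>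

lemma conv_nonzero:
  assumes fg: "f \<in> sections" "g \<in> sections" and \<gamma>: "\<gamma> \<in> arrows G" "conv f g \<gamma> \<noteq> val_zero \<gamma>"
  obtains \<beta> \<rho> where "\<beta> \<in> arrows G" "\<rho> \<in> arrows G" "src \<beta> = tgt \<rho>" "\<gamma> = \<beta> \<cdot> \<rho>"
    "f \<beta> \<noteq> val_zero \<beta>" "g \<rho> \<noteq> val_zero \<rho>"
proof -
  interpret ring "stalk \<O> (tgt \<gamma>)" by (rule stalk_ring_rng[OF \<gamma>(1)])
  let ?I = "{(\<beta>, \<rho>). \<beta> \<in> arrows G \<and> \<rho> \<in> arrows G \<and> src \<beta> = tgt \<rho> \<and> \<beta> \<cdot> \<rho> = \<gamma> \<and>
     f \<beta> \<otimes>\<^bsub>stalk \<O> (tgt \<gamma>)\<^esub> tr \<beta> (g \<rho>) \<noteq> \<zero>\<^bsub>stalk \<O> (tgt \<gamma>)\<^esub>}"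
  have "?I \<noteq> {}"
  proof
    assume I: "?I = {}"
    have "conv f g \<gamma> = val_zero \<gamma>"
      unfolding convolution_def restrict_apply'[OF \<gamma>(1)] I by simp
    then show False using \<gamma>(2) by simp
  qed
  then obtain \<beta> \<rho> where b: "\<beta> \<in> arrows G" "\<rho> \<in> arrows G" "src \<beta> = tgt \<rho>" "\<beta> \<cdot> \<rho> = \<gamma>"
    "f \<beta> \<otimes>\<^bsub>stalk \<O> (tgt \<gamma>)\<^esub> tr \<beta> (g \<rho>) \<noteq> \<zero>\<^bsub>stalk \<O> (tgt \<gamma>)\<^esub>" by auto
  have "tgt \<gamma> = tgt \<beta>" using b rng_comp by metis
  then show thesis using that b conv_term_zero[OF fg b(1-3)] by metis
qed

text \<open>The algebraic trace of being carried by a bisection. With such a right factor every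
  convolution sum has at most one term.\<close>

definition fibrewise_single :: "('g \<Rightarrow> 'e) \<Rightarrow> bool" where
  "fibrewise_single f \<longleftrightarrow> (\<forall>\<rho>\<in>arrows G. \<forall>\<sigma>\<in>arrows G.
     src \<rho> = src \<sigma> \<longrightarrow> f \<rho> \<noteq> val_zero \<rho> \<longrightarrow> f \<sigma> \<noteq> val_zero \<sigma> \<longrightarrow> \<rho> = \<sigma>)"

text \<open>A product has the source of its right factor, so \<open>g\<close> leaves only
  \<open>\<rho>\<close>, and cancellation then fixes the left factor. The hypothesis also covers a
  \<open>g\<close> that vanishes on the whole fibre, where any \<open>\<rho>\<close> may be
  chosen.\<close>

lemma conv_right_single:
  assumes "f \<in> sections" "g \<in> sections" "\<beta> \<in> arrows G" "\<rho> \<in> arrows G" "src \<beta> = tgt \<rho>"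
    and "\<And>\<sigma>. \<lbrakk>\<sigma> \<in> arrows G; src \<sigma> = src \<rho>; g \<sigma> \<noteq> val_zero \<sigma>\<rbrakk> \<Longrightarrow> \<sigma> = \<rho>"
  shows "conv f g (\<beta> \<cdot> \<rho>) = f \<beta> \<otimes>\<^bsub>stalk \<O> (tgt \<beta>)\<^esub> tr \<beta> (g \<rho>)"
proof (rule conv_eq_term[OF assms(1-5)])
  fix \<beta>' \<rho>' assume b: "\<beta>' \<in> arrows G" "\<rho>' \<in> arrows G" "src \<beta>' = tgt \<rho>'" "\<beta>' \<cdot> \<rho>' = \<beta> \<cdot> \<rho>"
    "g \<rho>' \<noteq> val_zero \<rho>'"
  have "\<rho>' = \<rho>" using assms b dom_comp by metis
  then show "\<beta>' = \<beta> \<and> \<rho>' = \<rho>" using assms b cancel_right by metis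
qed

lemma conv_left_single:
  assumes "f \<in> sections" "g \<in> sections" "\<beta> \<in> arrows G" "\<rho> \<in> arrows G" "src \<beta> = tgt \<rho>"
    and "\<And>\<sigma>. \<lbrakk>\<sigma> \<in> arrows G; tgt \<sigma> = tgt \<beta>; f \<sigma> \<noteq> val_zero \<sigma>\<rbrakk> \<Longrightarrow> \<sigma> = \<beta>"
  shows "conv f g (\<beta> \<cdot> \<rho>) = f \<beta> \<otimes>\<^bsub>stalk \<O> (tgt \<beta>)\<^esub> tr \<beta> (g \<rho>)"
proof (rule conv_eq_term[OF assms(1-5)])
  fix \<beta>' \<rho>' assume b: "\<beta>' \<in> arrows G" "\<rho>' \<in> arrows G" "src \<beta>' = tgt \<rho>'" "\<beta>' \<cdot> \<rho>' = \<beta> \<cdot> \<rho>"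
    "f \<beta>' \<noteq> val_zero \<beta>'"
  have "\<beta>' = \<beta>" using assms b rng_comp by metis
  then show "\<beta>' = \<beta> \<and> \<rho>' = \<rho>" using assms b cancel_left by metis
qed

text \<open>No sums have to be interchanged. Over a given source \<open>h\<close> leaves one arrow
  \<open>\<rho>\<close>, then \<open>g\<close> leaves one arrow \<open>\<sigma>\<close> starting
  where \<open>\<rho>\<close> ends, and the third factor \<open>\<beta>\<close> is found by
  division. Both sides become the same triple product, whatever section \<open>f\<close> is.\<close>

lemma conv_assoc_single:
  assumes fgh: "f \<in> sections" "g \<in> sections" "h \<in> sections"
    and sg: "fibrewise_single g" and sh: "fibrewise_single h"
  shows "conv (conv f g) h = conv f (conv g h)"
proof (intro sections_eqI conv_closed fgh)
  \<comment> \<open>When \<open>k\<close> vanishes on the whole fibre, the unit at \<open>x\<close>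
    serves as the arrow.\<close>
  have rep: "\<exists>\<rho>\<in>arrows G. src \<rho> = x \<and> (\<forall>\<sigma>\<in>arrows G. src \<sigma> = x \<longrightarrow> k \<sigma> \<noteq> val_zero \<sigma> \<longrightarrow> \<sigma> = \<rho>)"
    if "fibrewise_single k" "x \<in> units" for k x
    using that unit_closed dom_unit unfolding fibrewise_single_def by metis
  fix \<gamma> assume \<gamma>: "\<gamma> \<in> arrows G"
  obtain \<rho> where \<rho>: "\<rho> \<in> arrows G" "src \<rho> = src \<gamma>"
    and h: "\<And>\<sigma>. \<sigma> \<in> arrows G \<Longrightarrow> src \<sigma> = src \<rho> \<Longrightarrow> h \<sigma> \<noteq> val_zero \<sigma> \<Longrightarrow> \<sigma> = \<rho>"
    using rep[OF sh dom_closed[OF \<gamma>]] by metis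
  define \<delta> where "\<delta> = \<gamma> \<cdot> ginv G \<rho>"
  have \<delta>: "\<delta> \<in> arrows G" "src \<delta> = tgt \<rho>" "\<gamma> = \<delta> \<cdot> \<rho>"
    unfolding \<delta>_def using divide_right[OF \<gamma> \<rho>(1)] \<rho>(2) by auto
  obtain \<sigma> where \<sigma>: "\<sigma> \<in> arrows G" "src \<sigma> = tgt \<rho>"
    and g: "\<And>\<tau>. \<tau> \<in> arrows G \<Longrightarrow> src \<tau> = src \<sigma> \<Longrightarrow> g \<tau> \<noteq> val_zero \<tau> \<Longrightarrow> \<tau> = \<sigma>"
    using rep[OF sg rng_closed[OF \<rho>(1)]] by metis
  define \<beta> where "\<beta> = \<delta> \<cdot> ginv G \<sigma>"
  have \<beta>: "\<beta> \<in> arrows G" "src \<beta> = tgt \<sigma>" "\<delta> = \<beta> \<cdot> \<sigma>"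
    unfolding \<beta>_def using divide_right[OF \<delta>(1) \<sigma>(1)] \<delta>(2) \<sigma>(2) by auto
  have r: "tgt \<delta> = tgt \<beta>" using \<beta> \<sigma> by (simp add: rng_comp)
  interpret ring "stalk \<O> (tgt \<beta>)" by (rule stalk_ring_rng[OF \<beta>(1)])
  have "conv (conv f g) h \<gamma> = conv f g \<delta> \<otimes>\<^bsub>stalk \<O> (tgt \<beta>)\<^esub> tr \<delta> (h \<rho>)"
    using conv_right_single[OF conv_closed[OF fgh(1,2)] fgh(3) \<delta>(1) \<rho>(1) \<delta>(2)] h \<delta>(3) r by simp
  also have "conv f g \<delta> = f \<beta> \<otimes>\<^bsub>stalk \<O> (tgt \<beta>)\<^esub> tr \<beta> (g \<sigma>)"
    using conv_right_single[OF fgh(1,2) \<beta>(1) \<sigma>(1) \<beta>(2)] g \<beta>(3) by simp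
  also have "tr \<delta> (h \<rho>) = tr \<beta> (tr \<sigma> (h \<rho>))"
    unfolding \<beta>(3) using tr_comp[OF \<beta>(1) \<sigma>(1) \<beta>(2), of "h \<rho>"] sections_value[OF fgh(3) \<rho>(1)] \<sigma>(2) by simp
  finally have 1: "conv (conv f g) h \<gamma> =
    f \<beta> \<otimes>\<^bsub>stalk \<O> (tgt \<beta>)\<^esub> tr \<beta> (g \<sigma>) \<otimes>\<^bsub>stalk \<O> (tgt \<beta>)\<^esub> tr \<beta> (tr \<sigma> (h \<rho>))" .
  have \<sigma>\<rho>: "\<sigma> \<cdot> \<rho> \<in> arrows G" "src (\<sigma> \<cdot> \<rho>) = src \<rho>" "src \<beta> = tgt (\<sigma> \<cdot> \<rho>)" "\<gamma> = \<beta> \<cdot> (\<sigma> \<cdot> \<rho>)"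
    using \<sigma> \<rho> \<beta> \<delta> by (simp_all add: groupoid_simps comp_assoc)
  \<comment> \<open>The inner product is again confined to one arrow over this source, so
    \<open>conv_right_single\<close> applies to it as a right factor.\<close>
  have gh: "\<tau> = \<sigma> \<cdot> \<rho>"
    if \<tau>: "\<tau> \<in> arrows G" "src \<tau> = src (\<sigma> \<cdot> \<rho>)" "conv g h \<tau> \<noteq> val_zero \<tau>" for \<tau>
  proof -
    obtain \<beta>' \<rho>' where b: "\<beta>' \<in> arrows G" "\<rho>' \<in> arrows G" "src \<beta>' = tgt \<rho>'" "\<tau> = \<beta>' \<cdot> \<rho>'"
      "g \<beta>' \<noteq> val_zero \<beta>'" "h \<rho>' \<noteq> val_zero \<rho>'"
      by (rule conv_nonzero[OF fgh(2,3) \<tau>(1,3)])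
    have "\<rho>' = \<rho>" using h b \<tau>(2) \<sigma>\<rho>(2) dom_comp by metis
    moreover have "\<beta>' = \<sigma>" using g b \<sigma>(2) calculation by metis
    ultimately show ?thesis using b by simp
  qed
  have "conv f (conv g h) \<gamma> = f \<beta> \<otimes>\<^bsub>stalk \<O> (tgt \<beta>)\<^esub> tr \<beta> (conv g h (\<sigma> \<cdot> \<rho>))"
    unfolding \<sigma>\<rho>(4)
    by (rule conv_right_single[OF fgh(1) conv_closed[OF fgh(2,3)] \<beta>(1) \<sigma>\<rho>(1,3) gh])
  also have "conv g h (\<sigma> \<cdot> \<rho>) = g \<sigma> \<otimes>\<^bsub>stalk \<O> (tgt \<sigma>)\<^esub> tr \<sigma> (h \<rho>)"
    using conv_right_single[OF fgh(2,3) \<sigma>(1) \<rho>(1) \<sigma>(2)] h by blast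
  also have "tr \<beta> \<dots> = tr \<beta> (g \<sigma>) \<otimes>\<^bsub>stalk \<O> (tgt \<beta>)\<^esub> tr \<beta> (tr \<sigma> (h \<rho>))"
    using ring_hom_mult[OF tr_hom[OF \<beta>(1)], of "g \<sigma>" "tr \<sigma> (h \<rho>)"] \<beta>(2) \<sigma>
      sections_value[OF fgh(2) \<sigma>(1)] tr_closed[OF \<sigma>(1), of "h \<rho>"] sections_value[OF fgh(3) \<rho>(1)]
    by simp
  finally show "conv (conv f g) h \<gamma> = conv f (conv g h) \<gamma>"
    unfolding 1 using \<beta>(2) \<sigma> tr_closed[OF \<beta>(1), of "g \<sigma>"] tr_closed[OF \<beta>(1), of "tr \<sigma> (h \<rho>)"]
      sections_value[OF fgh(2) \<sigma>(1)] tr_closed[OF \<sigma>(1), of "h \<rho>"] sections_value[OF fgh(3) \<rho>(1)]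
      sections_value[OF fgh(1) \<beta>(1)]
    by (simp add: m_assoc)
qed

section \<open>Convolution as a finite sum, and distributivity\<close>

text \<open>Being carried by a bisection is lost under addition. This weaker condition is not, and
  it is what distributivity asks of right factors.\<close>

definition fibrewise_finite :: "('g \<Rightarrow> 'e) \<Rightarrow> bool" where
  "fibrewise_finite f \<longleftrightarrow> (\<forall>x\<in>units. finite {\<rho>\<in>arrows G. src \<rho> = x \<and> f \<rho> \<noteq> val_zero \<rho>})"

text \<open>The definition sums over a set depending on both factors. Here \<open>F\<close> may be
  any finite part of the source fibre that contains the support of \<open>g\<close> there, so that
  several convolutions can be compared term by term; the additional terms vanish.\<close>

lemma conv_eq_sum:
  assumes fg: "f \<in> sections" "g \<in> sections" and \<gamma>: "\<gamma> \<in> arrows G"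
    and F: "finite F" "F \<subseteq> {\<rho>\<in>arrows G. src \<rho> = src \<gamma>}"
      "\<And>\<rho>. \<lbrakk>\<rho> \<in> arrows G; src \<rho> = src \<gamma>; g \<rho> \<noteq> val_zero \<rho>\<rbrakk> \<Longrightarrow> \<rho> \<in> F"
  shows "conv f g \<gamma> = finsum (stalk \<O> (tgt \<gamma>))
    (\<lambda>\<rho>. f (\<gamma> \<cdot> ginv G \<rho>) \<otimes>\<^bsub>stalk \<O> (tgt \<gamma>)\<^esub> tr (\<gamma> \<cdot> ginv G \<rho>) (g \<rho>)) F"
proof -
  interpret ring "stalk \<O> (tgt \<gamma>)" by (rule stalk_ring_rng[OF \<gamma>])
  let ?t = "\<lambda>(\<beta>, \<rho>). f \<beta> \<otimes>\<^bsub>stalk \<O> (tgt \<gamma>)\<^esub> tr \<beta> (g \<rho>)"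
  let ?q = "\<lambda>\<rho>. (\<gamma> \<cdot> ginv G \<rho>, \<rho>)"
  let ?I = "{(\<beta>, \<rho>). \<beta> \<in> arrows G \<and> \<rho> \<in> arrows G \<and> src \<beta> = tgt \<rho> \<and> \<beta> \<cdot> \<rho> = \<gamma> \<and>
     f \<beta> \<otimes>\<^bsub>stalk \<O> (tgt \<gamma>)\<^esub> tr \<beta> (g \<rho>) \<noteq> \<zero>\<^bsub>stalk \<O> (tgt \<gamma>)\<^esub>}"
  have q: "\<gamma> \<cdot> ginv G \<rho> \<in> arrows G" "\<rho> \<in> arrows G" "src (\<gamma> \<cdot> ginv G \<rho>) = tgt \<rho>"
    "tgt \<gamma> = tgt (\<gamma> \<cdot> ginv G \<rho>)" "(\<gamma> \<cdot> ginv G \<rho>) \<cdot> \<rho> = \<gamma>" if "\<rho> \<in> F" for \<rho>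
    using divide_right[OF \<gamma>, of \<rho>] F(2) that by auto
  have closed: "?t (?q \<rho>) \<in> carrier (stalk \<O> (tgt \<gamma>))" if "\<rho> \<in> F" for \<rho>
    using conv_term_closed[OF fg q(1-4)[OF that]] by simp
  have I: "?I \<subseteq> ?q ` F"
  proof clarify
    fix \<beta> \<rho>
    assume b: "\<beta> \<in> arrows G" "\<rho> \<in> arrows G" "src \<beta> = tgt \<rho>" "\<gamma> = \<beta> \<cdot> \<rho>"
      and nz: "f \<beta> \<otimes>\<^bsub>stalk \<O> (tgt (\<beta> \<cdot> \<rho>))\<^esub> tr \<beta> (g \<rho>) \<noteq> \<zero>\<^bsub>stalk \<O> (tgt (\<beta> \<cdot> \<rho>))\<^esub>"
    have d: "src \<rho> = src \<gamma>" "tgt (\<beta> \<cdot> \<rho>) = tgt \<beta>" using b by (simp_all add: dom_comp rng_comp)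
    have "\<rho> \<in> F" using F(3)[OF b(2) d(1)] conv_term_zero[OF fg b(1-3) d(2)] nz by metis
    moreover have "\<beta> = (\<beta> \<cdot> \<rho>) \<cdot> ginv G \<rho>"
      using cancel_right[of \<beta> "\<gamma> \<cdot> ginv G \<rho>" \<rho>] b q[OF \<open>\<rho> \<in> F\<close>] by metis
    ultimately show "(\<beta>, \<rho>) \<in> (\<lambda>\<rho>'. ((\<beta> \<cdot> \<rho>) \<cdot> ginv G \<rho>', \<rho>')) ` F" by auto
  qed
  have "conv f g \<gamma> = finsum (stalk \<O> (tgt \<gamma>)) ?t ?I"
    using \<gamma> by (simp add: convolution_def)
  also have "\<dots> = finsum (stalk \<O> (tgt \<gamma>)) ?t (?q ` F)"
    by (rule add.finprod_mono_neutral_cong_left) (use F(1) I q closed in \<open>auto simp: Pi_iff\<close>)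
  also have "\<dots> = finsum (stalk \<O> (tgt \<gamma>)) (\<lambda>\<rho>. ?t (?q \<rho>)) F"
    by (rule finsum_reindex) (use closed in \<open>auto simp: inj_on_def\<close>)
  finally show ?thesis by simp
qed

lemma conv_add_left:
  assumes "f \<in> sections" "f' \<in> sections" "g \<in> sections" "fibrewise_finite g"
  shows "conv (f \<oplus>\<^bsub>Sec\<^esub> f') g = conv f g \<oplus>\<^bsub>Sec\<^esub> conv f' g"
proof (intro sections_eqI conv_closed assms Sec.a_closed)
  fix \<gamma> assume \<gamma>: "\<gamma> \<in> arrows G"
  interpret ring "stalk \<O> (tgt \<gamma>)" by (rule stalk_ring_rng[OF \<gamma>])
  let ?F = "{\<rho>\<in>arrows G. src \<rho> = src \<gamma> \<and> g \<rho> \<noteq> val_zero \<rho>}"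
  have F: "finite ?F" "?F \<subseteq> {\<rho>\<in>arrows G. src \<rho> = src \<gamma>}"
    using assms(4) dom_closed[OF \<gamma>] by (auto simp: fibrewise_finite_def)
  have q: "\<gamma> \<cdot> ginv G \<rho> \<in> arrows G" "\<rho> \<in> arrows G" "src (\<gamma> \<cdot> ginv G \<rho>) = tgt \<rho>"
    "tgt (\<gamma> \<cdot> ginv G \<rho>) = tgt \<gamma>" if "\<rho> \<in> ?F" for \<rho>
    using divide_right[OF \<gamma>, of \<rho>] F(2) that by auto
  let ?t = "\<lambda>f g \<rho>. f (\<gamma> \<cdot> ginv G \<rho>) \<otimes>\<^bsub>stalk \<O> (tgt \<gamma>)\<^esub> tr (\<gamma> \<cdot> ginv G \<rho>) (g \<rho>)"
  have S: "conv h g \<gamma> = finsum (stalk \<O> (tgt \<gamma>)) (?t h g) ?F" if "h \<in> sections" for h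
    by (rule conv_eq_sum[OF that assms(3) \<gamma> F]) simp
  have C: "?t h g \<in> ?F \<rightarrow> carrier (stalk \<O> (tgt \<gamma>))" if "h \<in> sections" for h
    by (rule Pi_I) (rule conv_term_closed[OF that assms(3) q(1-3) q(4)[symmetric]])
  have "?t (f \<oplus>\<^bsub>Sec\<^esub> f') g \<rho> = ?t f g \<rho> \<oplus>\<^bsub>stalk \<O> (tgt \<gamma>)\<^esub> ?t f' g \<rho>" if \<rho>: "\<rho> \<in> ?F" for \<rho>
  proof -
    note \<beta> = q[OF \<rho>]
    have "tr (\<gamma> \<cdot> ginv G \<rho>) (g \<rho>) \<in> carrier (stalk \<O> (tgt \<gamma>))"
      using \<beta> tr_closed[OF \<beta>(1), of "g \<rho>"] sections_value[OF assms(3) \<beta>(2)] by simp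
    then show ?thesis
      using \<beta> sections_value[OF assms(1) \<beta>(1)] sections_value[OF assms(2) \<beta>(1)]
      by (simp add: add_apply l_distr)
  qed
  then have "finsum (stalk \<O> (tgt \<gamma>)) (?t (f \<oplus>\<^bsub>Sec\<^esub> f') g) ?F =
      (\<Oplus>\<^bsub>stalk \<O> (tgt \<gamma>)\<^esub>\<rho>\<in>?F. ?t f g \<rho> \<oplus>\<^bsub>stalk \<O> (tgt \<gamma>)\<^esub> ?t f' g \<rho>)"
    using C[OF assms(1)] C[OF assms(2)] by (intro finsum_cong') (auto simp: Pi_iff)
  also have "\<dots> = finsum (stalk \<O> (tgt \<gamma>)) (?t f g) ?F \<oplus>\<^bsub>stalk \<O> (tgt \<gamma>)\<^esub>
      finsum (stalk \<O> (tgt \<gamma>)) (?t f' g) ?F"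
    by (rule finsum_addf) (rule C assms)+
  finally show "conv (f \<oplus>\<^bsub>Sec\<^esub> f') g \<gamma> = (conv f g \<oplus>\<^bsub>Sec\<^esub> conv f' g) \<gamma>"
    using S assms \<gamma> by (simp add: add_apply)
qed

lemma conv_add_right:
  assumes "f \<in> sections" "g \<in> sections" "g' \<in> sections" "fibrewise_finite g" "fibrewise_finite g'"
  shows "conv f (g \<oplus>\<^bsub>Sec\<^esub> g') = conv f g \<oplus>\<^bsub>Sec\<^esub> conv f g'"
proof (intro sections_eqI conv_closed assms Sec.a_closed)
  fix \<gamma> assume \<gamma>: "\<gamma> \<in> arrows G"
  interpret ring "stalk \<O> (tgt \<gamma>)" by (rule stalk_ring_rng[OF \<gamma>])
  \<comment> \<open>The support of a sum lies in the union of the supports, so this one set indexes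
    all three convolutions.\<close>
  let ?F = "{\<rho>\<in>arrows G. src \<rho> = src \<gamma> \<and> g \<rho> \<noteq> val_zero \<rho>} \<union>
    {\<rho>\<in>arrows G. src \<rho> = src \<gamma> \<and> g' \<rho> \<noteq> val_zero \<rho>}"
  have F: "finite ?F" "?F \<subseteq> {\<rho>\<in>arrows G. src \<rho> = src \<gamma>}"
    using assms(4,5) dom_closed[OF \<gamma>] by (auto simp: fibrewise_finite_def)
  have q: "\<gamma> \<cdot> ginv G \<rho> \<in> arrows G" "\<rho> \<in> arrows G" "src (\<gamma> \<cdot> ginv G \<rho>) = tgt \<rho>"
    "tgt (\<gamma> \<cdot> ginv G \<rho>) = tgt \<gamma>" if "\<rho> \<in> ?F" for \<rho>
    using divide_right[OF \<gamma>, of \<rho>] F(2) that by auto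
  let ?t = "\<lambda>f g \<rho>. f (\<gamma> \<cdot> ginv G \<rho>) \<otimes>\<^bsub>stalk \<O> (tgt \<gamma>)\<^esub> tr (\<gamma> \<cdot> ginv G \<rho>) (g \<rho>)"
  have S: "conv f h \<gamma> = finsum (stalk \<O> (tgt \<gamma>)) (?t f h) ?F"
    if "h \<in> sections" "\<And>\<rho>. \<lbrakk>\<rho> \<in> arrows G; src \<rho> = src \<gamma>; h \<rho> \<noteq> val_zero \<rho>\<rbrakk> \<Longrightarrow> \<rho> \<in> ?F" for h
    by (rule conv_eq_sum[OF assms(1) that(1) \<gamma> F that(2)])
  have C: "?t f h \<in> ?F \<rightarrow> carrier (stalk \<O> (tgt \<gamma>))" if "h \<in> sections" for h
    by (rule Pi_I) (rule conv_term_closed[OF assms(1) that q(1-3) q(4)[symmetric]])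
  have "?t f (g \<oplus>\<^bsub>Sec\<^esub> g') \<rho> = ?t f g \<rho> \<oplus>\<^bsub>stalk \<O> (tgt \<gamma>)\<^esub> ?t f g' \<rho>" if \<rho>: "\<rho> \<in> ?F" for \<rho>
  proof -
    note \<beta> = q[OF \<rho>]
    have v: "g \<rho> \<in> carrier (stalk \<O> (tgt \<rho>))" "g' \<rho> \<in> carrier (stalk \<O> (tgt \<rho>))"
      using assms(2,3) \<beta>(2) sections_value by blast+
    then have "tr (\<gamma> \<cdot> ginv G \<rho>) (g \<rho>) \<in> carrier (stalk \<O> (tgt \<gamma>))"
        "tr (\<gamma> \<cdot> ginv G \<rho>) (g' \<rho>) \<in> carrier (stalk \<O> (tgt \<gamma>))"
      using \<beta> tr_closed[OF \<beta>(1)] by simp_all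
    then show ?thesis
      using \<beta> sections_value[OF assms(1) \<beta>(1)] ring_hom_add[OF tr_hom[OF \<beta>(1)], of "g \<rho>" "g' \<rho>"] v
      by (simp add: add_apply r_distr)
  qed
  then have "finsum (stalk \<O> (tgt \<gamma>)) (?t f (g \<oplus>\<^bsub>Sec\<^esub> g')) ?F =
      (\<Oplus>\<^bsub>stalk \<O> (tgt \<gamma>)\<^esub>\<rho>\<in>?F. ?t f g \<rho> \<oplus>\<^bsub>stalk \<O> (tgt \<gamma>)\<^esub> ?t f g' \<rho>)"
    using C[OF assms(2)] C[OF assms(3)] by (intro finsum_cong') (auto simp: Pi_iff)
  also have "\<dots> = finsum (stalk \<O> (tgt \<gamma>)) (?t f g) ?F \<oplus>\<^bsub>stalk \<O> (tgt \<gamma>)\<^esub>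
      finsum (stalk \<O> (tgt \<gamma>)) (?t f g') ?F"
    by (rule finsum_addf) (rule C assms)+
  also have "\<dots> = conv f g \<gamma> \<oplus>\<^bsub>stalk \<O> (tgt \<gamma>)\<^esub> conv f g' \<gamma>"
    using S[OF assms(2)] S[OF assms(3)] by simp
  also have "finsum (stalk \<O> (tgt \<gamma>)) (?t f (g \<oplus>\<^bsub>Sec\<^esub> g')) ?F = conv f (g \<oplus>\<^bsub>Sec\<^esub> g') \<gamma>"
    by (rule S[symmetric]) (use assms in \<open>auto simp: add_apply ring.ring_simprules(2,8) stalk_ring_rng\<close>)
  finally show "conv f (g \<oplus>\<^bsub>Sec\<^esub> g') \<gamma> = (conv f g \<oplus>\<^bsub>Sec\<^esub> conv f g') \<gamma>"
    using \<gamma> by (simp add: add_apply)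
qed

end


section \<open>Ample groupoids\<close>

lemma continuous_map_locally:
  assumes "\<And>y. y \<in> topspace Y \<Longrightarrow>
    \<exists>U. openin Y U \<and> y \<in> U \<and> continuous_map (subtopology Y U) Z f"
  shows "continuous_map Y Z f"
  unfolding continuous_map
proof (intro conjI allI impI)
  show "f ` topspace Y \<subseteq> topspace Z"
  proof clarify
    fix y assume "y \<in> topspace Y"
    then obtain U where U: "openin Y U" "y \<in> U" "continuous_map (subtopology Y U) Z f"
      using assms by blast
    then have "y \<in> topspace (subtopology Y U)" using openin_subset by fastforce
    then show "f y \<in> topspace Z" using U(3) continuous_map_funspace by fastforce
  qed
  fix V assume V: "openin Z V"
  show "openin Y {y \<in> topspace Y. f y \<in> V}"
  proof (subst openin_subopen, clarify)
    fix y assume y: "y \<in> topspace Y" "f y \<in> V"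
    then obtain U where U: "openin Y U" "y \<in> U" "continuous_map (subtopology Y U) Z f"
      using assms by blast
    then have sub: "U \<subseteq> topspace Y" using openin_subset by blast
    have "openin (subtopology Y U) {z \<in> topspace (subtopology Y U). f z \<in> V}"
      by (rule openin_continuous_map_preimage[OF U(3) V])
    then have "openin Y {z \<in> topspace (subtopology Y U). f z \<in> V}"
      using U(1) openin_trans_full by blast
    then show "\<exists>T. openin Y T \<and> y \<in> T \<and> T \<subseteq> {y \<in> topspace Y. f y \<in> V}"
      using y U(2) sub by (intro exI[of _ "{z \<in> topspace (subtopology Y U). f z \<in> V}"]) auto
  qed
qed

lemma zero_dimensional_nbhd:
  assumes "zero_dimensional X" "openin X U" "x \<in> U"
  obtains K where "openin X K" "compactin X K" "x \<in> K" "K \<subseteq> U"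
proof -
  have "(arbitrary union_of (\<lambda>K. openin X K \<and> compact_Hausdorffin X K)) U"
    using assms(1,2) unfolding zero_dimensional_def by metis
  then obtain K where "openin X K" "compact_Hausdorffin X K" "x \<in> K" "K \<subseteq> U"
    using assms(3) unfolding union_of_def by auto
  then show thesis using that by (simp add: compact_Hausdorffin_def)
qed

text \<open>Local homeomorphisms enter as maps that are continuous, open and locally injective.
  Hausdorffness of the arrows makes compact open bisections closed as well.\<close>

locale ample_groupoid = algebraic_groupoid G
  for G :: "('g, 'x) top_groupoid" +
  assumes zero_dim: "zero_dimensional (unit_topology G)"
    and hausdorff_units: "Hausdorff_space (unit_topology G)"
    and hausdorff_arrows: "Hausdorff_space (arrow_topology G)"
    and dom_continuous: "continuous_map (arrow_topology G) (unit_topology G) (gdom G)"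
    and dom_open: "open_map (arrow_topology G) (unit_topology G) (gdom G)"
    and rng_open: "open_map (arrow_topology G) (unit_topology G) (grng G)"
    and rng_continuous: "continuous_map (arrow_topology G) (unit_topology G) (grng G)"
    and comp_continuous: "continuous_map
      (subtopology (prod_topology (arrow_topology G) (arrow_topology G))
        {(\<beta>, \<gamma>). gdom G \<beta> = grng G \<gamma>})
      (arrow_topology G) (\<lambda>(\<beta>, \<gamma>). gcomp G \<beta> \<gamma>)"
    and unit_continuous: "continuous_map (unit_topology G) (arrow_topology G) (gunit G)"
    and bisection_nbhd: "\<gamma> \<in> arrows G \<Longrightarrow>
      \<exists>B. openin (arrow_topology G) B \<and> \<gamma> \<in> B \<and> inj_on (gdom G) B \<and> inj_on (grng G) B"
begin

abbreviation "X \<equiv> unit_topology G"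
abbreviation "T \<equiv> arrow_topology G"

lemma compact_open_bisection_iff:
  "compact_open_bisection G B \<longleftrightarrow>
     openin T B \<and> compactin T B \<and> inj_on src B \<and> inj_on tgt B"
  by (auto simp: compact_open_bisection_def compact_Hausdorffin_def hausdorff_arrows
      Hausdorff_space_subtopology)

lemma compact_open_bisectionD:
  assumes "compact_open_bisection G B"
  shows "openin T B" "compactin T B" "closedin T B" "inj_on src B" "inj_on tgt B" "B \<subseteq> arrows G"
  using assms compactin_imp_closedin[OF hausdorff_arrows] openin_subset
  by (auto simp: compact_open_bisection_iff)

lemma open_src_image: "openin T A \<Longrightarrow> openin X (src ` A)"
  using dom_open by (simp add: open_map_def)

lemma compact_src_image: "compactin T A \<Longrightarrow> compactin X (src ` A)"
  using image_compactin[OF _ dom_continuous] .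

lemma compact_tgt_image: "compactin T A \<Longrightarrow> compactin X (tgt ` A)"
  using image_compactin[OF _ rng_continuous] .

lemma open_src_vimage: "openin X U \<Longrightarrow> openin T {\<gamma> \<in> arrows G. src \<gamma> \<in> U}"
  and open_tgt_vimage: "openin X U \<Longrightarrow> openin T {\<gamma> \<in> arrows G. tgt \<gamma> \<in> U}"
  and closed_src_vimage: "closedin X U \<Longrightarrow> closedin T {\<gamma> \<in> arrows G. src \<gamma> \<in> U}"
  and closed_tgt_vimage: "closedin X U \<Longrightarrow> closedin T {\<gamma> \<in> arrows G. tgt \<gamma> \<in> U}"
  using openin_continuous_map_preimage closedin_continuous_map_preimage
    dom_continuous rng_continuous by blast+

lemma compact_closed_units: "compactin X U \<Longrightarrow> closedin X U"
  by (rule compactin_imp_closedin[OF hausdorff_units])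

section \<open>Source sections and compact open bisections\<close>

definition src_section :: "'g set \<Rightarrow> 'x \<Rightarrow> 'g" where
  "src_section A = inv_into A src"

lemma src_section:
  "x \<in> src ` A \<Longrightarrow> src_section A x \<in> A" "x \<in> src ` A \<Longrightarrow> src (src_section A x) = x"
  "inj_on src A \<Longrightarrow> \<alpha> \<in> A \<Longrightarrow> src_section A (src \<alpha>) = \<alpha>"
  by (simp_all add: src_section_def inv_into_into f_inv_into_f)

text \<open>The preimage of \<open>W\<close> consists of the sources of the arrows common to
  \<open>A\<close> and \<open>W\<close>, a set that is open because \<open>gdom\<close> is an open
  map.\<close>

lemma src_section_continuous:
  assumes A: "openin T A" "inj_on src A"
  shows "continuous_map (subtopology X (src ` A)) T (src_section A)"
  unfolding continuous_map
proof (intro conjI allI impI)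
  have sub: "A \<subseteq> arrows G" using A(1) openin_subset by blast
  then show "src_section A ` topspace (subtopology X (src ` A)) \<subseteq> arrows G"
    using src_section(1) by fastforce
  fix W assume W: "openin T W"
  have "{x \<in> topspace (subtopology X (src ` A)). src_section A x \<in> W} = src ` (A \<inter> W)"
    using sub dom_closed src_section(1)[of _ A] src_section(2)[of _ A] src_section(3)[OF A(2)] by auto
  moreover have "openin X (src ` (A \<inter> W))" by (intro open_src_image openin_Int A W)
  ultimately show "openin (subtopology X (src ` A))
      {x \<in> topspace (subtopology X (src ` A)). src_section A x \<in> W}"
    by (metis image_mono inf_le1 openin_subset_topspace_eq openin_open_subtopology open_src_image[OF A(1)])
qed

text \<open>An arrow of a bisection is determined by its source. Near \<open>m y\<close> it is
  therefore enough that the sources of the values of \<open>m\<close> fill an open set: all arrows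
  of \<open>B\<close> over that set are values of \<open>m\<close>. Sets of units and products of
  bisections are shown to be open in this way.\<close>

lemma section_image_open:
  assumes m: "continuous_map Y T m" and op: "open_map Y X (src \<circ> m)"
  shows "openin T (m ` topspace Y)"
proof (subst openin_subopen, clarify)
  fix y assume y: "y \<in> topspace Y"
  then have my: "m y \<in> arrows G" using m continuous_map_funspace by fastforce
  obtain B where B: "openin T B" "m y \<in> B" "inj_on src B" using bisection_nbhd[OF my] by blast
  define N where "N = {z \<in> topspace Y. m z \<in> B}"
  have N: "openin Y N" unfolding N_def by (rule openin_continuous_map_preimage[OF m B(1)])
  have P: "openin X ((src \<circ> m) ` N)" using op N by (simp add: open_map_def)
  have "B \<inter> {\<gamma> \<in> arrows G. src \<gamma> \<in> (src \<circ> m) ` N} \<subseteq> m ` topspace Y"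
  proof clarify
    fix \<gamma> z assume "\<gamma> \<in> B" "src \<gamma> = (src \<circ> m) z" "z \<in> N"
    then have "\<gamma> = m z" using B(3) by (auto simp: N_def inj_on_def)
    then show "\<gamma> \<in> m ` topspace Y" using \<open>z \<in> N\<close> by (auto simp: N_def)
  qed
  moreover have "m y \<in> B \<inter> {\<gamma> \<in> arrows G. src \<gamma> \<in> (src \<circ> m) ` N}"
    using B(2) my y by (auto simp: N_def)
  moreover have "openin T (B \<inter> {\<gamma> \<in> arrows G. src \<gamma> \<in> (src \<circ> m) ` N})"
    by (intro openin_Int B(1) open_src_vimage P)
  ultimately show "\<exists>W. openin T W \<and> m y \<in> W \<and> W \<subseteq> m ` topspace Y" by blast
qed

text \<open>A bisection inside \<open>W\<close> is cut down to its arrows starting in a compact open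
  \<open>K\<close>. These form the image of \<open>K\<close> under the continuous source section,
  hence a compact set.\<close>

lemma compact_open_bisection_nbhd:
  assumes "openin T W" "\<gamma> \<in> W"
  obtains B where "compact_open_bisection G B" "\<gamma> \<in> B" "B \<subseteq> W"
proof -
  have "\<gamma> \<in> arrows G" using assms openin_subset by blast
  then obtain A where A: "openin T A" "\<gamma> \<in> A" "inj_on src A" "inj_on tgt A"
    using bisection_nbhd by blast
  have AW: "openin T (A \<inter> W)" "inj_on src (A \<inter> W)"
    using A assms(1) by (auto intro: inj_on_subset)
  obtain K where K: "openin X K" "compactin X K" "src \<gamma> \<in> K" "K \<subseteq> src ` (A \<inter> W)"
    by (rule zero_dimensional_nbhd[OF zero_dim open_src_image[OF AW(1)], of "src \<gamma>"])
      (use A(2) assms(2) in auto)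
  let ?B = "A \<inter> W \<inter> {\<gamma> \<in> arrows G. src \<gamma> \<in> K}"
  have B: "?B = src_section (A \<inter> W) ` K"
  proof (intro equalityI subsetI)
    fix \<beta> assume b: "\<beta> \<in> ?B"
    then have "\<beta> = src_section (A \<inter> W) (src \<beta>)" using src_section(3)[OF AW(2)] by auto
    then show "\<beta> \<in> src_section (A \<inter> W) ` K" using b by blast
  next
    fix \<beta> assume "\<beta> \<in> src_section (A \<inter> W) ` K"
    then obtain x where "x \<in> K" "\<beta> = src_section (A \<inter> W) x" by auto
    then show "\<beta> \<in> ?B"
      using src_section(1,2)[of x "A \<inter> W"] K(4) openin_subset[OF AW(1)] by auto
  qed
  have "compactin (subtopology X (src ` (A \<inter> W))) K"
    using K by (simp add: compactin_subtopology)
  then have "compactin T ?B"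
    unfolding B using src_section_continuous[OF AW] image_compactin by blast
  moreover have "openin T ?B" by (intro openin_Int AW(1)[THEN openin_Int] open_src_vimage K(1) A assms)
  moreover have "inj_on src ?B" "inj_on tgt ?B" using A by (auto intro: inj_on_subset)
  ultimately show thesis
    using that[of ?B] \<open>\<gamma> \<in> arrows G\<close> A(2) assms(2) K(3) by (auto simp: compact_open_bisection_iff)
qed

lemma unit_bisection:
  assumes "openin X U" "compactin X U"
  shows "compact_open_bisection G (gunit G ` U)"
  unfolding compact_open_bisection_iff
proof (intro conjI)
  have sub: "U \<subseteq> units" using assms openin_subset by blast
  have eq: "src (gunit G x) = x" "tgt (gunit G x) = x" if "x \<in> U" for x
    using sub that by (auto simp: dom_unit rng_unit)
  have m: "continuous_map (subtopology X U) T (gunit G)"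
    by (rule continuous_map_from_subtopology[OF unit_continuous])
  have "open_map (subtopology X U) X (src \<circ> gunit G)"
    unfolding open_map_def
  proof (intro allI impI)
    fix V assume "openin (subtopology X U) V"
    then have V: "openin X V" "V \<subseteq> U"
      using assms(1) by (simp_all add: openin_open_subtopology)
    then have "(src \<circ> gunit G) ` V = V" using eq by force
    then show "openin X ((src \<circ> gunit G) ` V)" using V by simp
  qed
  then show "openin T (gunit G ` U)"
    using section_image_open[OF m] sub by (simp add: Int_absorb1)
  show "compactin T (gunit G ` U)" by (rule image_compactin[OF assms(2) unit_continuous])
  show "inj_on src (gunit G ` U)" "inj_on tgt (gunit G ` U)"
    using eq by (auto simp: inj_on_def)
qed

definition bisection_prod :: "'g set \<Rightarrow> 'g set \<Rightarrow> 'g set" where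
  "bisection_prod A B = {\<alpha> \<cdot> \<beta> |\<alpha> \<beta>. \<alpha> \<in> A \<and> \<beta> \<in> B \<and> src \<alpha> = tgt \<beta>}"

lemma continuous_comp:
  assumes "continuous_map Y T a" "continuous_map Y T b"
    and "\<And>y. y \<in> topspace Y \<Longrightarrow> src (a y) = tgt (b y)"
  shows "continuous_map Y T (\<lambda>y. a y \<cdot> b y)"
proof -
  have "continuous_map Y (subtopology (prod_topology T T) {(\<beta>, \<gamma>). src \<beta> = tgt \<gamma>}) (\<lambda>y. (a y, b y))"
    using assms by (auto simp: continuous_map_in_subtopology intro: continuous_map_pairedI)
  from continuous_map_compose[OF this comp_continuous]
  show ?thesis by (simp add: o_def)
qed

text \<open>The product is parametrised by the part \<open>B'\<close> of \<open>B\<close> whose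
  targets are sources of \<open>A\<close>: the map \<open>m\<close> multiplies an arrow by the only
  arrow of \<open>A\<close> that can follow it. As \<open>m\<close> preserves sources, its image is
  open, and \<open>B'\<close> is compact because it is cut out of \<open>B\<close> by a closed
  condition.\<close>

lemma bisection_prod:
  assumes A: "compact_open_bisection G A" and B: "compact_open_bisection G B"
  shows "compact_open_bisection G (bisection_prod A B)"
proof -
  note AD = compact_open_bisectionD[OF A] and BD = compact_open_bisectionD[OF B]
  define B' where "B' = B \<inter> {\<beta> \<in> arrows G. tgt \<beta> \<in> src ` A}"
  define m where "m = (\<lambda>\<beta>. src_section A (tgt \<beta>) \<cdot> \<beta>)"
  have B': "openin T B'" "compactin T B'" "B' \<subseteq> B" "B' \<subseteq> arrows G"
    unfolding B'_def using BD AD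
    by (auto intro!: openin_Int open_tgt_vimage open_src_image compact_Int_closedin
      closed_tgt_vimage compact_closed_units compact_src_image)
  have s: "src_section A (tgt \<beta>) \<in> A" "src (src_section A (tgt \<beta>)) = tgt \<beta>"
    "src_section A (tgt \<beta>) \<in> arrows G" if "\<beta> \<in> B'" for \<beta>
    using that src_section(1,2)[of "tgt \<beta>" A] AD(6) by (auto simp: B'_def)
  have AB: "bisection_prod A B = m ` B'"
  proof (intro equalityI subsetI)
    fix \<gamma> assume "\<gamma> \<in> bisection_prod A B"
    then obtain \<alpha> \<beta> where g: "\<gamma> = \<alpha> \<cdot> \<beta>" "\<alpha> \<in> A" "\<beta> \<in> B" "src \<alpha> = tgt \<beta>"
      by (auto simp: bisection_prod_def)
    then have "\<gamma> = m \<beta>" using src_section(3)[OF AD(4) g(2)] by (simp add: m_def)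
    moreover have "\<beta> \<in> B'" unfolding B'_def using g BD(6) by (auto intro: rev_image_eqI)
    ultimately show "\<gamma> \<in> m ` B'" by blast
  next
    fix \<gamma> assume "\<gamma> \<in> m ` B'"
    then show "\<gamma> \<in> bisection_prod A B"
      using s B'(3) unfolding bisection_prod_def m_def by blast
  qed
  have t: "continuous_map (subtopology T B') (subtopology X (src ` A)) tgt"
    using continuous_map_from_subtopology[OF rng_continuous, of B']
    by (auto simp: continuous_map_in_subtopology B'_def)
  have m: "continuous_map (subtopology T B') T m"
    unfolding m_def
    using continuous_map_compose[OF t src_section_continuous[OF AD(1,4)]] s
    by (intro continuous_comp) (auto simp: o_def)
  have src_m: "src (m \<beta>) = src \<beta>" "tgt (m \<beta>) = tgt (src_section A (tgt \<beta>))" if "\<beta> \<in> B'" for \<beta>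
    using that s[OF that] B'(4) by (auto simp: m_def dom_comp rng_comp)
  have "open_map (subtopology T B') X (src \<circ> m)"
    unfolding open_map_def
  proof (intro allI impI)
    fix V assume "openin (subtopology T B') V"
    then have V: "openin T V" "V \<subseteq> B'"
      using B'(1) by (simp_all add: openin_open_subtopology)
    then have "(src \<circ> m) ` V = src ` V" using src_m by (auto intro!: image_cong)
    then show "openin X ((src \<circ> m) ` V)" using V open_src_image by simp
  qed
  then have "openin T (m ` B')"
    using section_image_open[OF m] B'(4) by (simp add: Int_absorb1)
  moreover have "compactin T (m ` B')"
    by (rule image_compactin[OF _ m]) (use B'(2) in \<open>simp add: compactin_subtopology\<close>)
  moreover have "inj_on src (m ` B')"
    using src_m(1) BD(4) B'(3) by (auto simp: inj_on_def subset_iff)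
  moreover have "inj_on tgt (m ` B')"
  proof (rule inj_onI, clarify)
    fix \<beta> \<beta>' assume b: "\<beta> \<in> B'" "\<beta>' \<in> B'" "tgt (m \<beta>) = tgt (m \<beta>')"
    then have "src_section A (tgt \<beta>) = src_section A (tgt \<beta>')"
      using src_m(2) s(1) AD(5) by (auto dest: inj_onD)
    then have "tgt \<beta> = tgt \<beta>'" using s(2) b by metis
    then show "m \<beta> = m \<beta>'" using b B'(3) BD(5) by (auto dest: inj_onD)
  qed
  ultimately show ?thesis unfolding AB compact_open_bisection_iff by blast
qed

end


section \<open>The convolution ring of an ample groupoid\<close>

locale ample_sheaf = ample_groupoid G + sheaf_groupoid G \<O>
  for G :: "('g, 'x) top_groupoid" and \<O> :: "('g, 'x, 'e) gsheaf_of_rings"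
begin

abbreviation "E \<equiv> total \<O>"
abbreviation "p \<equiv> proj \<O>"

section \<open>Local sections and continuity of the sheaf operations\<close>

lemma proj_local:
  assumes "e \<in> topspace E"
  obtains U where "openin E U" "e \<in> U" "openin X (p ` U)"
    "homeomorphic_map (subtopology E U) (subtopology X (p ` U)) p"
  using gsheaf assms unfolding is_gsheaf_def local_homeomorphism_def by blast

lemma proj_continuous: "continuous_map E X p"
proof (rule continuous_map_locally)
  fix e assume "e \<in> topspace E"
  then obtain U where U: "openin E U" "e \<in> U"
    "homeomorphic_map (subtopology E U) (subtopology X (p ` U)) p" by (rule proj_local)
  then have "continuous_map (subtopology E U) X p"
    using homeomorphic_imp_continuous_map continuous_map_in_subtopology by blast
  then show "\<exists>U. openin E U \<and> e \<in> U \<and> continuous_map (subtopology E U) X p" using U by blast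
qed

lemma stalk_carrier_iff: "e \<in> carrier (stalk \<O> x) \<and> x \<in> units \<longleftrightarrow> e \<in> topspace E \<and> p e = x"
  using stalk_carrier proj_closed by auto

text \<open>The section is the inverse of \<open>p\<close> on a sheet around \<open>e\<close>, cut
  down to a compact open set.\<close>

lemma local_section:
  assumes e: "e \<in> topspace E" and W: "openin X W" "p e \<in> W"
  obtains K k where "openin X K" "compactin X K" "p e \<in> K" "K \<subseteq> W"
    "continuous_map (subtopology X K) E k" "\<And>x. x \<in> K \<Longrightarrow> k x \<in> carrier (stalk \<O> x)" "k (p e) = e"
proof -
  obtain U where U: "openin E U" "e \<in> U" "openin X (p ` U)"
    "homeomorphic_map (subtopology E U) (subtopology X (p ` U)) p" using e by (rule proj_local)
  then obtain k where "homeomorphic_maps (subtopology E U) (subtopology X (p ` U)) p k"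
    by (auto simp: homeomorphic_map_maps)
  then have k: "continuous_map (subtopology X (p ` U)) (subtopology E U) k"
    "\<And>e. e \<in> topspace (subtopology E U) \<Longrightarrow> k (p e) = e"
    "\<And>x. x \<in> topspace (subtopology X (p ` U)) \<Longrightarrow> p (k x) = x"
    by (auto simp: homeomorphic_maps_def)
  obtain K where K: "openin X K" "compactin X K" "p e \<in> K" "K \<subseteq> p ` U \<inter> W"
    by (rule zero_dimensional_nbhd[OF zero_dim openin_Int[OF U(3) W(1)], of "p e"])
      (use U(2) W(2) in auto)
  have c: "continuous_map (subtopology X K) E k"
    using continuous_map_from_subtopology[OF continuous_map_into_fulltopology[OF k(1)], of K] K(4)
    by (simp add: subtopology_subtopology Int_absorb1)
  show thesis
  proof (rule that[OF K(1-3) _ c])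
    show "k x \<in> carrier (stalk \<O> x)" if "x \<in> K" for x
    proof -
      have "x \<in> topspace (subtopology X K)" using that openin_subset[OF K(1)] by auto
      then have "k x \<in> topspace E" using c continuous_map_funspace by fastforce
      moreover have "p (k x) = x" using that K openin_subset[OF K(1)] by (intro k(3)) auto
      ultimately show ?thesis using stalk_carrier_iff by blast
    qed
  qed (use K U(2) e k(2) in auto)
qed

text \<open>\<open>p\<close> is injective on a sheet around the common value, and both maps stay in
  that sheet near \<open>y\<close>. Identities between sections thus spread from a point to a
  neighbourhood; zeros, negatives and inverses are treated by this below.\<close>

lemma sections_agree_nbhd:
  assumes h: "continuous_map Y E h" "continuous_map Y E h'" and y: "y \<in> topspace Y" "h y = h' y"
    and eq: "\<And>y. y \<in> topspace Y \<Longrightarrow> p (h y) = p (h' y)"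
  obtains U where "openin Y U" "y \<in> U" "\<And>z. z \<in> U \<Longrightarrow> h z = h' z"
proof -
  have "h y \<in> topspace E" using h(1) y(1) continuous_map_funspace by fastforce
  then obtain V where V: "openin E V" "h y \<in> V"
    "homeomorphic_map (subtopology E V) (subtopology X (p ` V)) p" by (rule proj_local)
  have inj: "inj_on p V"
    using homeomorphic_imp_injective_map[OF V(3)] openin_subset[OF V(1)] by (simp add: Int_absorb1)
  let ?U = "{z \<in> topspace Y. h z \<in> V} \<inter> {z \<in> topspace Y. h' z \<in> V}"
  have "openin Y ?U" using h V(1) openin_continuous_map_preimage by blast
  moreover have "y \<in> ?U" using y V(2) by auto
  moreover have "h z = h' z" if "z \<in> ?U" for z
    using that eq inj by (auto dest: inj_onD)
  ultimately show thesis using that by blast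
qed

lemma continuous_binop:
  assumes op: "continuous_map (subtopology (prod_topology E E) {(a, b). p a = p b}) E
      (\<lambda>(a, b). f (p a) a b)"
    and "continuous_map Y E a" "continuous_map Y E b"
    and "\<And>y. y \<in> topspace Y \<Longrightarrow> p (a y) = x y" "\<And>y. y \<in> topspace Y \<Longrightarrow> p (b y) = x y"
  shows "continuous_map Y E (\<lambda>y. f (x y) (a y) (b y))"
proof -
  have "continuous_map Y (subtopology (prod_topology E E) {(a, b). p a = p b}) (\<lambda>y. (a y, b y))"
    using assms by (auto simp: continuous_map_in_subtopology intro: continuous_map_pairedI)
  from continuous_map_compose[OF this op]
  show ?thesis by (rule continuous_map_eq) (simp add: assms)
qed

lemma continuous_add:
  assumes "continuous_map Y E a" "continuous_map Y E b"
    and "\<And>y. y \<in> topspace Y \<Longrightarrow> p (a y) = x y" "\<And>y. y \<in> topspace Y \<Longrightarrow> p (b y) = x y"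
  shows "continuous_map Y E (\<lambda>y. a y \<oplus>\<^bsub>stalk \<O> (x y)\<^esub> b y)"
  by (rule continuous_binop[OF _ assms]) (use sheaf in \<open>simp_all add: is_gsheaf_of_rings_def\<close>)

lemma continuous_mult:
  assumes "continuous_map Y E a" "continuous_map Y E b"
    and "\<And>y. y \<in> topspace Y \<Longrightarrow> p (a y) = x y" "\<And>y. y \<in> topspace Y \<Longrightarrow> p (b y) = x y"
  shows "continuous_map Y E (\<lambda>y. a y \<otimes>\<^bsub>stalk \<O> (x y)\<^esub> b y)"
  by (rule continuous_binop[OF _ assms]) (use sheaf in \<open>simp_all add: is_gsheaf_of_rings_def\<close>)

lemma continuous_tr:
  assumes "continuous_map Y T a" "continuous_map Y E b"
    and "\<And>y. y \<in> topspace Y \<Longrightarrow> src (a y) = p (b y)"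
  shows "continuous_map Y E (\<lambda>y. tr (a y) (b y))"
proof -
  have tr: "continuous_map (subtopology (prod_topology T E) {(\<gamma>, e). src \<gamma> = p e}) E
      (\<lambda>(\<gamma>, e). tr \<gamma> e)"
    using gsheaf by (simp add: is_gsheaf_def)
  have "continuous_map Y (subtopology (prod_topology T E) {(\<gamma>, e). src \<gamma> = p e}) (\<lambda>y. (a y, b y))"
    using assms by (auto simp: continuous_map_in_subtopology intro: continuous_map_pairedI)
  from continuous_map_compose[OF this tr] show ?thesis by (simp add: o_def)
qed

lemma one_continuous: "continuous_map X E (\<lambda>x. \<one>\<^bsub>stalk \<O> x\<^esub>)"
  using sheaf by (simp add: is_gsheaf_of_rings_def)

text \<open>For a local section \<open>k\<close> through the zero of the stalk at \<open>x\<close>,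
  the identity k + k = k holds at \<open>x\<close>, hence nearby, and there it makes
  \<open>k\<close> zero. So continuity of the zero section follows from that of addition.\<close>

lemma zero_continuous: "continuous_map X E (\<lambda>x. \<zero>\<^bsub>stalk \<O> x\<^esub>)"
proof (rule continuous_map_locally)
  fix x assume x: "x \<in> units"
  interpret Rx: ring "stalk \<O> x" by (rule stalk_is_ring[OF x])
  have z: "\<zero>\<^bsub>stalk \<O> x\<^esub> \<in> topspace E" "p \<zero>\<^bsub>stalk \<O> x\<^esub> = x"
    using Rx.zero_closed x stalk_carrier_iff by blast+
  obtain K k where K: "openin X K" "x \<in> K" "continuous_map (subtopology X K) E k"
    "\<And>y. y \<in> K \<Longrightarrow> k y \<in> carrier (stalk \<O> y)" "k x = \<zero>\<^bsub>stalk \<O> x\<^esub>"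
    by (rule local_section[OF z(1) openin_topspace]) (use z x in auto)
  have sub: "K \<subseteq> units" using K(1) openin_subset by blast
  have pk: "p (k y) = y" if "y \<in> topspace (subtopology X K)" for y
    using that K(4)[of y] stalk_carrier_iff sub by auto
  have add: "continuous_map (subtopology X K) E (\<lambda>y. k y \<oplus>\<^bsub>stalk \<O> y\<^esub> k y)"
    by (rule continuous_add[OF K(3,3)]) (use pk in auto)
  have "p (k y \<oplus>\<^bsub>stalk \<O> y\<^esub> k y) = p (k y)" if "y \<in> topspace (subtopology X K)" for y
  proof -
    have y: "y \<in> K" "y \<in> units" using that by auto
    interpret ring "stalk \<O> y" by (rule stalk_is_ring[OF y(2)])
    show ?thesis using K(4)[OF y(1)] a_closed stalk_carrier_iff y by metis
  qed
  then obtain U where U: "openin (subtopology X K) U" "x \<in> U"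
    "\<And>y. y \<in> U \<Longrightarrow> k y \<oplus>\<^bsub>stalk \<O> y\<^esub> k y = k y"
    using sections_agree_nbhd[OF add K(3), of x] K(2,5) sub by (auto simp: subset_iff)
  have U': "openin X U" "U \<subseteq> K" using U(1) K(1) by (simp_all add: openin_open_subtopology)
  have "continuous_map (subtopology X U) E k"
    using continuous_map_from_subtopology[OF K(3), of U] U'
    by (simp add: subtopology_subtopology Int_absorb1)
  moreover have "k y = \<zero>\<^bsub>stalk \<O> y\<^esub>" if "y \<in> topspace (subtopology X U)" for y
  proof -
    have y: "y \<in> U" "y \<in> K" "y \<in> units" using that U' by auto
    interpret ring "stalk \<O> y" by (rule stalk_is_ring[OF y(3)])
    show ?thesis using U(3)[OF y(1)] K(4)[OF y(2)] by simp
  qed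
  ultimately have "continuous_map (subtopology X U) E (\<lambda>x. \<zero>\<^bsub>stalk \<O> x\<^esub>)"
    by (rule continuous_map_eq)
  then show "\<exists>U. openin X U \<and> x \<in> U \<and> continuous_map (subtopology X U) E (\<lambda>x. \<zero>\<^bsub>stalk \<O> x\<^esub>)"
    using U' U(2) by blast
qed

text \<open>Let \<open>k\<close> be a local section through the negative of \<open>e\<close>. The
  sum of a and k(p a) is zero at a = \<open>e\<close>, hence for all nearby a, so negation is there
  the composite of \<open>k\<close> with \<open>p\<close>.\<close>

lemma neg_continuous: "continuous_map E E (\<lambda>e. \<ominus>\<^bsub>stalk \<O> (p e)\<^esub> e)"
proof (rule continuous_map_locally)
  fix e assume e: "e \<in> topspace E"
  interpret Re: ring "stalk \<O> (p e)" by (rule stalk_is_ring[OF proj_closed[OF e]])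
  have ec: "e \<in> carrier (stalk \<O> (p e))" using e stalk_carrier_iff by blast
  let ?n = "\<ominus>\<^bsub>stalk \<O> (p e)\<^esub> e"
  have n: "?n \<in> topspace E" "p ?n = p e"
    using Re.a_inv_closed[OF ec] stalk_carrier_iff proj_closed[OF e] by blast+
  obtain K k where K: "openin X K" "p e \<in> K" "continuous_map (subtopology X K) E k"
    "\<And>y. y \<in> K \<Longrightarrow> k y \<in> carrier (stalk \<O> y)" "k (p e) = ?n"
    by (rule local_section[OF n(1) openin_topspace]) (use n proj_closed[OF e] in auto)
  have sub: "K \<subseteq> units" using K(1) openin_subset by blast
  define W where "W = {e \<in> topspace E. p e \<in> K}"
  have W: "openin E W" unfolding W_def by (rule openin_continuous_map_preimage[OF proj_continuous K(1)])
  have Wt: "topspace (subtopology E W) = W" by (auto simp: W_def)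
  have pc: "continuous_map (subtopology E W) X p"
    by (rule continuous_map_from_subtopology[OF proj_continuous])
  then have pK: "continuous_map (subtopology E W) (subtopology X K) p"
    by (auto simp: continuous_map_in_subtopology W_def)
  have kp: "continuous_map (subtopology E W) E (\<lambda>a. k (p a))"
    using continuous_map_compose[OF pK K(3)] by (simp add: o_def)
  have idc: "continuous_map (subtopology E W) E (\<lambda>a. a)"
    by (rule continuous_map_from_subtopology) (simp add: continuous_map_id[unfolded id_def])
  have pk: "p (k (p a)) = p a" if "a \<in> W" for a
    using that K(4)[of "p a"] stalk_carrier_iff sub by (auto simp: W_def)
  have add: "continuous_map (subtopology E W) E (\<lambda>a. a \<oplus>\<^bsub>stalk \<O> (p a)\<^esub> k (p a))"
    by (rule continuous_add[OF idc kp]) (use pk Wt in auto)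
  have zero: "continuous_map (subtopology E W) E (\<lambda>a. \<zero>\<^bsub>stalk \<O> (p a)\<^esub>)"
    using continuous_map_compose[OF pc zero_continuous] by (simp add: o_def)
  have car: "p a \<in> units" "a \<in> carrier (stalk \<O> (p a))" "k (p a) \<in> carrier (stalk \<O> (p a))"
    if "a \<in> W" for a
    using that K(4) stalk_carrier_iff sub by (auto simp: W_def)
  have "p (a \<oplus>\<^bsub>stalk \<O> (p a)\<^esub> k (p a)) = p \<zero>\<^bsub>stalk \<O> (p a)\<^esub>" if "a \<in> topspace (subtopology E W)" for a
  proof -
    have a: "a \<in> W" using that by auto
    interpret ring "stalk \<O> (p a)" by (rule stalk_is_ring[OF car(1)[OF a]])
    show ?thesis using car[OF a] a_closed zero_closed stalk_carrier_iff by metis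
  qed
  moreover have "e \<in> topspace (subtopology E W)" using e K(2) by (simp add: W_def)
  moreover have "e \<oplus>\<^bsub>stalk \<O> (p e)\<^esub> k (p e) = \<zero>\<^bsub>stalk \<O> (p e)\<^esub>"
    using ec by (simp add: K(5) Re.r_neg)
  ultimately obtain U where U: "openin (subtopology E W) U" "e \<in> U"
    "\<And>a. a \<in> U \<Longrightarrow> a \<oplus>\<^bsub>stalk \<O> (p a)\<^esub> k (p a) = \<zero>\<^bsub>stalk \<O> (p a)\<^esub>"
    using sections_agree_nbhd[OF add zero, of e] by metis
  have U': "openin E U" "U \<subseteq> W" using U(1) W by (simp_all add: openin_open_subtopology)
  have "continuous_map (subtopology E U) E (\<lambda>a. k (p a))"
    using continuous_map_from_subtopology[OF kp, of U] U'
    by (simp add: subtopology_subtopology Int_absorb1)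
  moreover have "k (p a) = \<ominus>\<^bsub>stalk \<O> (p a)\<^esub> a" if "a \<in> topspace (subtopology E U)" for a
  proof -
    have a: "a \<in> U" "a \<in> W" using that U' by auto
    interpret ring "stalk \<O> (p a)" by (rule stalk_is_ring[OF car(1)[OF a(2)]])
    show ?thesis using U(3)[OF a(1)] car[OF a(2)] by (metis minus_equality a_comm)
  qed
  ultimately have "continuous_map (subtopology E U) E (\<lambda>e. \<ominus>\<^bsub>stalk \<O> (p e)\<^esub> e)"
    by (rule continuous_map_eq)
  then show "\<exists>U. openin E U \<and> e \<in> U \<and> continuous_map (subtopology E U) E (\<lambda>e. \<ominus>\<^bsub>stalk \<O> (p e)\<^esub> e)"
    using U' U(2) by blast
qed

section \<open>Sections carried by compact open bisections\<close>

abbreviation "bisec \<equiv> bisection_sections G \<O>"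

lemma sections_proj: "f \<in> sections \<Longrightarrow> \<gamma> \<in> arrows G \<Longrightarrow> p (f \<gamma>) = tgt \<gamma>"
  by (simp add: all_sections_def)

lemma bisecD:
  assumes "f \<in> bisec"
  shows "\<exists>B. f \<in> sections \<and> compact_open_bisection G B \<and> continuous_map (subtopology T B) E f \<and>
    (\<forall>\<gamma>\<in>arrows G. f \<gamma> \<noteq> val_zero \<gamma> \<longrightarrow> \<gamma> \<in> B)"
  using assms by (auto simp: bisection_sections_def)

lemma bisecI:
  assumes "f \<in> sections" "compact_open_bisection G B" "continuous_map (subtopology T B) E f"
    "\<And>\<gamma>. \<gamma> \<in> arrows G \<Longrightarrow> f \<gamma> \<noteq> val_zero \<gamma> \<Longrightarrow> \<gamma> \<in> B"
  shows "f \<in> bisec"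
  using assms by (auto simp: bisection_sections_def)

text \<open>A compact open bisection is closed because the arrows form a Hausdorff space. Its
  complement is then an open set on which \<open>f\<close> is the continuous zero section.\<close>

lemma bisec_continuous:
  assumes "f \<in> bisec"
  shows "continuous_map T E f"
proof -
  obtain B where B: "f \<in> sections" "compact_open_bisection G B" "continuous_map (subtopology T B) E f"
    "\<And>\<gamma>. \<gamma> \<in> arrows G \<Longrightarrow> f \<gamma> \<noteq> val_zero \<gamma> \<Longrightarrow> \<gamma> \<in> B" using bisecD[OF assms] by blast
  note BD = compact_open_bisectionD[OF B(2)]
  show ?thesis
  proof (rule continuous_map_locally)
    fix \<gamma> assume \<gamma>: "\<gamma> \<in> arrows G"
    have "continuous_map (subtopology T (arrows G - B)) E (\<lambda>\<gamma>. val_zero \<gamma>)"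
      using continuous_map_from_subtopology[OF
          continuous_map_compose[OF rng_continuous zero_continuous]]
      by (simp add: o_def)
    then have "continuous_map (subtopology T (arrows G - B)) E f"
      by (rule continuous_map_eq) (use B(4) in force)
    moreover have "openin T (arrows G - B)" using BD(3) by blast
    ultimately show "\<exists>U. openin T U \<and> \<gamma> \<in> U \<and> continuous_map (subtopology T U) E f"
      using \<gamma> B(3) BD(1) by blast
  qed
qed

lemma bisec_fibrewise_single:
  assumes "f \<in> bisec"
  shows "fibrewise_single f"
proof -
  obtain B where B: "compact_open_bisection G B" 
    "\<And>\<gamma>. \<gamma> \<in> arrows G \<Longrightarrow> f \<gamma> \<noteq> val_zero \<gamma> \<Longrightarrow> \<gamma> \<in> B" using bisecD[OF assms] by blast
  then show ?thesis
    using compact_open_bisectionD(4)[OF B(1)] by (auto simp: fibrewise_single_def dest: inj_onD)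
qed

lemma bisec_fibrewise_finite:
  assumes "f \<in> bisec"
  shows "fibrewise_finite f"
  unfolding fibrewise_finite_def
proof
  fix x
  let ?A = "{\<rho>\<in>arrows G. src \<rho> = x \<and> f \<rho> \<noteq> val_zero \<rho>}"
  have "\<rho> = \<sigma>" if "\<rho> \<in> ?A" "\<sigma> \<in> ?A" for \<rho> \<sigma>
    using bisec_fibrewise_single[OF assms] that by (auto simp: fibrewise_single_def)
  then have "?A \<subseteq> {SOME \<rho>. \<rho> \<in> ?A}" by (metis (no_types, lifting) singletonI someI subsetI)
  then show "finite ?A" by (rule finite_subset) simp
qed

lemma bisec_sections: "f \<in> bisec \<Longrightarrow> f \<in> sections"
  by (simp add: bisection_sections_def)

text \<open>On \<open>bisection_prod A B\<close> each arrow factors through \<open>A\<close> and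
  \<open>B\<close> in one way, as \<open>a \<gamma> \<cdot> b \<gamma>\<close>, and both factors
  vary continuously because they come from source sections. The convolution is there the single term
  formed by them.\<close>

lemma bisec_conv:
  assumes f: "f \<in> bisec" and g: "g \<in> bisec"
  shows "conv f g \<in> bisec"
proof -
  obtain A where A: "f \<in> sections" "compact_open_bisection G A"
    "\<And>\<gamma>. \<gamma> \<in> arrows G \<Longrightarrow> f \<gamma> \<noteq> val_zero \<gamma> \<Longrightarrow> \<gamma> \<in> A" using bisecD[OF f] by blast
  obtain B where B: "g \<in> sections" "compact_open_bisection G B"
    "\<And>\<gamma>. \<gamma> \<in> arrows G \<Longrightarrow> g \<gamma> \<noteq> val_zero \<gamma> \<Longrightarrow> \<gamma> \<in> B" using bisecD[OF g] by blast
  note AD = compact_open_bisectionD[OF A(2)] and BD = compact_open_bisectionD[OF B(2)]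
  let ?P = "bisection_prod A B"
  have P: "compact_open_bisection G ?P" by (rule bisection_prod[OF A(2) B(2)])
  have Pt: "topspace (subtopology T ?P) = ?P" using compact_open_bisectionD(6)[OF P] by auto
  define b where "b \<gamma> = src_section B (src \<gamma>)" for \<gamma>
  define a where "a \<gamma> = src_section A (tgt (b \<gamma>))" for \<gamma>
  have ab: "a \<gamma> \<in> A" "b \<gamma> \<in> B" "src (a \<gamma>) = tgt (b \<gamma>)" "\<gamma> = a \<gamma> \<cdot> b \<gamma>" "src \<gamma> \<in> src ` B"
    "tgt (b \<gamma>) \<in> src ` A" "a \<gamma> \<in> arrows G" "b \<gamma> \<in> arrows G" "tgt (a \<gamma>) = tgt \<gamma>"
    if \<gamma>: "\<gamma> \<in> ?P" for \<gamma>
  proof -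
    obtain \<alpha> \<beta> where g: "\<gamma> = \<alpha> \<cdot> \<beta>" "\<alpha> \<in> A" "\<beta> \<in> B" "src \<alpha> = tgt \<beta>"
      using \<gamma> by (auto simp: bisection_prod_def)
    moreover from this have "\<alpha> \<in> arrows G" "\<beta> \<in> arrows G" using AD(6) BD(6) by blast+
    ultimately have "src \<gamma> = src \<beta>" "tgt \<gamma> = tgt \<alpha>" by (simp_all add: dom_comp rng_comp)
    moreover have "b \<gamma> = \<beta>" using src_section(3)[OF BD(4) g(3)] calculation by (simp add: b_def)
    moreover have "a \<gamma> = \<alpha>"
      using src_section(3)[OF AD(4) g(2)] calculation g(4) by (simp add: a_def)
    ultimately show "a \<gamma> \<in> A" "b \<gamma> \<in> B" "src (a \<gamma>) = tgt (b \<gamma>)" "\<gamma> = a \<gamma> \<cdot> b \<gamma>" "src \<gamma> \<in> src ` B"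
        "tgt (b \<gamma>) \<in> src ` A" "a \<gamma> \<in> arrows G" "b \<gamma> \<in> arrows G" "tgt (a \<gamma>) = tgt \<gamma>"
      using g AD(6) BD(6) by (auto intro: rev_image_eqI)
  qed
  have "continuous_map (subtopology T ?P) (subtopology X (src ` B)) src"
    using continuous_map_from_subtopology[OF dom_continuous, of ?P] ab(5) Pt
    by (auto simp: continuous_map_in_subtopology)
  from continuous_map_compose[OF this src_section_continuous[OF BD(1,4)]]
  have bc: "continuous_map (subtopology T ?P) T b" by (simp add: o_def b_def[abs_def])
  have "continuous_map (subtopology T ?P) (subtopology X (src ` A)) (\<lambda>\<gamma>. tgt (b \<gamma>))"
    using continuous_map_compose[OF bc rng_continuous] ab(6) Pt
    by (auto simp: continuous_map_in_subtopology o_def)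
  from continuous_map_compose[OF this src_section_continuous[OF AD(1,4)]]
  have ac: "continuous_map (subtopology T ?P) T a" by (simp add: o_def a_def[abs_def])
  have gb: "continuous_map (subtopology T ?P) E (\<lambda>\<gamma>. g (b \<gamma>))"
    using continuous_map_compose[OF bc bisec_continuous[OF g]] by (simp add: o_def)
  have fa: "continuous_map (subtopology T ?P) E (\<lambda>\<gamma>. f (a \<gamma>))"
    using continuous_map_compose[OF ac bisec_continuous[OF f]] by (simp add: o_def)
  have tg: "continuous_map (subtopology T ?P) E (\<lambda>\<gamma>. tr (a \<gamma>) (g (b \<gamma>)))"
    by (rule continuous_tr[OF ac gb]) (use ab sections_proj[OF B(1)] Pt in auto)
  have "p (tr (a \<gamma>) (g (b \<gamma>))) = tgt \<gamma>" if "\<gamma> \<in> ?P" for \<gamma>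
  proof -
    have "g (b \<gamma>) \<in> carrier (stalk \<O> (src (a \<gamma>)))"
      using sections_value[OF B(1) ab(8)] ab(3) that by simp
    then have "tr (a \<gamma>) (g (b \<gamma>)) \<in> carrier (stalk \<O> (tgt \<gamma>))"
      using tr_closed[OF ab(7)] ab(9) that by metis
    then show ?thesis using stalk_carrier_iff rng_closed[OF ab(7)] ab(9) that by metis
  qed
  then have "continuous_map (subtopology T ?P) E
      (\<lambda>\<gamma>. f (a \<gamma>) \<otimes>\<^bsub>stalk \<O> (tgt \<gamma>)\<^esub> tr (a \<gamma>) (g (b \<gamma>)))"
    using sections_proj[OF A(1)] ab(7,9) Pt by (intro continuous_mult[OF fa tg]) auto
  moreover have "f (a \<gamma>) \<otimes>\<^bsub>stalk \<O> (tgt \<gamma>)\<^esub> tr (a \<gamma>) (g (b \<gamma>)) = conv f g \<gamma>"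
    if "\<gamma> \<in> topspace (subtopology T ?P)" for \<gamma>
  proof -
    have \<gamma>: "\<gamma> \<in> ?P" using that by auto
    have "\<sigma> = b \<gamma>" if "\<sigma> \<in> arrows G" "src \<sigma> = src (b \<gamma>)" "g \<sigma> \<noteq> val_zero \<sigma>" for \<sigma>
      using B(3) ab(2)[OF \<gamma>] BD(4) that by (auto dest: inj_onD)
    from conv_right_single[OF A(1) B(1) ab(7,8,3)[OF \<gamma>] this]
    show ?thesis using ab(4,9)[OF \<gamma>] by simp
  qed
  ultimately have "continuous_map (subtopology T ?P) E (conv f g)"
    by (rule continuous_map_eq)
  moreover have "\<gamma> \<in> ?P" if \<gamma>: "\<gamma> \<in> arrows G" "conv f g \<gamma> \<noteq> val_zero \<gamma>" for \<gamma>
  proof -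
    obtain \<alpha> \<beta> where "\<alpha> \<in> arrows G" "\<beta> \<in> arrows G" "src \<alpha> = tgt \<beta>" "\<gamma> = \<alpha> \<cdot> \<beta>"
      "f \<alpha> \<noteq> val_zero \<alpha>" "g \<beta> \<noteq> val_zero \<beta>"
      by (rule conv_nonzero[OF A(1) B(1) \<gamma>])
    moreover from this have "\<alpha> \<in> A" "\<beta> \<in> B" using A(3) B(3) by blast+
    ultimately show ?thesis unfolding bisection_prod_def by blast
  qed
  ultimately show ?thesis by (intro bisecI[OF conv_closed[OF A(1) B(1)] P]) auto
qed

lemma bisec_minus:
  assumes "f \<in> bisec"
  shows "\<ominus>\<^bsub>Sec\<^esub> f \<in> bisec"
proof -
  obtain B where B: "f \<in> sections" "compact_open_bisection G B" "continuous_map (subtopology T B) E f"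
    "\<And>\<gamma>. \<gamma> \<in> arrows G \<Longrightarrow> f \<gamma> \<noteq> val_zero \<gamma> \<Longrightarrow> \<gamma> \<in> B" using bisecD[OF assms] by blast
  have "continuous_map (subtopology T B) E (\<lambda>\<gamma>. \<ominus>\<^bsub>stalk \<O> (p (f \<gamma>))\<^esub> f \<gamma>)"
    using continuous_map_compose[OF B(3) neg_continuous] by (simp add: o_def)
  then have "continuous_map (subtopology T B) E (\<ominus>\<^bsub>Sec\<^esub> f)"
    by (rule continuous_map_eq) (use B(1) in \<open>auto simp: minus_apply sections_proj\<close>)
  moreover have "\<gamma> \<in> B" if \<gamma>: "\<gamma> \<in> arrows G" "(\<ominus>\<^bsub>Sec\<^esub> f) \<gamma> \<noteq> val_zero \<gamma>" for \<gamma>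
  proof (rule B(4)[OF \<gamma>(1)])
    interpret ring "stalk \<O> (tgt \<gamma>)" by (rule stalk_ring_rng[OF \<gamma>(1)])
    show "f \<gamma> \<noteq> val_zero \<gamma>" using \<gamma> B(1) by (auto simp: minus_apply)
  qed
  ultimately show ?thesis by (intro bisecI[OF Sec.a_inv_closed[OF B(1)] B(2)]) auto
qed

lemma bisec_zero: "\<zero>\<^bsub>Sec\<^esub> \<in> bisec"
  by (rule bisecI[of _ "{}"])
    (auto simp: compact_open_bisection_iff zero_apply continuous_map_on_empty)

section \<open>The convolution ring\<close>

abbreviation "\<Gamma> \<equiv> Gamma_c G \<O>"

lemma Gamma_simps:
  "carrier \<Gamma> = generate (add_monoid Sec) bisec" "add \<Gamma> = add Sec" "zero \<Gamma> = zero Sec"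
  "mult \<Gamma> = conv"
  by (simp_all add: Gamma_c_def all_sections_def)

lemma bisec_Gamma: "f \<in> bisec \<Longrightarrow> f \<in> carrier \<Gamma>"
  by (simp add: Gamma_simps generate.incl)

lemma Gamma_add: "f \<in> carrier \<Gamma> \<Longrightarrow> g \<in> carrier \<Gamma> \<Longrightarrow> f \<oplus>\<^bsub>Sec\<^esub> g \<in> carrier \<Gamma>"
  using generate.eng[of f "add_monoid Sec" bisec g] by (simp add: Gamma_simps)

text \<open>\<open>bisec\<close> already contains zero and is closed under negatives, so addition is
  the only generating step that remains.\<close>

lemma Gamma_induct [consumes 1, case_names bisec add]:
  assumes "f \<in> carrier \<Gamma>" and "\<And>f. f \<in> bisec \<Longrightarrow> P f"
    and "\<And>f g. \<lbrakk>f \<in> carrier \<Gamma>; g \<in> carrier \<Gamma>; P f; P g\<rbrakk> \<Longrightarrow> P (f \<oplus>\<^bsub>Sec\<^esub> g)"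
  shows "P f"
proof -
  have "f \<in> generate (add_monoid Sec) bisec" using assms(1) by (simp add: Gamma_simps)
  then show ?thesis
  proof induction
    case one
    show ?case using assms(2)[OF bisec_zero] by simp
  next
    case (inv h)
    show ?case using assms(2)[OF bisec_minus[OF inv]] by (simp add: a_inv_def)
  next
    case (eng h1 h2)
    then show ?case using assms(3)[of h1 h2] by (simp add: Gamma_simps)
  qed (rule assms(2))
qed

lemma Gamma_sections: "f \<in> carrier \<Gamma> \<Longrightarrow> f \<in> sections"
  by (induction rule: Gamma_induct) (simp_all add: bisec_sections)

lemma Gamma_fibrewise_finite: "f \<in> carrier \<Gamma> \<Longrightarrow> fibrewise_finite f"
proof (induction rule: Gamma_induct)
  case (add f g)
  have "finite {\<rho>\<in>arrows G. src \<rho> = x \<and> (f \<oplus>\<^bsub>Sec\<^esub> g) \<rho> \<noteq> val_zero \<rho>}" if "x \<in> units" for x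
  proof (rule finite_subset)
    show "{\<rho>\<in>arrows G. src \<rho> = x \<and> (f \<oplus>\<^bsub>Sec\<^esub> g) \<rho> \<noteq> val_zero \<rho>} \<subseteq>
        {\<rho>\<in>arrows G. src \<rho> = x \<and> f \<rho> \<noteq> val_zero \<rho>} \<union> {\<rho>\<in>arrows G. src \<rho> = x \<and> g \<rho> \<noteq> val_zero \<rho>}"
      by (auto simp: add_apply ring.ring_simprules(2,8) stalk_ring_rng)
    show "finite ({\<rho>\<in>arrows G. src \<rho> = x \<and> f \<rho> \<noteq> val_zero \<rho>} \<union>
        {\<rho>\<in>arrows G. src \<rho> = x \<and> g \<rho> \<noteq> val_zero \<rho>})"
      using add.IH that by (simp add: fibrewise_finite_def)
  qed
  then show ?case by (simp add: fibrewise_finite_def)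
qed (rule bisec_fibrewise_finite)

lemma Gamma_continuous: "f \<in> carrier \<Gamma> \<Longrightarrow> continuous_map T E f"
proof (induction rule: Gamma_induct)
  case (add f g)
  have "continuous_map T E (\<lambda>\<gamma>. f \<gamma> \<oplus>\<^bsub>stalk \<O> (tgt \<gamma>)\<^esub> g \<gamma>)"
    using add by (intro continuous_add) (simp_all add: sections_proj Gamma_sections)
  then show ?case by (rule continuous_map_eq) (simp add: add_apply)
qed (rule bisec_continuous)

lemma Gamma_conv:
  assumes "f \<in> carrier \<Gamma>" "g \<in> carrier \<Gamma>"
  shows "conv f g \<in> carrier \<Gamma>"
  using assms(2)
proof (induction rule: Gamma_induct)
  case (bisec g)
  show ?case using assms(1)
  proof (induction rule: Gamma_induct)
    case (bisec f)
    then show ?case using \<open>g \<in> bisec\<close> by (intro bisec_Gamma bisec_conv)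
  next
    case (add f f')
    then show ?case
      using conv_add_left[of f f' g] \<open>g \<in> bisec\<close>
      by (simp add: Gamma_sections Gamma_add bisec_sections bisec_fibrewise_finite)
  qed
next
  case (add g g')
  then show ?case
    using conv_add_right[of f g g'] assms(1)
    by (simp add: Gamma_sections Gamma_add Gamma_fibrewise_finite)
qed

text \<open>Associativity on bisection sections extends additively. Only \<open>g\<close> and
  \<open>h\<close> are decomposed, since \<open>conv_assoc_single\<close> admits any section as
  first factor.\<close>

lemma Gamma_conv_assoc:
  assumes f: "f \<in> carrier \<Gamma>" and g: "g \<in> carrier \<Gamma>" and h: "h \<in> carrier \<Gamma>"
  shows "conv (conv f g) h = conv f (conv g h)"
  using h
proof (induction rule: Gamma_induct)
  case (bisec h)
  show ?case using g
  proof (induction rule: Gamma_induct)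
    case (bisec g)
    then show ?case
      using \<open>h \<in> bisec\<close> Gamma_sections[OF f]
      by (simp add: conv_assoc_single bisec_sections bisec_fibrewise_single)
  next
    case (add g g')
    then show ?case
      using conv_add_right[of f g g'] conv_add_right[of f "conv g h" "conv g' h"]
        conv_add_left[of "conv f g" "conv f g'" h] conv_add_left[of g g' h]
        f bisec_Gamma[OF \<open>h \<in> bisec\<close>]
      by (simp add: Gamma_sections Gamma_fibrewise_finite Gamma_conv)
  qed
next
  case (add h h')
  then show ?case
    using conv_add_right[of "conv f g" h h'] conv_add_right[of g h h']
      conv_add_right[of f "conv g h" "conv g h'"] f g
    by (simp add: Gamma_sections Gamma_fibrewise_finite Gamma_conv)
qed

lemma Gamma_minus:
  assumes "f \<in> carrier \<Gamma>"
  shows "\<ominus>\<^bsub>Sec\<^esub> f \<in> carrier \<Gamma>"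
  using assms
proof (induction rule: Gamma_induct)
  case (bisec f)
  then show ?case by (intro bisec_Gamma bisec_minus)
next
  case (add f g)
  then show ?case by (simp add: Sec.minus_add Gamma_sections Gamma_add)
qed

sublocale Gamma: nonunital_ring \<Gamma>
proof -
  have "abelian_group \<Gamma>"
  proof (rule abelian_groupI)
    fix f assume f: "f \<in> carrier \<Gamma>"
    show "\<exists>g\<in>carrier \<Gamma>. g \<oplus>\<^bsub>\<Gamma>\<^esub> f = \<zero>\<^bsub>\<Gamma>\<^esub>"
      using Sec.l_neg[OF Gamma_sections[OF f]] Gamma_minus[OF f] by (auto simp: Gamma_simps(2,3))
  qed (use bisec_Gamma[OF bisec_zero] in
      \<open>simp_all add: Gamma_simps(2,3) Gamma_sections Gamma_add Sec.a_ac\<close>)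
  then show "nonunital_ring \<Gamma>"
    by (intro nonunital_ring.intro nonunital_ring_axioms.intro)
      (simp_all add: Gamma_simps(2,4) Gamma_conv Gamma_conv_assoc conv_add_left conv_add_right
        Gamma_sections Gamma_fibrewise_finite)
qed

lemma Gamma_minus_apply:
  assumes "f \<in> carrier \<Gamma>" "g \<in> carrier \<Gamma>" "\<gamma> \<in> arrows G"
  shows "(f \<ominus>\<^bsub>\<Gamma>\<^esub> g) \<gamma> = f \<gamma> \<ominus>\<^bsub>stalk \<O> (tgt \<gamma>)\<^esub> g \<gamma>"
proof -
  have "\<ominus>\<^bsub>\<Gamma>\<^esub> g = \<ominus>\<^bsub>Sec\<^esub> g"
    using assms Gamma_minus Sec.l_neg[OF Gamma_sections]
    by (intro Gamma.minus_equality) (simp_all add: Gamma_simps(2,3))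
  then show ?thesis
    using assms by (simp add: a_minus_def Gamma_simps(2) add_apply minus_apply Gamma_sections)
qed

end


section \<open>Dense orbits and left primitivity\<close>

text \<open>The condition \<open>effective\<close> says that two local sections of \<open>gdom G\<close> inducing the same
  partial map on units coincide. It amounts to the units being the interior of the isotropy.\<close>

locale effective_field_sheaf = ample_sheaf G \<O>
  for G :: "('g, 'x) top_groupoid" and \<O> :: "('g, 'x, 'e) gsheaf_of_rings" +
  assumes stalk_field: "x \<in> units \<Longrightarrow> field (stalk \<O> x)"
    and effective: "\<lbrakk>openin T A; openin T B; \<alpha> \<in> A; \<beta> \<in> B; src \<alpha> = src \<beta>;
      \<And>\<alpha>' \<beta>'. \<lbrakk>\<alpha>' \<in> A; \<beta>' \<in> B; src \<alpha>' = src \<beta>'\<rbrakk> \<Longrightarrow> tgt \<alpha>' = tgt \<beta>'\<rbrakk> \<Longrightarrow> \<alpha> = \<beta>"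
begin

section \<open>Orbits, bump sections and indicators\<close>

definition orbit :: "'x \<Rightarrow> 'x set" where
  "orbit x = tgt ` {\<gamma> \<in> arrows G. src \<gamma> = x}"

lemma one_closed: "x \<in> units \<Longrightarrow> \<one>\<^bsub>stalk \<O> x\<^esub> \<in> carrier (stalk \<O> x)"
  using stalk_is_ring ring.ring_simprules(6) by blast

lemma one_not_zero: "x \<in> units \<Longrightarrow> \<one>\<^bsub>stalk \<O> x\<^esub> \<noteq> \<zero>\<^bsub>stalk \<O> x\<^esub>"
  using stalk_field field.axioms(1) domain.one_not_zero by metis

lemma stalk_inverse:
  assumes "x \<in> units" "v \<in> carrier (stalk \<O> x)" "v \<noteq> \<zero>\<^bsub>stalk \<O> x\<^esub>"
  obtains c where "c \<in> carrier (stalk \<O> x)" "c \<otimes>\<^bsub>stalk \<O> x\<^esub> v = \<one>\<^bsub>stalk \<O> x\<^esub>"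
    "v \<otimes>\<^bsub>stalk \<O> x\<^esub> c = \<one>\<^bsub>stalk \<O> x\<^esub>"
proof -
  interpret field "stalk \<O> x" by (rule stalk_field[OF assms(1)])
  have "v \<in> Units (stalk \<O> x)" using assms by (simp add: field_Units)
  then show thesis using that by (auto simp: Units_def)
qed

lemma tr_one: "\<gamma> \<in> arrows G \<Longrightarrow> tr \<gamma> \<one>\<^bsub>stalk \<O> (src \<gamma>)\<^esub> = \<one>\<^bsub>stalk \<O> (tgt \<gamma>)\<^esub>"
  using ring_hom_one tr_hom by blast

text \<open>The value at an arrow lies in the stalk at its target, so a local section through
  \<open>c\<close> is pulled back along \<open>tgt\<close> and cut off outside a small bisection.
  That bisection is part of the conclusion because comaximality uses its injectivity.\<close>

lemma bump:
  assumes \<beta>: "\<beta> \<in> arrows G" and c: "c \<in> carrier (stalk \<O> (tgt \<beta>))"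
    and W: "openin T W" "\<beta> \<in> W"
  shows "\<exists>a\<in>bisec. \<exists>B. a \<beta> = c \<and> compact_open_bisection G B \<and> \<beta> \<in> B \<and> B \<subseteq> W \<and>
    (\<forall>\<gamma>\<in>arrows G. a \<gamma> \<noteq> val_zero \<gamma> \<longrightarrow> \<gamma> \<in> B)"
proof -
  have c': "c \<in> topspace E" "p c = tgt \<beta>" using c stalk_carrier_iff rng_closed[OF \<beta>] by blast+
  obtain K k where K: "openin X K" "tgt \<beta> \<in> K" "continuous_map (subtopology X K) E k"
    "\<And>x. x \<in> K \<Longrightarrow> k x \<in> carrier (stalk \<O> x)" "k (tgt \<beta>) = c"
    by (rule local_section[OF c'(1) openin_topspace]) (use c' rng_closed[OF \<beta>] in auto)
  obtain B where B: "compact_open_bisection G B" "\<beta> \<in> B" "B \<subseteq> W \<inter> {\<gamma> \<in> arrows G. tgt \<gamma> \<in> K}"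
    by (rule compact_open_bisection_nbhd[OF openin_Int[OF W(1) open_tgt_vimage[OF K(1)]], of \<beta>])
      (use W(2) \<beta> K(2) in auto)
  let ?a = "\<lambda>\<gamma>\<in>arrows G. if \<gamma> \<in> B then k (tgt \<gamma>) else val_zero \<gamma>"
  have "?a \<in> sections"
    using B(3) K(4) by (intro sectionsI) (auto simp: ring.ring_simprules(2) stalk_ring_rng)
  moreover have "continuous_map (subtopology T B) E ?a"
  proof -
    have "continuous_map (subtopology T B) (subtopology X K) tgt"
      using continuous_map_from_subtopology[OF rng_continuous, of B] B(3)
      by (auto simp: continuous_map_in_subtopology)
    from continuous_map_compose[OF this K(3)] show ?thesis
      by (rule continuous_map_eq) auto
  qed
  ultimately have "?a \<in> bisec" by (rule bisecI[OF _ B(1)]) (auto split: if_splits)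
  moreover have "?a \<beta> = c" using \<beta> B(2) K(5) by simp
  ultimately show ?thesis using B by (intro bexI[of _ ?a] exI[of _ B]) (auto split: if_splits)
qed

text \<open>The \<open>1\<^sub>U\<close> of the overview. For compact open \<open>U\<close> it is an
  idempotent; multiplication by it on the left keeps the values at arrows ending in
  \<open>U\<close>, on the right those at arrows starting in \<open>U\<close>.\<close>

definition ind :: "'x set \<Rightarrow> 'g \<Rightarrow> 'e" where
  "ind U = (\<lambda>\<gamma>\<in>arrows G. if \<gamma> \<in> gunit G ` U then \<one>\<^bsub>stalk \<O> (tgt \<gamma>)\<^esub> else val_zero \<gamma>)"

lemma ind_bisec:
  assumes "openin X U" "compactin X U"
  shows "ind U \<in> bisec"
proof -
  note B = unit_bisection[OF assms]
  have s: "ind U \<in> sections"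
    by (intro sectionsI) (auto simp: ind_def ring.ring_simprules(2,6) stalk_ring_rng)
  have "continuous_map (subtopology T (gunit G ` U)) E (\<lambda>\<gamma>. \<one>\<^bsub>stalk \<O> (tgt \<gamma>)\<^esub>)"
    using continuous_map_from_subtopology[OF continuous_map_compose[OF rng_continuous one_continuous]]
    by (simp add: o_def)
  then have "continuous_map (subtopology T (gunit G ` U)) E (ind U)"
    by (rule continuous_map_eq) (auto simp: ind_def)
  then show ?thesis by (rule bisecI[OF s B]) (auto simp: ind_def split: if_splits)
qed

lemma ind_unit: "x \<in> units \<Longrightarrow> x \<in> U \<Longrightarrow> ind U (gunit G x) = \<one>\<^bsub>stalk \<O> x\<^esub>"
  by (simp add: ind_def unit_closed rng_unit)

lemma ind_nonzero:
  assumes "\<gamma> \<in> arrows G" "ind U \<gamma> \<noteq> val_zero \<gamma>" "U \<subseteq> units"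
  shows "\<gamma> = gunit G (src \<gamma>)" "src \<gamma> \<in> U" "tgt \<gamma> = src \<gamma>"
proof -
  have "\<gamma> \<in> gunit G ` U" using assms by (auto simp: ind_def split: if_splits)
  then show "\<gamma> = gunit G (src \<gamma>)" "src \<gamma> \<in> U" "tgt \<gamma> = src \<gamma>"
    using assms(3) by (auto simp: dom_unit rng_unit subset_iff)
qed

lemma conv_ind_left:
  assumes U: "openin X U" "compactin X U" and g: "g \<in> sections" and \<gamma>: "\<gamma> \<in> arrows G"
  shows "conv (ind U) g \<gamma> = (if tgt \<gamma> \<in> U then g \<gamma> else val_zero \<gamma>)"
proof -
  have sub: "U \<subseteq> units" using U(1) openin_subset by blast
  note s = bisec_sections[OF ind_bisec[OF U]]
  interpret ring "stalk \<O> (tgt \<gamma>)" by (rule stalk_ring_rng[OF \<gamma>])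
  show ?thesis
  proof (cases "tgt \<gamma> \<in> U")
    case True
    let ?u = "gunit G (tgt \<gamma>)"
    note x = rng_closed[OF \<gamma>]
    have "\<sigma> = ?u" if "\<sigma> \<in> arrows G" "tgt \<sigma> = tgt ?u" "ind U \<sigma> \<noteq> val_zero \<sigma>" for \<sigma>
      using ind_nonzero[OF that(1,3) sub] that(2) rng_unit[OF x] by metis
    then have "conv (ind U) g (?u \<cdot> \<gamma>) = ind U ?u \<otimes>\<^bsub>stalk \<O> (tgt ?u)\<^esub> tr ?u (g \<gamma>)"
      using conv_left_single[OF s g unit_closed[OF x] \<gamma>] dom_unit[OF x] by blast
    then show ?thesis
      using True \<gamma> x sections_value[OF g \<gamma>] tr_unit[OF x, of "g \<gamma>"]
      by (simp add: ind_unit rng_unit comp_unit_left)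
  next
    case False
    have "conv (ind U) g \<gamma> = val_zero \<gamma>"
    proof (rule ccontr)
      assume nz: "conv (ind U) g \<gamma> \<noteq> val_zero \<gamma>"
      obtain \<beta> \<rho> where b: "\<beta> \<in> arrows G" "\<rho> \<in> arrows G" "src \<beta> = tgt \<rho>" "\<gamma> = \<beta> \<cdot> \<rho>"
        "ind U \<beta> \<noteq> val_zero \<beta>" by (rule conv_nonzero[OF s g \<gamma> nz])
      then show False using ind_nonzero[OF b(1,5) sub] False by (simp add: rng_comp)
    qed
    then show ?thesis using False by simp
  qed
qed

lemma conv_ind_right:
  assumes U: "openin X U" "compactin X U" and g: "g \<in> sections" and \<gamma>: "\<gamma> \<in> arrows G"
  shows "conv g (ind U) \<gamma> = (if src \<gamma> \<in> U then g \<gamma> else val_zero \<gamma>)"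
proof -
  have sub: "U \<subseteq> units" using U(1) openin_subset by blast
  note s = bisec_sections[OF ind_bisec[OF U]]
  interpret ring "stalk \<O> (tgt \<gamma>)" by (rule stalk_ring_rng[OF \<gamma>])
  show ?thesis
  proof (cases "src \<gamma> \<in> U")
    case True
    let ?u = "gunit G (src \<gamma>)"
    note x = dom_closed[OF \<gamma>]
    have "\<sigma> = ?u" if "\<sigma> \<in> arrows G" "src \<sigma> = src ?u" "ind U \<sigma> \<noteq> val_zero \<sigma>" for \<sigma>
      using ind_nonzero[OF that(1,3) sub] that(2) dom_unit[OF x] by metis
    then have "conv g (ind U) (\<gamma> \<cdot> ?u) = g \<gamma> \<otimes>\<^bsub>stalk \<O> (tgt \<gamma>)\<^esub> tr \<gamma> (ind U ?u)"
      using conv_right_single[OF g s \<gamma> unit_closed[OF x]] rng_unit[OF x] by metis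
    then show ?thesis
      using True \<gamma> x sections_value[OF g \<gamma>]
      by (simp add: ind_unit comp_unit_right tr_one)
  next
    case False
    have "conv g (ind U) \<gamma> = val_zero \<gamma>"
    proof (rule ccontr)
      assume nz: "conv g (ind U) \<gamma> \<noteq> val_zero \<gamma>"
      obtain \<beta> \<rho> where b: "\<beta> \<in> arrows G" "\<rho> \<in> arrows G" "src \<beta> = tgt \<rho>" "\<gamma> = \<beta> \<cdot> \<rho>"
        "ind U \<rho> \<noteq> val_zero \<rho>" by (rule conv_nonzero[OF g s \<gamma> nz])
      then show False using ind_nonzero[OF b(2,5) sub] False by (simp add: dom_comp)
    qed
    then show ?thesis using False by simp
  qed
qed

lemma conv_ind_ind:
  assumes U: "openin X U" "compactin X U" and V: "openin X V" "compactin X V" and "U \<subseteq> V"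
  shows "conv (ind U) (ind V) = ind U"
proof (rule sections_eqI)
  note s = bisec_sections[OF ind_bisec[OF U]] bisec_sections[OF ind_bisec[OF V]]
  have sub: "U \<subseteq> units" using U(1) openin_subset by blast
  show "conv (ind U) (ind V) \<in> sections" "ind U \<in> sections" using s conv_closed by auto
  fix \<gamma> assume \<gamma>: "\<gamma> \<in> arrows G"
  have "src \<gamma> \<in> V" if "ind U \<gamma> \<noteq> val_zero \<gamma>"
    using ind_nonzero(2)[OF \<gamma> that sub] assms(5) by blast
  then show "conv (ind U) (ind V) \<gamma> = ind U \<gamma>"
    using conv_ind_right[OF V s(1) \<gamma>] by metis
qed

lemma ind_disjoint_union:
  assumes U: "openin X U" "compactin X U" and V: "openin X V" "compactin X V" and "U \<inter> V = {}"
  shows "ind (U \<union> V) = ind U \<oplus>\<^bsub>Sec\<^esub> ind V"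
proof (rule sections_eqI)
  show "ind (U \<union> V) \<in> sections" "ind U \<oplus>\<^bsub>Sec\<^esub> ind V \<in> sections"
    by (intro Sec.a_closed bisec_sections ind_bisec openin_Un compactin_Un assms)+
  fix \<gamma> assume \<gamma>: "\<gamma> \<in> arrows G"
  interpret ring "stalk \<O> (tgt \<gamma>)" by (rule stalk_ring_rng[OF \<gamma>])
  have "U \<subseteq> units" "V \<subseteq> units" using U(1) V(1) openin_subset by blast+
  then have "inj_on (gunit G) (U \<union> V)" by (intro inj_on_inverseI[of _ src]) (auto simp: dom_unit)
  then have "\<not> (\<gamma> \<in> gunit G ` U \<and> \<gamma> \<in> gunit G ` V)" using assms(5) by (auto simp: inj_on_def)
  then show "ind (U \<union> V) \<gamma> = (ind U \<oplus>\<^bsub>Sec\<^esub> ind V) \<gamma>"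
    using \<gamma> by (auto simp: ind_def add_apply image_Un)
qed

text \<open>Only a cover of the support is claimed, since terms of a sum can cancel.\<close>

lemma Gamma_bisections:
  assumes "f \<in> carrier \<Gamma>"
  shows "\<exists>\<B>. finite \<B> \<and> (\<forall>B\<in>\<B>. compact_open_bisection G B) \<and>
    (\<forall>\<gamma>\<in>arrows G. f \<gamma> \<noteq> val_zero \<gamma> \<longrightarrow> \<gamma> \<in> \<Union>\<B>)"
  using assms
proof (induction rule: Gamma_induct)
  case (bisec f)
  then obtain B where "compact_open_bisection G B" "\<forall>\<gamma>\<in>arrows G. f \<gamma> \<noteq> val_zero \<gamma> \<longrightarrow> \<gamma> \<in> B"
    using bisecD by blast
  then show ?case by (intro exI[of _ "{B}"]) auto
next
  case (add f g)
  then obtain \<B> \<C> where "finite \<B>" "\<forall>B\<in>\<B>. compact_open_bisection G B"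
      "\<forall>\<gamma>\<in>arrows G. f \<gamma> \<noteq> val_zero \<gamma> \<longrightarrow> \<gamma> \<in> \<Union>\<B>"
      "finite \<C>" "\<forall>B\<in>\<C>. compact_open_bisection G B"
      "\<forall>\<gamma>\<in>arrows G. g \<gamma> \<noteq> val_zero \<gamma> \<longrightarrow> \<gamma> \<in> \<Union>\<C>" by blast
  moreover have "f \<gamma> \<noteq> val_zero \<gamma> \<or> g \<gamma> \<noteq> val_zero \<gamma>"
    if "\<gamma> \<in> arrows G" "(f \<oplus>\<^bsub>Sec\<^esub> g) \<gamma> \<noteq> val_zero \<gamma>" for \<gamma>
    using that by (auto simp: add_apply ring.ring_simprules(2,8) stalk_ring_rng)
  ultimately show ?case by (intro exI[of _ "\<B> \<union> \<C>"]) blast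
qed

section \<open>From left primitivity to a dense orbit\<close>

text \<open>Arrows in the support of \<open>a\<close> that start in \<open>V\<close> end in the
  finite union of the compact, hence closed, sets \<open>C B\<close>. The point \<open>x\<close> is
  in none of these, for the inverse of an arrow from \<open>V\<close> to \<open>x\<close> would put
  a point of \<open>V\<close> into the orbit. Any compact open \<open>U\<close> around
  \<open>x\<close> off this union will do.\<close>

lemma avoid_orbit:
  assumes a: "a \<in> carrier \<Gamma>" and x: "x \<in> units" and V: "openin X V" "compactin X V"
    and disj: "orbit x \<inter> V = {}"
  obtains U where "openin X U" "compactin X U" "x \<in> U" "conv (ind U) (conv a (ind V)) = \<zero>\<^bsub>\<Gamma>\<^esub>"
proof -
  obtain \<B> where \<B>: "finite \<B>" "\<And>B. B \<in> \<B> \<Longrightarrow> compact_open_bisection G B"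
    "\<And>\<gamma>. \<gamma> \<in> arrows G \<Longrightarrow> a \<gamma> \<noteq> val_zero \<gamma> \<Longrightarrow> \<gamma> \<in> \<Union>\<B>"
    using Gamma_bisections[OF a] by meson
  define C where "C B = tgt ` (B \<inter> {\<gamma> \<in> arrows G. src \<gamma> \<in> V})" for B
  have "closedin X (C B)" if "B \<in> \<B>" for B
    unfolding C_def using compact_open_bisectionD(2)[OF \<B>(2)[OF that]] V(2)
    by (intro compact_closed_units compact_tgt_image compact_Int_closedin closed_src_vimage)
  then have op: "openin X (units - \<Union>(C ` \<B>))"
    using \<B>(1) by (intro openin_diff openin_topspace closedin_Union) auto
  have "x \<notin> C B" for B
  proof
    assume "x \<in> C B"
    then obtain \<gamma> where \<gamma>: "\<gamma> \<in> arrows G" "src \<gamma> \<in> V" "tgt \<gamma> = x" by (auto simp: C_def)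
    then have "src \<gamma> \<in> orbit x"
      unfolding orbit_def by (intro image_eqI[of _ _ "ginv G \<gamma>"]) (simp_all add: groupoid_simps)
    then show False using disj \<gamma>(2) by blast
  qed
  then obtain U where U: "openin X U" "compactin X U" "x \<in> U" "U \<subseteq> units - \<Union>(C ` \<B>)"
    using zero_dimensional_nbhd[OF zero_dim op, of x] x by auto
  note aS = Gamma_sections[OF a] and VS = bisec_sections[OF ind_bisec[OF V]]
  have "conv (ind U) (conv a (ind V)) = \<zero>\<^bsub>Sec\<^esub>"
  proof (rule sections_eqI)
    show "conv (ind U) (conv a (ind V)) \<in> sections" "\<zero>\<^bsub>Sec\<^esub> \<in> sections"
      using conv_closed[OF bisec_sections[OF ind_bisec[OF U(1,2)]] conv_closed[OF aS VS]] by simp_all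
    fix \<gamma> assume \<gamma>: "\<gamma> \<in> arrows G"
    have "a \<gamma> = val_zero \<gamma>" if "tgt \<gamma> \<in> U" "src \<gamma> \<in> V"
    proof (rule ccontr)
      assume "a \<gamma> \<noteq> val_zero \<gamma>"
      then obtain B where "B \<in> \<B>" "\<gamma> \<in> B" using \<B>(3)[OF \<gamma>] by blast
      then have "tgt \<gamma> \<in> \<Union>(C ` \<B>)" using \<gamma> that(2) by (auto simp: C_def)
      then show False using that(1) U(4) by blast
    qed
    then show "conv (ind U) (conv a (ind V)) \<gamma> = \<zero>\<^bsub>Sec\<^esub> \<gamma>"
      using \<gamma> by (simp add: conv_ind_left[OF U(1,2) conv_closed[OF aS VS]]
          conv_ind_right[OF V aS] zero_apply)
  qed
  then show thesis using that[OF U(1-3)] by (simp add: Gamma_simps(3))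
qed

theorem dense_orbit_if_left_primitive:
  assumes "left_primitive \<Gamma>"
  shows "\<exists>x\<in>units. X closure_of orbit x = units"
proof (rule ccontr)
  assume no: "\<not> ?thesis"
  obtain N :: "('g \<Rightarrow> 'e, ('g \<Rightarrow> 'e) set) module" where
    simple: "simple_left_module \<Gamma> N" and faithful: "faithful_left_module \<Gamma> N"
    using assms by (auto simp: left_primitive_def)
  have lm: "left_module \<Gamma> N" using simple by (simp add: simple_left_module_def)
  interpret N: abelian_group N using lm by (simp add: left_module_def)
  have closed: "a \<odot>\<^bsub>N\<^esub> n \<in> carrier N"
    and assoc: "b \<in> carrier \<Gamma> \<Longrightarrow> conv a b \<odot>\<^bsub>N\<^esub> n = a \<odot>\<^bsub>N\<^esub> (b \<odot>\<^bsub>N\<^esub> n)"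
    and distr: "b \<in> carrier \<Gamma> \<Longrightarrow> (a \<oplus>\<^bsub>\<Gamma>\<^esub> b) \<odot>\<^bsub>N\<^esub> n = a \<odot>\<^bsub>N\<^esub> n \<oplus>\<^bsub>N\<^esub> b \<odot>\<^bsub>N\<^esub> n"
    if "a \<in> carrier \<Gamma>" "n \<in> carrier N" for a b n
    using lm that by (simp_all add: left_module_def Gamma_simps(4)[symmetric])
  have distr_r: "a \<odot>\<^bsub>N\<^esub> (m \<oplus>\<^bsub>N\<^esub> n) = a \<odot>\<^bsub>N\<^esub> m \<oplus>\<^bsub>N\<^esub> a \<odot>\<^bsub>N\<^esub> n"
    if "a \<in> carrier \<Gamma>" "m \<in> carrier N" "n \<in> carrier N" for a m n
    using lm that by (simp add: left_module_def)
  have zero_l: "\<zero>\<^bsub>\<Gamma>\<^esub> \<odot>\<^bsub>N\<^esub> n = \<zero>\<^bsub>N\<^esub>" if "n \<in> carrier N" for n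
    using distr[of "\<zero>\<^bsub>\<Gamma>\<^esub>" n "\<zero>\<^bsub>\<Gamma>\<^esub>"] closed[of "\<zero>\<^bsub>\<Gamma>\<^esub>" n] that by simp
  have zero_r: "a \<odot>\<^bsub>N\<^esub> \<zero>\<^bsub>N\<^esub> = \<zero>\<^bsub>N\<^esub>" if "a \<in> carrier \<Gamma>" for a
    using distr_r[of a "\<zero>\<^bsub>N\<^esub>" "\<zero>\<^bsub>N\<^esub>"] closed[of a "\<zero>\<^bsub>N\<^esub>"] that by simp
  have indG: "ind U \<in> carrier \<Gamma>" if "openin X U" "compactin X U" for U
    using bisec_Gamma[OF ind_bisec[OF that]] .
  obtain a0 n0 where n0: "a0 \<in> carrier \<Gamma>" "n0 \<in> carrier N" "a0 \<odot>\<^bsub>N\<^esub> n0 \<noteq> \<zero>\<^bsub>N\<^esub>"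
    using simple by (auto simp: simple_left_module_def)
  \<comment> \<open>A nonzero vector of this form is chosen because the targets of the support of
    \<open>a0\<close> lie in a compact set, which later yields an indicator fixing
    \<open>m\<close>.\<close>
  define m where "m = a0 \<odot>\<^bsub>N\<^esub> n0"
  have m: "m \<in> carrier N" unfolding m_def using n0 closed by blast
  have loc: "\<exists>U. openin X U \<and> compactin X U \<and> x \<in> U \<and> ind U \<odot>\<^bsub>N\<^esub> m = \<zero>\<^bsub>N\<^esub>" if x: "x \<in> units" for x
  proof -
    have "X closure_of orbit x \<noteq> units" using no x by blast
    then obtain W where W: "openin X W" "W \<noteq> {}" "orbit x \<inter> W = {}"
      unfolding dense_intersects_open by blast
    then obtain y where y: "y \<in> W" by blast
    obtain V where V: "openin X V" "compactin X V" "y \<in> V" "V \<subseteq> W"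
      by (rule zero_dimensional_nbhd[OF zero_dim W(1) y])
    have yu: "y \<in> units" using V(1,3) openin_subset by blast
    have "ind V \<noteq> \<zero>\<^bsub>\<Gamma>\<^esub>"
      using ind_unit[OF yu V(3)] one_not_zero[OF yu] zero_apply[OF unit_closed[OF yu]] rng_unit[OF yu]
      by (auto simp: Gamma_simps(3))
    then obtain n where n: "n \<in> carrier N" "ind V \<odot>\<^bsub>N\<^esub> n \<noteq> \<zero>\<^bsub>N\<^esub>"
      using faithful indG[OF V(1,2)] unfolding faithful_left_module_def by blast
    define k where "k = ind V \<odot>\<^bsub>N\<^esub> n"
    have k: "k \<in> carrier N" "k \<noteq> \<zero>\<^bsub>N\<^esub>" 
      unfolding k_def using n closed[OF indG[OF V(1,2)] n(1)] by simp_all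
    \<comment> \<open>\<open>ind V\<close> is idempotent and so fixes \<open>k\<close>. Hence this
      submodule contains the nonzero \<open>k\<close> and is all of \<open>N\<close>; in particular
      it contains \<open>m\<close>.\<close>
    let ?H = "(\<lambda>a. a \<odot>\<^bsub>N\<^esub> k) ` carrier \<Gamma>"
    have "submodule ?H \<Gamma> N"
    proof (intro submodule.intro subgroup.intro submodule_axioms.intro)
      show "?H \<subseteq> carrier (add_monoid N)" using closed k(1) by auto
      show "\<one>\<^bsub>add_monoid N\<^esub> \<in> ?H"
        using zero_l[OF k(1)] by (auto intro!: image_eqI[of _ _ "\<zero>\<^bsub>\<Gamma>\<^esub>"])
      show "u \<otimes>\<^bsub>add_monoid N\<^esub> v \<in> ?H" if "u \<in> ?H" "v \<in> ?H" for u v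
        using that distr[OF _ k(1), symmetric] by auto
      show "inv\<^bsub>add_monoid N\<^esub> u \<in> ?H" if u: "u \<in> ?H" for u
      proof -
        obtain a where a: "u = a \<odot>\<^bsub>N\<^esub> k" "a \<in> carrier \<Gamma>" using u by auto
        have "\<ominus>\<^bsub>N\<^esub> u = (\<ominus>\<^bsub>\<Gamma>\<^esub> a) \<odot>\<^bsub>N\<^esub> k"
          by (rule N.minus_equality)
            (use a k(1) closed zero_l[OF k(1)] distr[of "\<ominus>\<^bsub>\<Gamma>\<^esub> a" k a] in \<open>simp_all add: Gamma.l_neg\<close>)
        then have "\<ominus>\<^bsub>N\<^esub> u \<in> ?H" using Gamma.a_inv_closed[OF a(2)] by auto
        then show ?thesis by (simp only: a_inv_def)
      qed
      show "a \<odot>\<^bsub>N\<^esub> u \<in> ?H" if "a \<in> carrier \<Gamma>" "u \<in> ?H" for a u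
        using that Gamma_conv assoc[OF _ k(1), symmetric] by auto
    qed
    then have "?H = {\<zero>\<^bsub>N\<^esub>} \<or> ?H = carrier N"
      using simple by (simp add: simple_left_module_def)
    moreover have "ind V \<odot>\<^bsub>N\<^esub> k = k"
    proof -
      have "conv (ind V) (ind V) = ind V" by (rule conv_ind_ind[OF V(1,2,1,2)]) simp
      then show ?thesis unfolding k_def using assoc indG[OF V(1,2)] n(1) by metis
    qed
    then have "k \<in> ?H" using indG[OF V(1,2)] by (metis imageI)
    ultimately have "?H = carrier N" using k(2) by blast
    then obtain a where a: "a \<in> carrier \<Gamma>" "m = a \<odot>\<^bsub>N\<^esub> k" using m by blast
    have "orbit x \<inter> V = {}" using W(3) V(4) by blast
    then obtain U where U: "openin X U" "compactin X U" "x \<in> U"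
      "conv (ind U) (conv a (ind V)) = \<zero>\<^bsub>\<Gamma>\<^esub>"
      by (rule avoid_orbit[OF a(1) x V(1,2)])
    have "ind U \<odot>\<^bsub>N\<^esub> m = conv (ind U) (conv a (ind V)) \<odot>\<^bsub>N\<^esub> n"
      using a n(1) indG[OF V(1,2)] indG[OF U(1,2)] by (simp add: k_def assoc Gamma_conv closed)
    then show ?thesis using U zero_l[OF n(1)] by auto
  qed
  define \<U> where "\<U> = {U. openin X U \<and> compactin X U \<and> ind U \<odot>\<^bsub>N\<^esub> m = \<zero>\<^bsub>N\<^esub>}"
  \<comment> \<open>Indicators add over disjoint sets, so the union is split into \<open>U\<close>
    and \<open>V - U\<close>. The indicator of \<open>V - U\<close> kills \<open>m\<close> because
    it is its own product with \<open>ind V\<close>.\<close>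
  have un: "U \<union> V \<in> \<U>" if "U \<in> \<U>" "V \<in> \<U>" for U V
  proof -
    have U: "openin X U" "compactin X U" "ind U \<odot>\<^bsub>N\<^esub> m = \<zero>\<^bsub>N\<^esub>"
      and V: "openin X V" "compactin X V" "ind V \<odot>\<^bsub>N\<^esub> m = \<zero>\<^bsub>N\<^esub>"
      using that by (auto simp: \<U>_def)
    have "V - U = V \<inter> (units - U)" using V(1) openin_subset by blast
    moreover have "closedin X (units - U)" using U(1) by blast
    ultimately have VU: "openin X (V - U)" "compactin X (V - U)"
      using openin_diff[OF V(1) compact_closed_units[OF U(2)]]
        compact_Int_closedin[OF V(2), of "units - U"] by simp_all
    have "conv (ind (V - U)) (ind V) = ind (V - U)"
      by (rule conv_ind_ind[OF VU V(1,2)]) blast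
    then have "ind (V - U) \<odot>\<^bsub>N\<^esub> m = \<zero>\<^bsub>N\<^esub>"
      using assoc[OF indG[OF VU] m indG[OF V(1,2)]] V(3) zero_r[OF indG[OF VU]] by simp
    moreover have "ind (U \<union> V) = ind U \<oplus>\<^bsub>\<Gamma>\<^esub> ind (V - U)"
      using ind_disjoint_union[OF U(1,2) VU] by (simp add: Gamma_simps(2))
    ultimately have "ind (U \<union> V) \<odot>\<^bsub>N\<^esub> m = \<zero>\<^bsub>N\<^esub>"
      using distr[OF indG[OF U(1,2)] m indG[OF VU]] U(3) by simp
    then show ?thesis using U V by (simp add: \<U>_def openin_Un compactin_Un)
  qed
  have fin: "\<Union>\<F> \<in> \<U>" if "finite \<F>" "\<F> \<subseteq> \<U>" for \<F>
    using that
  proof (induction rule: finite_induct)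
    case empty
    have "ind {} = \<zero>\<^bsub>\<Gamma>\<^esub>" by (simp add: ind_def Gamma_simps(3) all_sections_def)
    then show ?case using zero_l[OF m] by (simp add: \<U>_def)
  qed (use un in auto)
  obtain \<B> where \<B>: "finite \<B>" "\<And>B. B \<in> \<B> \<Longrightarrow> compact_open_bisection G B"
    "\<And>\<gamma>. \<gamma> \<in> arrows G \<Longrightarrow> a0 \<gamma> \<noteq> val_zero \<gamma> \<Longrightarrow> \<gamma> \<in> \<Union>\<B>"
    using Gamma_bisections[OF n0(1)] by meson
  \<comment> \<open>This set contains the targets of the support of \<open>a0\<close>, so the
    indicator of any compact open \<open>K\<close> around it satisfies
    \<open>conv (ind K) a0 = a0\<close> and fixes \<open>m\<close>. A finite union of members of
    \<open>\<U>\<close> is such a \<open>K\<close>, and its indicator also kills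
    \<open>m\<close>.\<close>
  have C: "compactin X (\<Union>B\<in>\<B>. tgt ` B)"
    using \<B>(1) compact_open_bisectionD(2)[OF \<B>(2)] by (auto intro!: compactin_Union compact_tgt_image)
  have "\<exists>\<F>. finite \<F> \<and> \<F> \<subseteq> \<U> \<and> (\<Union>B\<in>\<B>. tgt ` B) \<subseteq> \<Union>\<F>"
  proof (rule compactinD[OF C])
    have "units \<subseteq> \<Union>\<U>" using loc unfolding \<U>_def by blast
    then show "(\<Union>B\<in>\<B>. tgt ` B) \<subseteq> \<Union>\<U>" using compactin_subset_topspace[OF C] by (rule order_trans[rotated])
  qed (auto simp: \<U>_def)
  then obtain \<F> where "finite \<F>" "\<F> \<subseteq> \<U>" "(\<Union>B\<in>\<B>. tgt ` B) \<subseteq> \<Union>\<F>" by metis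
  then obtain K where K: "K \<in> \<U>" "(\<Union>B\<in>\<B>. tgt ` B) \<subseteq> K" using fin[of \<F>] by metis
  have Ko: "openin X K" "compactin X K" "ind K \<odot>\<^bsub>N\<^esub> m = \<zero>\<^bsub>N\<^esub>" using K(1) by (auto simp: \<U>_def)
  have "conv (ind K) a0 = a0"
  proof (rule sections_eqI)
    show "conv (ind K) a0 \<in> sections" "a0 \<in> sections"
      using indG[OF Ko(1,2)] n0(1) by (auto intro: Gamma_sections conv_closed)
    fix \<gamma> assume \<gamma>: "\<gamma> \<in> arrows G"
    have "tgt \<gamma> \<in> K" if "a0 \<gamma> \<noteq> val_zero \<gamma>" using \<B>(3)[OF \<gamma> that] K(2) by blast
    then show "conv (ind K) a0 \<gamma> = a0 \<gamma>"
      using conv_ind_left[OF Ko(1,2) Gamma_sections[OF n0(1)] \<gamma>] by metis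
  qed
  then have "ind K \<odot>\<^bsub>N\<^esub> m = m" unfolding m_def using assoc[OF indG[OF Ko(1,2)] n0(2,1)] by metis
  then show False using Ko(3) n0(3) by (simp add: m_def)
qed

section \<open>From a dense orbit to left primitivity\<close>

text \<open>Agreement with zero spreads to neighbourhoods in any sheaf of rings; for nonvanishing
  the stalks are fields. The inverse of \<open>f \<gamma>\<close> extends to a local section
  \<open>k\<close>, the identity f k = 1 holds at \<open>\<gamma>\<close>, hence nearby, and it
  excludes zeros of \<open>f\<close> since 1 is not 0.\<close>

lemma support_open:
  assumes f: "f \<in> carrier \<Gamma>" and \<gamma>: "\<gamma> \<in> arrows G" "f \<gamma> \<noteq> val_zero \<gamma>"
  obtains A where "openin T A" "\<gamma> \<in> A" "\<And>\<alpha>. \<alpha> \<in> A \<Longrightarrow> f \<alpha> \<noteq> val_zero \<alpha>"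
proof -
  note fS = Gamma_sections[OF f]
  obtain c where c: "c \<in> carrier (stalk \<O> (tgt \<gamma>))" "f \<gamma> \<otimes>\<^bsub>stalk \<O> (tgt \<gamma>)\<^esub> c = \<one>\<^bsub>stalk \<O> (tgt \<gamma>)\<^esub>"
    by (rule stalk_inverse[OF rng_closed[OF \<gamma>(1)] sections_value[OF fS \<gamma>(1)] \<gamma>(2)])
  have c': "c \<in> topspace E" "p c = tgt \<gamma>" using c stalk_carrier_iff rng_closed[OF \<gamma>(1)] by blast+
  obtain K k where K: "openin X K" "tgt \<gamma> \<in> K" "continuous_map (subtopology X K) E k"
    "\<And>x. x \<in> K \<Longrightarrow> k x \<in> carrier (stalk \<O> x)" "k (tgt \<gamma>) = c"
    by (rule local_section[OF c'(1) openin_topspace]) (use c' rng_closed[OF \<gamma>(1)] in auto)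
  let ?W = "{\<gamma> \<in> arrows G. tgt \<gamma> \<in> K}"
  have W: "openin T ?W" by (rule open_tgt_vimage[OF K(1)])
  have Wt: "topspace (subtopology T ?W) = ?W" by auto
  have fc: "continuous_map (subtopology T ?W) E f"
    by (rule continuous_map_from_subtopology[OF Gamma_continuous[OF f]])
  have "continuous_map (subtopology T ?W) (subtopology X K) tgt"
    using continuous_map_from_subtopology[OF rng_continuous, of ?W]
    by (auto simp: continuous_map_in_subtopology)
  from continuous_map_compose[OF this K(3)]
  have kc: "continuous_map (subtopology T ?W) E (\<lambda>\<gamma>. k (tgt \<gamma>))" by (simp add: o_def)
  have pk: "p (k (tgt \<alpha>)) = tgt \<alpha>" if "\<alpha> \<in> ?W" for \<alpha>
    using that K(4)[of "tgt \<alpha>"] stalk_carrier_iff rng_closed[of \<alpha>] by blast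
  have mc: "continuous_map (subtopology T ?W) E (\<lambda>\<gamma>. f \<gamma> \<otimes>\<^bsub>stalk \<O> (tgt \<gamma>)\<^esub> k (tgt \<gamma>))"
    by (rule continuous_mult[OF fc kc]) (use pk sections_proj[OF fS] in auto)
  have oc: "continuous_map (subtopology T ?W) E (\<lambda>\<gamma>. \<one>\<^bsub>stalk \<O> (tgt \<gamma>)\<^esub>)"
    using continuous_map_from_subtopology[OF continuous_map_compose[OF rng_continuous one_continuous]]
    by (simp add: o_def)
  have "p (f \<alpha> \<otimes>\<^bsub>stalk \<O> (tgt \<alpha>)\<^esub> k (tgt \<alpha>)) = p \<one>\<^bsub>stalk \<O> (tgt \<alpha>)\<^esub>" if "\<alpha> \<in> ?W" for \<alpha>
  proof -
    have \<alpha>: "\<alpha> \<in> arrows G" "tgt \<alpha> \<in> K" using that by auto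
    interpret ring "stalk \<O> (tgt \<alpha>)" by (rule stalk_ring_rng[OF \<alpha>(1)])
    show ?thesis
      using m_closed[OF sections_value[OF fS \<alpha>(1)] K(4)[OF \<alpha>(2)]] one_closed
        stalk_carrier_iff rng_closed[OF \<alpha>(1)] by metis
  qed
  then obtain A where A: "openin (subtopology T ?W) A" "\<gamma> \<in> A"
    "\<And>\<alpha>. \<alpha> \<in> A \<Longrightarrow> f \<alpha> \<otimes>\<^bsub>stalk \<O> (tgt \<alpha>)\<^esub> k (tgt \<alpha>) = \<one>\<^bsub>stalk \<O> (tgt \<alpha>)\<^esub>"
    using sections_agree_nbhd[OF mc oc, of \<gamma>] \<gamma>(1) K(2,5) c(2) unfolding Wt by blast
  have A': "openin T A" "A \<subseteq> ?W" using A(1) W by (simp_all add: openin_open_subtopology)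
  have "f \<alpha> \<noteq> val_zero \<alpha>" if \<alpha>: "\<alpha> \<in> A" for \<alpha>
  proof
    assume z: "f \<alpha> = val_zero \<alpha>"
    have a: "\<alpha> \<in> arrows G" "tgt \<alpha> \<in> K" using \<alpha> A'(2) by auto
    interpret ring "stalk \<O> (tgt \<alpha>)" by (rule stalk_ring_rng[OF a(1)])
    show False
      using A(3)[OF \<alpha>] z K(4)[OF a(2)] one_not_zero[OF rng_closed[OF a(1)]] by simp
  qed
  then show thesis using that[OF A'(1) A(2)] by blast
qed

text \<open>There are three cases. If \<open>A\<close> meets \<open>B\<close>, the intersection
  works because \<open>gdom\<close> is injective on \<open>B\<close>. If some source of
  \<open>A\<close> is outside the closed set of sources of \<open>B\<close>, the smaller set avoids
  the latter. Otherwise \<open>effective\<close> provides arrows of \<open>A\<close> and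
  \<open>B\<close> with a common source and different targets, and separating these targets keeps
  \<open>B\<close> away from the smaller set.\<close>

lemma shrink_bisection:
  assumes A: "openin T A" "A \<noteq> {}" and B: "compact_open_bisection G B"
  shows "\<exists>A'\<subseteq>A. openin T A' \<and> A' \<noteq> {} \<and>
    (\<forall>\<delta>\<in>B. src \<delta> \<in> src ` A' \<longrightarrow> tgt \<delta> \<in> tgt ` A' \<longrightarrow> \<delta> \<in> A)"
proof -
  note BD = compact_open_bisectionD[OF B]
  have sub: "A \<subseteq> arrows G" using A openin_subset by blast
  consider "A \<inter> B \<noteq> {}" | \<alpha> where "\<alpha> \<in> A" "src \<alpha> \<notin> src ` B" |
    "A \<inter> B = {}" "src ` A \<subseteq> src ` B" by blast
  then show ?thesis
  proof cases
    case 1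
    have "\<delta> \<in> A" if "\<delta> \<in> B" "src \<delta> \<in> src ` (A \<inter> B)" for \<delta>
      using that BD(4) by (auto dest: inj_onD)
    then show ?thesis using 1 A(1) BD(1) by (intro exI[of _ "A \<inter> B"]) auto
  next
    case 2
    let ?A = "A \<inter> {\<gamma> \<in> arrows G. src \<gamma> \<in> units - src ` B}"
    have "openin X (units - src ` B)"
      by (intro openin_diff openin_topspace compact_closed_units compact_src_image BD)
    then have "openin T ?A" by (intro openin_Int A(1) open_src_vimage)
    moreover have "\<alpha> \<in> ?A" using 2 sub dom_closed by auto
    moreover have "\<delta> \<notin> B" if \<delta>: "src \<delta> \<in> src ` ?A" for \<delta>
    proof -
      obtain \<gamma> where "src \<delta> = src \<gamma>" "src \<gamma> \<notin> src ` B" using \<delta> by auto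
      then show ?thesis by (metis imageI)
    qed
    ultimately show ?thesis by (intro exI[of _ ?A]) blast
  next
    case 3
    obtain \<alpha> where \<alpha>: "\<alpha> \<in> A" using A(2) by blast
    then obtain \<beta> where \<beta>: "\<beta> \<in> B" "src \<alpha> = src \<beta>" using 3(2) by force
    have "\<alpha> \<noteq> \<beta>" using \<alpha> \<beta> 3(1) by blast
    then obtain \<alpha>' \<beta>' where ab: "\<alpha>' \<in> A" "\<beta>' \<in> B" "src \<alpha>' = src \<beta>'" "tgt \<alpha>' \<noteq> tgt \<beta>'"
      using effective[OF A(1) BD(1) \<alpha> \<beta>] by blast
    have "tgt \<alpha>' \<in> units" "tgt \<beta>' \<in> units" using ab sub BD(6) rng_closed by blast+
    then obtain P Q where PQ: "openin X P" "openin X Q" "tgt \<alpha>' \<in> P" "tgt \<beta>' \<in> Q" "P \<inter> Q = {}"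
      using hausdorff_units ab(4) unfolding Hausdorff_space_def disjnt_def by metis
    let ?Q = "src ` (B \<inter> {\<gamma> \<in> arrows G. tgt \<gamma> \<in> Q})"
    \<comment> \<open>Arrows of \<open>?A\<close> end in \<open>P\<close>, while arrows of
      \<open>B\<close> over their sources end in the disjoint set \<open>Q\<close>.\<close>
    let ?A = "A \<inter> {\<gamma> \<in> arrows G. tgt \<gamma> \<in> P} \<inter> {\<gamma> \<in> arrows G. src \<gamma> \<in> ?Q}"
    have "openin T ?A"
      by (intro openin_Int A(1) BD(1) open_src_vimage open_tgt_vimage open_src_image PQ)
    moreover have "\<alpha>' \<in> ?A" using ab PQ sub BD(6) by auto
    moreover have False if \<delta>: "\<delta> \<in> B" "src \<delta> \<in> src ` ?A" "tgt \<delta> \<in> tgt ` ?A" for \<delta>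
    proof -
      obtain \<beta>'' where "\<beta>'' \<in> B" "tgt \<beta>'' \<in> Q" "src \<delta> = src \<beta>''" using \<delta>(2) by auto
      then have "tgt \<delta> \<in> Q" using BD(4) \<delta>(1) by (auto dest: inj_onD)
      then show False using \<delta>(3) PQ(5) by auto
    qed
    ultimately show ?thesis by (intro exI[of _ ?A]) blast
  qed
qed

text \<open>Further shrinking preserves what was achieved for earlier bisections, because the sets
  of sources and targets get smaller. So the bisections can be treated one at a time.\<close>

lemma shrink_bisections:
  assumes "finite \<B>" "\<forall>B\<in>\<B>. compact_open_bisection G B" and A: "openin T A" "A \<noteq> {}"
  shows "\<exists>A'\<subseteq>A. openin T A' \<and> A' \<noteq> {} \<and>
    (\<forall>\<delta>\<in>\<Union>\<B>. src \<delta> \<in> src ` A' \<longrightarrow> tgt \<delta> \<in> tgt ` A' \<longrightarrow> \<delta> \<in> A)"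
  using assms(1,2)
proof (induction rule: finite_induct)
  case empty
  then show ?case using A by auto
next
  case (insert B \<B>)
  then obtain A1 where A1: "A1 \<subseteq> A" "openin T A1" "A1 \<noteq> {}"
    "\<forall>\<delta>\<in>\<Union>\<B>. src \<delta> \<in> src ` A1 \<longrightarrow> tgt \<delta> \<in> tgt ` A1 \<longrightarrow> \<delta> \<in> A" by auto
  obtain A2 where A2: "A2 \<subseteq> A1" "openin T A2" "A2 \<noteq> {}"
    "\<forall>\<delta>\<in>B. src \<delta> \<in> src ` A2 \<longrightarrow> tgt \<delta> \<in> tgt ` A2 \<longrightarrow> \<delta> \<in> A1"
    using shrink_bisection[OF A1(2,3), of B] insert.prems by auto
  have "\<delta> \<in> A" if "\<delta> \<in> \<Union>(insert B \<B>)" "src \<delta> \<in> src ` A2" "tgt \<delta> \<in> tgt ` A2" for \<delta>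
  proof -
    have "src \<delta> \<in> src ` A1" "tgt \<delta> \<in> tgt ` A1" using that A2(1) by blast+
    then show ?thesis using that A1(1,4) A2(4) by blast
  qed
  then show ?case using A1 A2 by (intro exI[of _ A2]) blast
qed

theorem left_primitive_if_dense_orbit:
  assumes x: "x \<in> units" and dense: "X closure_of orbit x = units"
  shows "left_primitive \<Gamma>"
proof -
  obtain U where U: "openin X U" "compactin X U" "x \<in> U"
    by (rule zero_dimensional_nbhd[OF zero_dim openin_topspace x])
  have sub: "U \<subseteq> units" using U(1) openin_subset by blast
  have indG: "ind U \<in> carrier \<Gamma>" by (rule bisec_Gamma[OF ind_bisec[OF U(1,2)]])
  let ?u = "gunit G x"
  have u: "?u \<in> arrows G" "src ?u = x" "tgt ?u = x" using x by (simp_all add: groupoid_simps)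
  define L where "L = {a \<in> carrier \<Gamma>. \<forall>\<gamma>\<in>arrows G. src \<gamma> = x \<longrightarrow> a \<gamma> = val_zero \<gamma>}"
  show ?thesis
  proof (rule Gamma.left_primitive_modular[of L "ind U"])
    show "Gamma.left_ideal L"
      unfolding Gamma.left_ideal_def
    proof (intro conjI ballI)
      show "L \<subseteq> carrier \<Gamma>" by (auto simp: L_def)
      show "\<zero>\<^bsub>\<Gamma>\<^esub> \<in> L" by (auto simp: L_def) (simp add: Gamma_simps(3) zero_apply)
      show "a \<ominus>\<^bsub>\<Gamma>\<^esub> b \<in> L" if ab: "a \<in> L" "b \<in> L" for a b
      proof -
        have "(a \<ominus>\<^bsub>\<Gamma>\<^esub> b) \<gamma> = val_zero \<gamma>" if \<gamma>: "\<gamma> \<in> arrows G" "src \<gamma> = x" for \<gamma>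
        proof -
          interpret ring "stalk \<O> (tgt \<gamma>)" by (rule stalk_ring_rng[OF \<gamma>(1)])
          show ?thesis using ab \<gamma> by (simp add: L_def Gamma_minus_apply minus_eq)
        qed
        then show ?thesis using ab by (simp add: L_def)
      qed
      \<comment> \<open>A product has the source of its right factor, so vanishing over the source
        \<open>x\<close> is stable under left multiplication.\<close>
      show "a \<otimes>\<^bsub>\<Gamma>\<^esub> b \<in> L" if ab: "a \<in> carrier \<Gamma>" "b \<in> L" for a b
      proof -
        have b: "b \<in> carrier \<Gamma>" "\<And>\<gamma>. \<gamma> \<in> arrows G \<Longrightarrow> src \<gamma> = x \<Longrightarrow> b \<gamma> = val_zero \<gamma>"
          using ab(2) by (auto simp: L_def)
        have "conv a b \<gamma> = val_zero \<gamma>" if \<gamma>: "\<gamma> \<in> arrows G" "src \<gamma> = x" for \<gamma>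
        proof (rule ccontr)
          assume nz: "conv a b \<gamma> \<noteq> val_zero \<gamma>"
          obtain \<beta> \<rho> where r: "\<beta> \<in> arrows G" "\<rho> \<in> arrows G" "src \<beta> = tgt \<rho>" "\<gamma> = \<beta> \<cdot> \<rho>"
            "b \<rho> \<noteq> val_zero \<rho>"
            by (rule conv_nonzero[OF Gamma_sections[OF ab(1)] Gamma_sections[OF b(1)] \<gamma>(1) nz])
          then show False using b(2)[OF r(2)] \<gamma>(2) by (simp add: dom_comp)
        qed
        then show ?thesis using Gamma_conv[OF ab(1) b(1)] by (simp add: L_def Gamma_simps(4))
      qed
    qed
    show "ind U \<in> carrier \<Gamma>" by (rule indG)
    show "ind U \<notin> L"
      using ind_unit[OF x U(3)] one_not_zero[OF x] u by (auto simp: L_def)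
    show "a \<ominus>\<^bsub>\<Gamma>\<^esub> a \<otimes>\<^bsub>\<Gamma>\<^esub> ind U \<in> L" if a: "a \<in> carrier \<Gamma>" for a
    proof -
      note c = Gamma_conv[OF a indG]
      have "(a \<ominus>\<^bsub>\<Gamma>\<^esub> conv a (ind U)) \<gamma> = val_zero \<gamma>" if \<gamma>: "\<gamma> \<in> arrows G" "src \<gamma> = x" for \<gamma>
      proof -
        interpret ring "stalk \<O> (tgt \<gamma>)" by (rule stalk_ring_rng[OF \<gamma>(1)])
        show ?thesis
          using a \<gamma> U(3) sections_value[OF Gamma_sections[OF a] \<gamma>(1)]
          by (simp add: Gamma_minus_apply c conv_ind_right[OF U(1,2)] Gamma_sections minus_eq r_neg)
      qed
      then show ?thesis using a c by (simp add: L_def Gamma_simps(4))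
    qed
    show "\<exists>a\<in>carrier \<Gamma>. \<exists>b\<in>carrier \<Gamma>. a \<otimes>\<^bsub>\<Gamma>\<^esub> (f \<otimes>\<^bsub>\<Gamma>\<^esub> b) \<ominus>\<^bsub>\<Gamma>\<^esub> ind U \<in> L"
      if f: "f \<in> carrier \<Gamma>" "f \<noteq> \<zero>\<^bsub>\<Gamma>\<^esub>" for f
    proof -
      note fS = Gamma_sections[OF f(1)]
      obtain \<gamma>0 where \<gamma>0: "\<gamma>0 \<in> arrows G" "f \<gamma>0 \<noteq> val_zero \<gamma>0"
        using f(2) sections_eqI[OF fS Sec.zero_closed] by (auto simp: Gamma_simps(3) zero_apply)
      obtain A0 where A0: "openin T A0" "\<gamma>0 \<in> A0" "\<And>\<alpha>. \<alpha> \<in> A0 \<Longrightarrow> f \<alpha> \<noteq> val_zero \<alpha>"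
        using support_open[OF f(1) \<gamma>0] by metis
      obtain A where A: "compact_open_bisection G A" "\<gamma>0 \<in> A" "A \<subseteq> A0"
        by (rule compact_open_bisection_nbhd[OF A0(1,2)])
      note AD = compact_open_bisectionD[OF A(1)]
      obtain \<B> where \<B>: "finite \<B>" "\<forall>B\<in>\<B>. compact_open_bisection G B"
        "\<forall>\<gamma>\<in>arrows G. f \<gamma> \<noteq> val_zero \<gamma> \<longrightarrow> \<gamma> \<in> \<Union>\<B>"
        using Gamma_bisections[OF f(1)] by blast
      have "A \<noteq> {}" using A(2) by blast
      then obtain A' where A': "A' \<subseteq> A" "openin T A'" "A' \<noteq> {}"
        "\<forall>\<delta>\<in>\<Union>\<B>. src \<delta> \<in> src ` A' \<longrightarrow> tgt \<delta> \<in> tgt ` A' \<longrightarrow> \<delta> \<in> A"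
        using shrink_bisections[OF \<B>(1,2) AD(1)] by blast
      have "orbit x \<inter> src ` A' \<noteq> {}"
        using dense open_src_image[OF A'(2)] A'(3) unfolding dense_intersects_open by blast
      then obtain y where y: "y \<in> orbit x" "y \<in> src ` A'" by blast
      obtain \<tau> where \<tau>: "\<tau> \<in> arrows G" "src \<tau> = x" "y = tgt \<tau>" using y(1) unfolding orbit_def by blast
      obtain \<alpha> where \<alpha>: "\<alpha> \<in> A'" "src \<alpha> = tgt \<tau>" using y(2) \<tau>(3) by auto
      have \<alpha>A: "\<alpha> \<in> A" "\<alpha> \<in> arrows G" "f \<alpha> \<noteq> val_zero \<alpha>" using \<alpha>(1) A'(1) A(3) A0(3) AD(6) by auto
      \<comment> \<open>\<open>b\<close> will be used at \<open>\<tau>\<close>, \<open>f\<close> at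
        \<open>\<alpha>\<close> and \<open>a\<close> at \<open>\<beta>\<close>. The arrow
        \<open>\<beta>\<close> closes the path \<open>\<alpha> \<cdot> \<tau>\<close> to the unit at
        \<open>x\<close>, where \<open>ind U\<close> has the value 1.\<close>
      define \<omega> where "\<omega> = \<alpha> \<cdot> \<tau>"
      define \<beta> where "\<beta> = ginv G \<omega>"
      have \<omega>: "\<omega> \<in> arrows G" "src \<omega> = x" "tgt \<omega> = tgt \<alpha>"
        unfolding \<omega>_def using \<tau> \<alpha>A \<alpha>(2) by (simp_all add: groupoid_simps)
      have \<beta>: "\<beta> \<in> arrows G" "src \<beta> = tgt \<alpha>" "tgt \<beta> = x" "\<beta> \<cdot> \<omega> = ?u" "\<omega> \<cdot> \<beta> = gunit G (tgt \<alpha>)"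
        unfolding \<beta>_def using \<omega> by (simp_all add: groupoid_simps comp_inv_left comp_inv_right)
      obtain b where b: "b \<in> bisec" "b \<tau> = \<one>\<^bsub>stalk \<O> (tgt \<tau>)\<^esub>"
        using bump[OF \<tau>(1) one_closed[OF rng_closed[OF \<tau>(1)]] openin_topspace \<tau>(1)] by blast
      note bS = bisec_sections[OF b(1)]
      have b_single: "\<sigma> = \<tau>" if "\<sigma> \<in> arrows G" "src \<sigma> = src \<tau>" "b \<sigma> \<noteq> val_zero \<sigma>" for \<sigma>
        using bisec_fibrewise_single[OF b(1)] that \<tau>(1) b(2) one_not_zero[OF rng_closed[OF \<tau>(1)]]
        by (auto simp: fibrewise_single_def)
      \<comment> \<open>At the unit the product will be \<open>a \<beta>\<close> times
        \<open>v\<close>. Transport along \<open>\<omega>\<close> returns \<open>f \<alpha>\<close>,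
        so \<open>v\<close> is nonzero and its inverse \<open>c\<close> is the value required of
        \<open>a\<close> at \<open>\<beta>\<close>.\<close>
      define v where "v = tr \<beta> (f \<alpha>)"
      have f\<alpha>: "f \<alpha> \<in> carrier (stalk \<O> (tgt \<alpha>))" by (rule sections_value[OF fS \<alpha>A(2)])
      have v: "v \<in> carrier (stalk \<O> x)"
        unfolding v_def using tr_closed[OF \<beta>(1), of "f \<alpha>"] f\<alpha> \<beta>(2,3) by simp
      have "tr \<omega> v = f \<alpha>"
        unfolding v_def using tr_comp[OF \<omega>(1) \<beta>(1), of "f \<alpha>"] \<omega>(2) \<beta>(2,3,5) f\<alpha>
          tr_unit[OF rng_closed[OF \<alpha>A(2)] f\<alpha>] by simp
      then have "v \<noteq> \<zero>\<^bsub>stalk \<O> x\<^esub>" using tr_zero[OF \<omega>(1)] \<omega>(2,3) \<alpha>A(3) by auto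
      then obtain c where c: "c \<in> carrier (stalk \<O> x)" "c \<otimes>\<^bsub>stalk \<O> x\<^esub> v = \<one>\<^bsub>stalk \<O> x\<^esub>"
        using stalk_inverse[OF x v] by metis
      \<comment> \<open>An \<open>a\<close> confined to arrows starting in the targets of
        \<open>A'\<close> only sees arrows of \<open>f\<close> ending there. This supplies the
        condition on targets in the choice of \<open>A'\<close>.\<close>
      let ?W = "{\<gamma> \<in> arrows G. src \<gamma> \<in> tgt ` A'}"
      have W: "openin T ?W" using rng_open A'(2) by (intro open_src_vimage) (simp add: open_map_def)
      have "\<beta> \<in> ?W" using \<beta>(1,2) \<alpha>(1) by auto
      moreover have "c \<in> carrier (stalk \<O> (tgt \<beta>))" using c(1) \<beta>(3) by simp
      ultimately obtain a B where a: "a \<in> bisec" "a \<beta> = c" "compact_open_bisection G B" "\<beta> \<in> B" "B \<subseteq> ?W"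
        and a_supp: "\<forall>\<gamma>\<in>arrows G. a \<gamma> \<noteq> val_zero \<gamma> \<longrightarrow> \<gamma> \<in> B"
        using bump[OF \<beta>(1) _ W] by blast
      note aS = bisec_sections[OF a(1)] and BD = compact_open_bisectionD[OF a(3)]
      note fbS = conv_closed[OF fS bS]
      have fb: "conv f b \<omega> = f \<alpha>"
      proof -
        interpret ring "stalk \<O> (tgt \<alpha>)" by (rule stalk_ring_rng[OF \<alpha>A(2)])
        have "conv f b \<omega> = f \<alpha> \<otimes>\<^bsub>stalk \<O> (tgt \<alpha>)\<^esub> tr \<alpha> (b \<tau>)"
          unfolding \<omega>_def by (rule conv_right_single[OF fS bS \<alpha>A(2) \<tau>(1) \<alpha>(2) b_single])
        also have "tr \<alpha> (b \<tau>) = \<one>\<^bsub>stalk \<O> (tgt \<alpha>)\<^esub>"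
          using tr_one[OF \<alpha>A(2)] b(2) \<alpha>(2) by simp
        finally show ?thesis using f\<alpha> by simp
      qed
      have at_unit: "conv a (conv f b) ?u = \<one>\<^bsub>stalk \<O> x\<^esub>"
      proof -
        have "\<sigma> = \<beta>" if "\<sigma> \<in> arrows G" "tgt \<sigma> = tgt \<beta>" "a \<sigma> \<noteq> val_zero \<sigma>" for \<sigma>
          using a_supp that a(4) BD(5) by (auto dest: inj_onD)
        then have "conv a (conv f b) (\<beta> \<cdot> \<omega>) = a \<beta> \<otimes>\<^bsub>stalk \<O> (tgt \<beta>)\<^esub> tr \<beta> (conv f b \<omega>)"
          using conv_left_single[OF aS fbS \<beta>(1) \<omega>(1)] \<beta>(2) \<omega>(3) by simp
        then show ?thesis using \<beta>(3,4) a(2) c(2) fb by (simp add: v_def)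
      qed
      \<comment> \<open>A nonzero value comes from a path \<beta>' \<delta> \<tau>'. The source
        forces \<tau>' = \<tau>; then \<delta> has its source and target among those of
        \<open>A'\<close>, so it lies in the bisection \<open>A\<close> and equals \<alpha>; finally
        \<beta>' = \<beta> because \<open>gdom\<close> is injective on \<open>B\<close>.\<close>
      have off_unit: "\<gamma> = ?u"
        if \<gamma>: "\<gamma> \<in> arrows G" "src \<gamma> = x" "conv a (conv f b) \<gamma> \<noteq> val_zero \<gamma>" for \<gamma>
      proof -
        obtain \<beta>' \<kappa> where k: "\<beta>' \<in> arrows G" "\<kappa> \<in> arrows G" "src \<beta>' = tgt \<kappa>" "\<gamma> = \<beta>' \<cdot> \<kappa>"
          "a \<beta>' \<noteq> val_zero \<beta>'" "conv f b \<kappa> \<noteq> val_zero \<kappa>"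
          by (rule conv_nonzero[OF aS fbS \<gamma>(1,3)])
        obtain \<delta> \<tau>' where d: "\<delta> \<in> arrows G" "\<tau>' \<in> arrows G" "src \<delta> = tgt \<tau>'" "\<kappa> = \<delta> \<cdot> \<tau>'"
          "f \<delta> \<noteq> val_zero \<delta>" "b \<tau>' \<noteq> val_zero \<tau>'"
          by (rule conv_nonzero[OF fS bS k(2,6)])
        have "src \<tau>' = src \<tau>" using k d \<gamma>(2) \<tau>(2) by (simp add: dom_comp)
        then have \<tau>': "\<tau>' = \<tau>" using b_single d(2,6) by blast
        have \<beta>'B: "\<beta>' \<in> B" using a_supp k(1,5) by blast
        have "tgt \<delta> = src \<beta>'" using k(3) d by (simp add: rng_comp)
        then have "tgt \<delta> \<in> tgt ` A'" using \<beta>'B a(5) by auto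
        moreover have "src \<delta> \<in> src ` A'" using \<alpha> d(3) \<tau>' by (metis imageI)
        moreover have "\<delta> \<in> \<Union>\<B>" using \<B>(3) d(1,5) by blast
        ultimately have "\<delta> \<in> A" using A'(4) by blast
        then have \<delta>: "\<delta> = \<alpha>" using inj_onD[OF AD(4) _ _ \<alpha>A(1)] \<alpha>(2) d(3) \<tau>' by simp
        then have \<kappa>: "\<kappa> = \<omega>" using d(4) \<tau>' by (simp add: \<omega>_def)
        then have "\<beta>' = \<beta>" using inj_onD[OF BD(4) _ \<beta>'B a(4)] k(3) \<beta>(2) \<omega>(3) by simp
        then show ?thesis using k(4) \<kappa> \<beta>(4) by simp
      qed
      have G: "a \<in> carrier \<Gamma>" "b \<in> carrier \<Gamma>" "conv a (conv f b) \<in> carrier \<Gamma>"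
        using a(1) b(1) f(1) by (simp_all add: bisec_Gamma Gamma_conv)
      have "(conv a (conv f b) \<ominus>\<^bsub>\<Gamma>\<^esub> ind U) \<gamma> = val_zero \<gamma>" if \<gamma>: "\<gamma> \<in> arrows G" "src \<gamma> = x" for \<gamma>
      proof -
        interpret ring "stalk \<O> (tgt \<gamma>)" by (rule stalk_ring_rng[OF \<gamma>(1)])
        have "conv a (conv f b) \<gamma> = ind U \<gamma>"
        proof (cases "\<gamma> = ?u")
          case True
          then show ?thesis using at_unit ind_unit[OF x U(3)] by simp
        next
          case False
          then show ?thesis using off_unit[OF \<gamma>] ind_nonzero(1)[OF \<gamma>(1) _ sub] \<gamma>(2) by metis
        qed
        then show ?thesis
          using \<gamma> sections_value[OF Gamma_sections[OF indG] \<gamma>(1)]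
          by (simp add: Gamma_minus_apply G(3) indG minus_eq r_neg)
      qed
      then have "conv a (conv f b) \<ominus>\<^bsub>\<Gamma>\<^esub> ind U \<in> L" using G(3) indG by (simp add: L_def)
      then show ?thesis using G(1,2) by (intro bexI[of _ a] bexI[of _ b]) (simp_all add: Gamma_simps(4))
    qed
  qed
qed

end


section \<open>The groupoid of germs\<close>

lemma unit_topology_germ_groupoid [simp]: "unit_topology (germ_groupoid X D \<theta>) = X"
  by (simp add: germ_groupoid_def)

context
  fixes X :: "'x topology" and D :: "'s::inverse_semigroup \<Rightarrow> 'x set" and \<theta> :: "'s \<Rightarrow> 'x \<Rightarrow> 'x"
  assumes act: "inverse_semigroup_action X D \<theta>"
begin

private abbreviation (input) "G \<equiv> germ_groupoid X D \<theta>"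

section \<open>Algebra of germs\<close>

lemma germ_arrow: "x \<in> D (star s) \<Longrightarrow> germ D s x \<in> arrows G"
  using arrows_germ_groupoid[OF act] by auto

lemma germ_arrowE:
  assumes "\<gamma> \<in> arrows G"
  obtains s x where "\<gamma> = germ D s x" "x \<in> D (star s)"
  using assms arrows_germ_groupoid[OF act] by auto

lemma mem_idem_range: "x \<in> D s \<Longrightarrow> x \<in> D (s * star s)"
  using act_dom[OF act, of s "star s"] act_image[OF act, of "star s"]
    star_idem[OF idem_mult_star, of s] by auto

lemma mem_idem:
  assumes "x \<in> topspace X"
  obtains e where "idem e" "x \<in> D e"
  using assms act_cover[OF act] mem_idem_range idem_mult_star by blast

lemma germ_groupoid_comp:
  assumes "x \<in> D (star t)" "\<theta> t x \<in> D (star s)"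
  shows "x \<in> D (star (s * t))" "\<theta> (s * t) x = \<theta> s (\<theta> t x)"
    "gcomp G (germ D s (\<theta> t x)) (germ D t x) = germ D (s * t) x"
proof -
  show *: "x \<in> D (star (s * t))" using act_dom[OF act, of s t] assms by simp
  show "\<theta> (s * t) x = \<theta> s (\<theta> t x)" by (rule act_mult[OF act *])
  show "gcomp G (germ D s (\<theta> t x)) (germ D t x) = germ D (s * t) x"
    by (rule gcomp_germ[OF act assms])
qed

text \<open>The representatives are aligned so that the left germ is based at
  \<open>\<theta> t x\<close> itself, the form in which \<open>gcomp_germ\<close> computes
  products.\<close>

lemma composable_germs:
  assumes "\<beta> \<in> arrows G" "\<gamma> \<in> arrows G" "gdom G \<beta> = grng G \<gamma>"
  obtains s t x where "\<beta> = germ D s (\<theta> t x)" "\<gamma> = germ D t x" "x \<in> D (star t)" "\<theta> t x \<in> D (star s)"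
proof -
  obtain s y where s: "\<beta> = germ D s y" "y \<in> D (star s)" using assms(1) by (rule germ_arrowE)
  obtain t x where t: "\<gamma> = germ D t x" "x \<in> D (star t)" using assms(2) by (rule germ_arrowE)
  have "y = \<theta> t x"
    using assms(3) gdom_germ[OF act s(2)] grng_germ[OF act t(2)] unfolding s(1) t(1) by simp
  then show thesis using that s t by blast
qed

lemma germ_groupoid_algebraic: "algebraic_groupoid G"
proof
  note gdom = gdom_germ[OF act] and grng = grng_germ[OF act] and comp = germ_groupoid_comp
  have sub: "D s \<subseteq> topspace X" for s by (rule act_subset[OF act])
  fix \<gamma> assume \<gamma>: "\<gamma> \<in> arrows G"
  obtain s x where s: "\<gamma> = germ D s x" "x \<in> D (star s)" using \<gamma> by (rule germ_arrowE)
  note \<theta>s = act_star[OF act s(2)]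
  have \<theta>s': "\<theta> s x \<in> D (star (star s))" using \<theta>s(1) by simp
  show "gdom G \<gamma> \<in> topspace (unit_topology G)" "grng G \<gamma> \<in> topspace (unit_topology G)"
    using s gdom grng subsetD[OF sub s(2)] subsetD[OF sub \<theta>s(1)] by simp_all
  have i: "ginv G \<gamma> = germ D (star s) (\<theta> s x)" using s ginv_germ[OF act] by simp
  show "ginv G \<gamma> \<in> arrows G" unfolding i using germ_arrow \<theta>s' by blast
  show "gdom G (ginv G \<gamma>) = grng G \<gamma>" "grng G (ginv G \<gamma>) = gdom G \<gamma>"
    unfolding i using gdom[OF \<theta>s'] grng[OF \<theta>s'] \<theta>s s gdom grng by auto
  have l: "\<theta> s x \<in> D (s * star s)" "\<theta> s x \<in> D (star (s * star s))"
    using mem_idem_range[OF \<theta>s(1)] star_idem[OF idem_mult_star, of s] by auto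
  have r: "x \<in> D (star s * s)" "x \<in> D (star (star s * s))" "\<theta> (star s * s) x = x"
    using mem_idem_range[OF s(2)] star_idem[OF idem_star_mult, of s]
      act_idem[OF act idem_star_mult, of x s] by auto
  show "gcomp G (gunit G (grng G \<gamma>)) \<gamma> = \<gamma>"
    unfolding s(1) grng[OF s(2)] gunit_germ[OF act idem_mult_star l(1)]
    using comp(3)[OF s(2) l(2)] by (simp add: star_inverse)
  show "gcomp G \<gamma> (gunit G (gdom G \<gamma>)) = \<gamma>"
    unfolding s(1) gdom[OF s(2)] gunit_germ[OF act idem_star_mult r(1)]
    using comp(3)[OF r(2), of s] s(2) r(3) by (simp add: star_inverse mult.assoc[symmetric])
  show "gcomp G (ginv G \<gamma>) \<gamma> = gunit G (gdom G \<gamma>)"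
    unfolding i unfolding s(1) gdom[OF s(2)] gunit_germ[OF act idem_star_mult r(1)]
    using comp(3)[OF s(2) \<theta>s'] .
  show "gcomp G \<gamma> (ginv G \<gamma>) = gunit G (grng G \<gamma>)"
    unfolding i unfolding s(1) grng[OF s(2)] gunit_germ[OF act idem_mult_star l(1)]
    using comp(3)[OF \<theta>s', of s] \<theta>s(2) s(2) by simp
next
  fix \<beta> \<gamma> assume bg: "\<beta> \<in> arrows G" "\<gamma> \<in> arrows G" "gdom G \<beta> = grng G \<gamma>"
  obtain s t x where s: "\<beta> = germ D s (\<theta> t x)" "\<gamma> = germ D t x" "x \<in> D (star t)" "\<theta> t x \<in> D (star s)"
    using bg by (rule composable_germs)
  note c = germ_groupoid_comp[OF s(3,4)]
  show "gcomp G \<beta> \<gamma> \<in> arrows G" using germ_arrow c s by simp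
  show "gdom G (gcomp G \<beta> \<gamma>) = gdom G \<gamma>"
    using c s gdom_germ[OF act c(1)] gdom_germ[OF act s(3)] by simp
  show "grng G (gcomp G \<beta> \<gamma>) = grng G \<beta>"
    using c s grng_germ[OF act c(1)] grng_germ[OF act s(4)] by simp
next
  fix \<alpha> \<beta> \<gamma>
  assume a: "\<alpha> \<in> arrows G" "\<beta> \<in> arrows G" "\<gamma> \<in> arrows G" "gdom G \<alpha> = grng G \<beta>" "gdom G \<beta> = grng G \<gamma>"
  obtain s t x where s: "\<beta> = germ D s (\<theta> t x)" "\<gamma> = germ D t x" "x \<in> D (star t)" "\<theta> t x \<in> D (star s)"
    using a(2,3,5) by (rule composable_germs)
  obtain q y where q: "\<alpha> = germ D q y" "y \<in> D (star q)" using a(1) by (rule germ_arrowE)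
  have y: "y = \<theta> s (\<theta> t x)"
    using a(4) gdom_germ[OF act q(2)] grng_germ[OF act s(4)] unfolding q(1) s(1) by simp
  note c = germ_groupoid_comp[OF s(3,4)]
  have y': "\<theta> s (\<theta> t x) \<in> D (star q)" "\<theta> (s * t) x \<in> D (star q)" using q(2) y c(2) by auto
  have 1: "gcomp G \<alpha> \<beta> = germ D (q * s) (\<theta> t x)"
    using germ_groupoid_comp(3)[OF s(4) y'(1)] q(1) s(1) y by simp
  have 2: "\<theta> t x \<in> D (star (q * s))" by (rule germ_groupoid_comp(1)[OF s(4) y'(1)])
  have "gcomp G (gcomp G \<alpha> \<beta>) \<gamma> = germ D (q * s * t) x"
    unfolding 1 using germ_groupoid_comp(3)[OF s(3) 2] s(2) by simp
  moreover have "gcomp G \<alpha> (gcomp G \<beta> \<gamma>) = germ D (q * (s * t)) x"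
    using germ_groupoid_comp(3)[OF c(1) y'(2)] c s q(1) y by simp
  ultimately show "gcomp G (gcomp G \<alpha> \<beta>) \<gamma> = gcomp G \<alpha> (gcomp G \<beta> \<gamma>)" by (simp add: mult.assoc)
next
  fix x assume "x \<in> topspace (unit_topology G)"
  then obtain e where e: "idem e" "x \<in> D e" using mem_idem by auto
  have e': "x \<in> D (star e)" using e star_idem[of e] by simp
  have u: "gunit G x = germ D e x" by (rule gunit_germ[OF act e])
  show "gunit G x \<in> arrows G" unfolding u by (rule germ_arrow[OF e'])
  show "gdom G (gunit G x) = x" unfolding u by (rule gdom_germ[OF act e'])
  show "grng G (gunit G x) = x"
    unfolding u using grng_germ[OF act e'] act_idem[OF act e] by simp
qed

section \<open>Topology of germs\<close>

lemma slice_open: "openin X U \<Longrightarrow> U \<subseteq> D (star s) \<Longrightarrow> openin (arrow_topology G) (slice D s U)"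
  unfolding germ_groupoid_def by (auto intro: topology_generated_by_Basis)

lemma slice_nbhd:
  assumes "openin (arrow_topology G) W" "\<gamma> \<in> W"
  obtains s V x where "openin X V" "V \<subseteq> D (star s)" "x \<in> V" "\<gamma> = germ D s x" "slice D s V \<subseteq> W"
proof -
  have "(arbitrary union_of (\<lambda>W. \<exists>s U. W = slice D s U \<and> openin X U \<and> U \<subseteq> D (star s))) W"
    using assms(1) unfolding slices_basis[OF act] .
  then obtain \<U> where \<U>: "\<U> \<subseteq> {W. \<exists>s U. W = slice D s U \<and> openin X U \<and> U \<subseteq> D (star s)}" "\<Union>\<U> = W"
    unfolding union_of_def by auto
  then obtain S where S: "S \<in> \<U>" "\<gamma> \<in> S" using assms(2) by blast
  then obtain s U where U: "S = slice D s U" "openin X U" "U \<subseteq> D (star s)" using \<U>(1) by blast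
  obtain x where "x \<in> U" "\<gamma> = germ D s x" using S(2) unfolding U(1) slice_def by blast
  moreover have "slice D s U \<subseteq> W" using S(1) U(1) \<U>(2) by blast
  ultimately show thesis using that[OF U(2,3)] by blast
qed

text \<open>The element \<open>u\<close> that witnesses equality at \<open>x\<close> also witnesses
  it at every point of the open set \<open>D (star u)\<close>.\<close>

lemma germ_eq_nbhd:
  assumes "x \<in> D (star s)" "x \<in> D (star t)" "germ D s x = germ D t x"
  obtains N where "openin X N" "x \<in> N" "\<And>z. z \<in> N \<Longrightarrow> germ D s z = germ D t z"
proof -
  obtain u where u: "u \<preceq> s" "u \<preceq> t" "x \<in> D (star u)"
    using assms(3) unfolding germ_eq_iff[OF act assms(1,2)] by blast
  have "germ D s z = germ D t z" if z: "z \<in> D (star u)" for z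
    using u(1,2) z by (subst germ_eq_iff[OF act]) (auto intro: act_le[OF act])
  then show thesis using that[OF act_open[OF act] u(3)] by blast
qed

text \<open>This is continuity of \<open>germ D s\<close> on its domain. The slice around
  \<open>germ D s x\<close> inside \<open>W\<close> may come from another element \<open>t\<close>,
  but near \<open>x\<close> the germs of \<open>s\<close> and \<open>t\<close> coincide by
  \<open>germ_eq_nbhd\<close>.\<close>

lemma germ_vimage_open:
  assumes W: "openin (arrow_topology G) W"
  shows "openin X {x \<in> D (star s). germ D s x \<in> W}"
proof (subst openin_subopen, clarify)
  fix x assume x: "x \<in> D (star s)" "germ D s x \<in> W"
  obtain t V y where V: "openin X V" "V \<subseteq> D (star t)" "y \<in> V" "germ D s x = germ D t y"
    "slice D t V \<subseteq> W" by (rule slice_nbhd[OF W x(2)])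
  have "y \<in> D (star t)" using V(2,3) by blast
  then have y: "y = x" using V(4) germ_eq_iff[OF act x(1), of y t] by blast
  have xt: "x \<in> D (star t)" "germ D s x = germ D t x" using V y by auto
  obtain N where N: "openin X N" "x \<in> N" "\<And>z. z \<in> N \<Longrightarrow> germ D s z = germ D t z"
    using germ_eq_nbhd[OF x(1) xt] by metis
  let ?N = "N \<inter> V \<inter> D (star s)"
  have "openin X ?N" by (intro openin_Int N V act_open[OF act])
  moreover have "x \<in> ?N" using N x V(3) y by auto
  moreover have "?N \<subseteq> {x \<in> D (star s). germ D s x \<in> W}"
    using N(3) V(5) by (auto simp: slice_def)
  ultimately show "\<exists>T. openin X T \<and> x \<in> T \<and> T \<subseteq> {x \<in> D (star s). germ D s x \<in> W}" by blast
qed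

text \<open>Slices over open sets are open and cover the arrows, so continuity can be tested in the
  base point for each fixed semigroup element.\<close>

lemma continuous_from_germs:
  assumes "\<And>s. continuous_map (subtopology X (D (star s))) Z (\<lambda>x. F (germ D s x))"
  shows "continuous_map (arrow_topology G) Z F"
  unfolding continuous_map
proof (intro conjI allI impI)
  have top: "topspace (subtopology X (D (star s))) = D (star s)" for s
    using act_subset[OF act] by auto
  show "F ` arrows G \<subseteq> topspace Z"
  proof clarify
    fix \<gamma> assume "\<gamma> \<in> arrows G"
    then obtain s x where "\<gamma> = germ D s x" "x \<in> D (star s)" by (rule germ_arrowE)
    then show "F \<gamma> \<in> topspace Z" using assms[of s] top continuous_map_funspace by fastforce
  qed
  fix V assume V: "openin Z V"
  show "openin (arrow_topology G) {\<gamma> \<in> arrows G. F \<gamma> \<in> V}"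
  proof (subst openin_subopen, clarify)
    fix \<gamma> assume \<gamma>: "\<gamma> \<in> arrows G" "F \<gamma> \<in> V"
    obtain s x where s: "\<gamma> = germ D s x" "x \<in> D (star s)" using \<gamma>(1) by (rule germ_arrowE)
    let ?U = "{x \<in> D (star s). F (germ D s x) \<in> V}"
    have "openin (subtopology X (D (star s))) ?U"
      using openin_continuous_map_preimage[OF assms V] unfolding top .
    then have "openin X ?U" using act_open[OF act] openin_trans_full by blast
    then have "openin (arrow_topology G) (slice D s ?U)" by (rule slice_open) auto
    moreover have "\<gamma> \<in> slice D s ?U" using s \<gamma>(2) by (auto simp: slice_def)
    moreover have "slice D s ?U \<subseteq> {\<gamma> \<in> arrows G. F \<gamma> \<in> V}"
      using germ_arrow by (auto simp: slice_def)
    ultimately show "\<exists>T. openin (arrow_topology G) T \<and> \<gamma> \<in> T \<and> T \<subseteq> {\<gamma> \<in> arrows G. F \<gamma> \<in> V}" by blast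
  qed
qed

lemma open_map_from_slices:
  assumes "\<And>s V. openin X V \<Longrightarrow> V \<subseteq> D (star s) \<Longrightarrow> openin Z (F ` slice D s V)"
  shows "open_map (arrow_topology G) Z F"
  unfolding open_map_def
proof (intro allI impI)
  fix W assume W: "openin (arrow_topology G) W"
  show "openin Z (F ` W)"
  proof (subst openin_subopen, clarify)
    fix \<gamma> assume "\<gamma> \<in> W"
    then obtain s V x where V: "openin X V" "V \<subseteq> D (star s)" "x \<in> V" "\<gamma> = germ D s x" "slice D s V \<subseteq> W"
      by (rule slice_nbhd[OF W])
    then have "F \<gamma> \<in> F ` slice D s V" by (auto simp: slice_def)
    then show "\<exists>T. openin Z T \<and> F \<gamma> \<in> T \<and> T \<subseteq> F ` W"
      using assms[OF V(1,2)] V(5) by blast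
  qed
qed

lemma src_slice: "V \<subseteq> D (star s) \<Longrightarrow> gdom G ` slice D s V = V"
  using gdom_germ[OF act] unfolding slice_def image_image by force

lemma tgt_slice: "V \<subseteq> D (star s) \<Longrightarrow> grng G ` slice D s V = \<theta> s ` V"
  using grng_germ[OF act] unfolding slice_def image_image by (intro image_cong) auto

lemma germ_groupoid_ample:
  assumes haus: "Hausdorff_space X" and zd: "zero_dimensional X"
    and hausG: "Hausdorff_space (arrow_topology G)"
  shows "ample_groupoid G"
proof (rule ample_groupoid.intro[OF germ_groupoid_algebraic], unfold_locales)
  interpret algebraic_groupoid G by (rule germ_groupoid_algebraic)
  let ?T = "arrow_topology G"
  have top: "topspace (subtopology X (D (star s))) = D (star s)" for s
    using act_subset[OF act] by auto
  show "zero_dimensional (unit_topology G)" "Hausdorff_space (unit_topology G)" "Hausdorff_space ?T"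
    using assms by simp_all
  have "continuous_map (subtopology X (D (star s))) X (\<lambda>x. gdom G (germ D s x))" for s
  proof (rule continuous_map_eq)
    show "continuous_map (subtopology X (D (star s))) X id"
      by (rule continuous_map_from_subtopology[OF continuous_map_id])
  qed (use top gdom_germ[OF act] in auto)
  then show "continuous_map ?T (unit_topology G) (gdom G)" by (simp add: continuous_from_germs)
  have "continuous_map (subtopology X (D (star s))) X (\<lambda>x. grng G (germ D s x))" for s
  proof (rule continuous_map_eq)
    show "continuous_map (subtopology X (D (star s))) X (\<theta> s)"
      by (rule continuous_map_into_fulltopology[OF
            homeomorphic_imp_continuous_map[OF act_homeo[OF act]]])
  qed (use top grng_germ[OF act] in auto)
  then show "continuous_map ?T (unit_topology G) (grng G)" by (simp add: continuous_from_germs)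
  have "open_map ?T X (gdom G)"
    by (rule open_map_from_slices) (simp add: src_slice)
  then show "open_map ?T (unit_topology G) (gdom G)" by simp
  have "open_map ?T X (grng G)"
  proof (rule open_map_from_slices)
    fix s V assume V: "openin X V" "V \<subseteq> D (star s)"
    have "open_map (subtopology X (D (star s))) (subtopology X (D s)) (\<theta> s)"
      by (rule homeomorphic_imp_open_map[OF act_homeo[OF act]])
    then have "openin (subtopology X (D s)) (\<theta> s ` V)"
      using V act_open[OF act] by (simp add: open_map_def openin_open_subtopology)
    then show "openin X (grng G ` slice D s V)"
      unfolding tgt_slice[OF V(2)] using act_open[OF act] openin_trans_full by blast
  qed
  then show "open_map ?T (unit_topology G) (grng G)" by simp
  let ?C = "{(\<beta>, \<gamma>). gdom G \<beta> = grng G \<gamma>}"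
  let ?P = "subtopology (prod_topology ?T ?T) ?C"
  show "continuous_map ?P ?T (\<lambda>(\<beta>, \<gamma>). gcomp G \<beta> \<gamma>)"
    unfolding continuous_map
  proof (intro conjI allI impI)
    show "(\<lambda>(\<beta>, \<gamma>). gcomp G \<beta> \<gamma>) ` topspace ?P \<subseteq> topspace ?T"
      using comp_closed by auto
    fix W assume W: "openin ?T W"
    show "openin ?P {q \<in> topspace ?P. (\<lambda>(\<beta>, \<gamma>). gcomp G \<beta> \<gamma>) q \<in> W}"
    proof (subst openin_subopen, clarify)
      fix \<beta> \<gamma> assume bg: "(\<beta>, \<gamma>) \<in> topspace ?P" "gcomp G \<beta> \<gamma> \<in> W"
      have "\<beta> \<in> arrows G" "\<gamma> \<in> arrows G" "gdom G \<beta> = grng G \<gamma>" using bg(1) by auto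
      then obtain s t x where s: "\<beta> = germ D s (\<theta> t x)" "\<gamma> = germ D t x" "x \<in> D (star t)"
          "\<theta> t x \<in> D (star s)"
        by (rule composable_germs)
      note c = germ_groupoid_comp[OF s(3,4)]
      \<comment> \<open>Composable germs of \<open>s\<close> and of \<open>t\<close> at z multiply
        to the germ of \<open>s * t\<close> at z. Restricting z to \<open>?U\<close> is thus enough
        to stay in \<open>W\<close>, and the left factor may range over its full slice.\<close>
      let ?U = "{z \<in> D (star (s * t)). germ D (s * t) z \<in> W}"
      have U: "openin X ?U" by (rule germ_vimage_open[OF W])
      have Ut: "?U \<subseteq> D (star t)" using act_dom[OF act, of s t] by auto
      let ?Q = "(slice D s (D (star s)) \<times> slice D t ?U) \<inter> ?C"
      have "openin ?P ?Q"
        using slice_open[OF act_open[OF act] order_refl, of s] slice_open[OF U Ut]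
        by (intro openin_subtopology_Int) (simp add: openin_prod_Times_iff)
      moreover have "(\<beta>, \<gamma>) \<in> ?Q" using s c bg by (auto simp: slice_def)
      moreover have "?Q \<subseteq> {q \<in> topspace ?P. (\<lambda>(\<beta>, \<gamma>). gcomp G \<beta> \<gamma>) q \<in> W}"
      proof
        fix q assume "q \<in> ?Q"
        then obtain \<beta>' \<gamma>' where qq: "q = (\<beta>', \<gamma>')" and
          q: "\<beta>' \<in> slice D s (D (star s))" "\<gamma>' \<in> slice D t ?U" "gdom G \<beta>' = grng G \<gamma>'" by blast
        obtain y where y: "\<beta>' = germ D s y" "y \<in> D (star s)" using q(1) by (auto simp: slice_def)
        obtain z where z: "\<gamma>' = germ D t z" "z \<in> ?U" using q(2) by (auto simp: slice_def)
        have zt: "z \<in> D (star t)" using z(2) Ut by blast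
        have yz: "y = \<theta> t z"
          using q(3) gdom_germ[OF act y(2)] grng_germ[OF act zt] y(1) z(1) by simp
        have "gcomp G \<beta>' \<gamma>' = germ D (s * t) z"
          using germ_groupoid_comp(3)[OF zt, of s] y z(1) yz by simp
        then have "gcomp G \<beta>' \<gamma>' \<in> W" using z(2) by simp
        moreover have "(\<beta>', \<gamma>') \<in> topspace ?P"
          using germ_arrow[OF y(2)] germ_arrow[OF zt] y(1) z(1) q(3) by simp
        ultimately show "q \<in> {q \<in> topspace ?P. (\<lambda>(\<beta>, \<gamma>). gcomp G \<beta> \<gamma>) q \<in> W}"
          unfolding qq by simp
      qed
      ultimately show "\<exists>S. openin ?P S \<and> (\<beta>, \<gamma>) \<in> S \<and>
          S \<subseteq> {q \<in> topspace ?P. (\<lambda>(\<beta>, \<gamma>). gcomp G \<beta> \<gamma>) q \<in> W}" by blast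
    qed
  qed
  have "continuous_map X ?T (gunit G)"
    unfolding continuous_map
  proof (intro conjI allI impI)
    show "gunit G ` topspace X \<subseteq> arrows G" using unit_closed by auto
    fix W assume W: "openin ?T W"
    show "openin X {x \<in> topspace X. gunit G x \<in> W}"
    proof (subst openin_subopen, clarify)
      fix x assume x: "x \<in> topspace X" "gunit G x \<in> W"
      obtain e where e: "idem e" "x \<in> D e" by (rule mem_idem[OF x(1)])
      \<comment> \<open>Near \<open>x\<close> the units are the germs of the one idempotent
        \<open>e\<close>, so the claim reduces to continuity of \<open>germ D e\<close>.\<close>
      let ?U = "{z \<in> D (star e). germ D e z \<in> W}"
      have "openin X ?U" by (rule germ_vimage_open[OF W])
      moreover have "x \<in> ?U" using x(2) e gunit_germ[OF act e] star_idem[OF e(1)] by simp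
      moreover have "?U \<subseteq> {x \<in> topspace X. gunit G x \<in> W}"
        using gunit_germ[OF act e(1)] star_idem[OF e(1)] act_subset[OF act] by auto
      ultimately show "\<exists>S. openin X S \<and> x \<in> S \<and> S \<subseteq> {x \<in> topspace X. gunit G x \<in> W}" by blast
    qed
  qed
  then show "continuous_map (unit_topology G) ?T (gunit G)" by simp
  fix \<gamma> assume "\<gamma> \<in> arrows G"
  then obtain s x where s: "\<gamma> = germ D s x" "x \<in> D (star s)" by (rule germ_arrowE)
  let ?B = "slice D s (D (star s))"
  have "inj_on (gdom G) ?B" "inj_on (grng G) ?B"
    using gdom_germ[OF act, of _ s] grng_germ[OF act, of _ s] act_inj[OF act, of s]
    by (auto simp: inj_on_def slice_def)
  then show "\<exists>B. openin ?T B \<and> \<gamma> \<in> B \<and> inj_on (gdom G) B \<and> inj_on (grng G) B"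
    using s slice_open[OF act_open[OF act] order_refl, of s]
    by (intro exI[of _ ?B]) (auto simp: slice_def)
qed

section \<open>Effectiveness and orbits of the groupoid of germs\<close>

text \<open>With \<alpha> = [s,x] and \<beta> = [t,x], equality of targets over common sources makes
  \<open>star s * t\<close> fix a neighbourhood of \<open>x\<close> pointwise. Freeness gives an
  idempotent \<open>e\<close> below \<open>star s * t\<close> with \<open>x\<close> in
  \<open>D e\<close>, and \<open>s * e\<close> is then a common restriction of \<open>s\<close> and
  \<open>t\<close> defined at \<open>x\<close>.\<close>

lemma germ_groupoid_effective:
  assumes free: "topologically_free X D \<theta>"
    and AB: "openin (arrow_topology G) A" "openin (arrow_topology G) B" "\<alpha> \<in> A" "\<beta> \<in> B"
    and eq: "gdom G \<alpha> = gdom G \<beta>"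
      "\<And>\<alpha>' \<beta>'. \<lbrakk>\<alpha>' \<in> A; \<beta>' \<in> B; gdom G \<alpha>' = gdom G \<beta>'\<rbrakk> \<Longrightarrow> grng G \<alpha>' = grng G \<beta>'"
  shows "\<alpha> = \<beta>"
proof -
  obtain s V x where V: "openin X V" "V \<subseteq> D (star s)" "x \<in> V" "\<alpha> = germ D s x" "slice D s V \<subseteq> A"
    by (rule slice_nbhd[OF AB(1,3)])
  obtain t V' y where V': "openin X V'" "V' \<subseteq> D (star t)" "y \<in> V'" "\<beta> = germ D t y" "slice D t V' \<subseteq> B"
    by (rule slice_nbhd[OF AB(2,4)])
  have xs: "x \<in> D (star s)" and yt: "y \<in> D (star t)" using V V' by auto
  have y: "y = x" using eq(1) gdom_germ[OF act xs] gdom_germ[OF act yt] V(4) V'(4) by simp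
  let ?u = "star s * t"
  have fixed: "z \<in> D (star ?u) \<and> \<theta> ?u z = z" if z: "z \<in> V \<inter> V'" for z
  proof -
    have zs: "z \<in> D (star s)" "z \<in> D (star t)" using z V(2) V'(2) by auto
    have "grng G (germ D s z) = grng G (germ D t z)"
      using z V(5) V'(5) gdom_germ[OF act zs(1)] gdom_germ[OF act zs(2)]
      by (intro eq(2)) (auto simp: slice_def)
    then have "\<theta> t z = \<theta> s z" using grng_germ[OF act zs(1)] grng_germ[OF act zs(2)] by simp
    then show ?thesis
      using germ_groupoid_comp(1,2)[OF zs(2), of "star s"] act_star[OF act zs(1)] by simp
  qed
  have "V \<inter> V' \<subseteq> X interior_of {x \<in> D (star ?u). \<theta> ?u x = x}"
    using fixed V(1) V'(1) by (intro interior_of_maximal) auto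
  moreover have "x \<in> V \<inter> V'" using V(3) V'(3) y by blast
  ultimately obtain e where e: "idem e" "e \<preceq> ?u" "x \<in> D e"
    using free unfolding topologically_free_def by blast
  obtain f where f: "idem f" "e = ?u * f" using e(2) by (auto simp: natural_le_def)
  let ?g = "star t * (s * star s) * t"
  \<comment> \<open>Moving the idempotent \<open>s * star s\<close> past \<open>t\<close> exhibits
    \<open>s * e\<close> as \<open>t\<close> times an idempotent.\<close>
  have "s * e = s * star s * t * f" by (simp add: f(2) mult.assoc)
  also have "\<dots> = t * ?g * f" using idem_conj(2)[OF idem_mult_star, of t s] by simp
  finally have "s * e = t * (?g * f)" by (simp add: mult.assoc)
  moreover have "idem (?g * f)" by (intro idem_mult idem_conj(1) idem_mult_star f(1))
  ultimately have "s * e \<preceq> t" by (auto simp: natural_le_def)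
  moreover have "s * e \<preceq> s" using e(1) by (auto simp: natural_le_def)
  moreover have "x \<in> D (star (s * e))" using act_mult_idem(1)[OF act e(1)] xs e(3) by blast
  ultimately show ?thesis
    unfolding V(4) V'(4) y using germ_eq_iff[OF act xs, of x t] yt y by blast
qed

lemma act_orbit_eq: "act_orbit D \<theta> x = grng G ` {\<gamma> \<in> arrows G. gdom G \<gamma> = x}"
proof (intro equalityI subsetI)
  fix y assume "y \<in> act_orbit D \<theta> x"
  then obtain s where s: "y = \<theta> s x" "x \<in> D (star s)" by (auto simp: act_orbit_def)
  then show "y \<in> grng G ` {\<gamma> \<in> arrows G. gdom G \<gamma> = x}"
    by (intro image_eqI[of _ _ "germ D s x"])
      (simp_all add: gdom_germ[OF act] grng_germ[OF act] germ_arrow)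
next
  fix y assume "y \<in> grng G ` {\<gamma> \<in> arrows G. gdom G \<gamma> = x}"
  then obtain \<gamma> where \<gamma>: "y = grng G \<gamma>" "\<gamma> \<in> arrows G" "gdom G \<gamma> = x" by blast
  obtain s z where "\<gamma> = germ D s z" "z \<in> D (star s)" using \<gamma>(2) by (rule germ_arrowE)
  then show "y \<in> act_orbit D \<theta> x"
    using \<gamma> gdom_germ[OF act] grng_germ[OF act] by (auto simp: act_orbit_def)
qed

end

theorem corollary5p7:
  fixes X :: "'x topology"
    and D :: "'s::inverse_semigroup \<Rightarrow> 'x set"
    and \<theta> :: "'s \<Rightarrow> 'x \<Rightarrow> 'x"
    and \<O> :: "(('s \<times> 'x) set, 'x, 'e) gsheaf_of_rings"
  assumes "locally_compact_space X" and "Hausdorff_space X" and "zero_dimensional X"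
    and "inverse_semigroup_action X D \<theta>"
    and "topologically_free X D \<theta>"
    and "is_gsheaf_of_fields (germ_groupoid X D \<theta>) \<O>"
    and "Hausdorff_space (arrow_topology (germ_groupoid X D \<theta>))"
  shows "(\<exists>x \<in> topspace X. X closure_of (act_orbit D \<theta> x) = topspace X) \<longleftrightarrow>
         left_primitive (Gamma_c (germ_groupoid X D \<theta>) \<O>)"
proof -
  let ?G = "germ_groupoid X D \<theta>"
  interpret ample_groupoid ?G by (rule germ_groupoid_ample[OF assms(4,2,3,7)])
  interpret effective_field_sheaf ?G \<O>
  proof (intro effective_field_sheaf.intro ample_sheaf.intro sheaf_groupoid.intro
      sheaf_groupoid_axioms.intro effective_field_sheaf_axioms.intro
      ample_groupoid_axioms algebraic_groupoid_axioms)
    show "is_gsheaf_of_rings ?G \<O>"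
      and "\<And>x. x \<in> topspace (unit_topology ?G) \<Longrightarrow> field (stalk \<O> x)"
      using assms(6) by (auto simp: is_gsheaf_of_fields_def)
  qed (rule germ_groupoid_effective[OF assms(4,5)])
  have "act_orbit D \<theta> x = orbit x" for x
    unfolding orbit_def by (rule act_orbit_eq[OF assms(4)])
  then show ?thesis
    using dense_orbit_if_left_primitive left_primitive_if_dense_orbit by auto
qed

end
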